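(* Let $m\ge1$ be an integer and consider the equation $$i\frac{\partial\psi}{\partial t}=\frac{(-1)^m}{2}\partial_x^{2m}\psi-|\psi|^{p-2}\psi,\qquad \psi=\psi(t,x)\in\mathbb{C},\ x\in\mathbb{R}. \qquad ( * )$$ Assume that the Cauchy problem for $( * )$ is globally well posed in $H^{m}$. Then $( * )$ admits hylomorphic solitons $u_\delta$, $\delta\in(0,\delta_\infty)$ (for some $\delta_\infty>0$), provided that $$2<p<4m+2 .$$ Moreover, for every $\delta\in(0,\delta_\infty)$ there is a suitable $\omega_\delta\in\mathbb{R}$ such that $u_\delta$ is a (weak) solution of $$\frac{(-1)^m}{2}\partial_x^{2m}u-|u|^{p-2}u=\omega_\delta u$$ and $U_\delta(t,x)=u_\delta(x)e^{-i\omega_\delta t}$ solves $( * )$.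
   Context: Fourier transform: $\hat w(\xi)=\frac1{\sqrt{2\pi}}\int w(y)e^{-iy\xi}\,dy$; $H^{s}$ is the Sobolev space on $\mathbb{R}$ with norm $\left(\int(1+|\xi|^{2s})|\hat u(\xi)|^2d\xi\right)^{1/2}$. "Weak solution" means solution in the sense of distributions. Setting: $X=H^{m}$ (complex-valued functions), with energy and hylenic charge $$E(\psi)=\int\Big(\tfrac12|\partial_x^{m}\psi|^2-\tfrac2p|\psi|^p\Big)dx,\qquad C(\psi)=\int|\psi|^2\,dx .$$ Flow: for $u_0\in X$, $T(u_0)\ge 0$ is the supremum of the $\tau\in[0,+\infty)$ such that for all $t\in[0,\tau)$ the solution $u(t,\cdot)$ of the evolution equation with initial value $u_0$ satisfies: $u(t,\cdot)$ is the unique solution in $X$; the solution is continuous at every point $(t,v)$ (time, initial datum) of $Z=\{(t,v)\in\mathbb{R}\times X: t\in[0,T(v))\}$; and $t\mapsto E(u(t,\cdot))$, $t\mapsto C(u(t,\cdot))$ are constant. Write $\gamma_tu_0:=u(t,\cdot)$ for $t\in[0,T(u_0))$; $(X,\gamma)$ is regarded as a dynamical system, i.e. $\gamma:Z\to X$ is continuous, $\gamma_0(u)=u$ and $\gamma_t\circ\gamma_r(u)=\gamma_{t+r}(u)$ when $t+r\in[0,T(u))$. Set $X_0=\{u\in X:T(u)=+\infty\}$. A set $\Gamma\subset X$ is invariant if $\gamma_tu\in\Gamma$ for all $u\in\Gamma$, $t\in[0,T(u))$. An invariant set $\Gamma$ is (orbitally) stable if for every $\varepsilon>0$ there is $\eta>0$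 such that for all $u\in X$, $d(u,\Gamma)\le\eta$ implies $d(\gamma_tu,\Gamma)\le\varepsilon$ for all $t\in[0,T(u))$. A soliton is a state $u\in\Gamma\subset X_0$, where $\Gamma$ is (i) an invariant, stable set and (ii) compact up to translations: every sequence $u_n\in\Gamma$ has a subsequence $u_{n_k}$ and a sequence $\tau_k\in\mathbb{R}$ such that $u_{n_k}(\cdot-\tau_k)$ converges in $X$. A soliton $u_0$ is hylomorphic if the corresponding $\Gamma$ has the form $\Gamma=\{u\in X: E(u)=e_0,\ |C(u)|=c_0\}$ with $e_0=\min\{E(u):u\in X,\ |C(u)|=c_0\}$. *)

theory Defs
  imports "HOL-Analysis.Analysis"
begin

text \<open>
  Elements of $L^2$ and of the Sobolev spaces are represented by Borel functions on the line, with
  no quotient taken: equality of elements is equality almost everywhere, and the Sobolev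
  distance is a pseudometric on representatives.
\<close>

section \<open>Sobolev spaces through the Fourier transform\<close>

definition L2 :: "(real \<Rightarrow> complex) set" where
  "L2 = {u. u \<in> borel_measurable lborel \<and> integrable lborel (\<lambda>x. (cmod (u x))\<^sup>2)}"

definition fourier_trunc :: "real \<Rightarrow> (real \<Rightarrow> complex) \<Rightarrow> real \<Rightarrow> complex" where
  "fourier_trunc R u \<xi> =
     (LINT y:{-R..R}|lborel. u y * exp (- \<i> * complex_of_real (y * \<xi>))) / complex_of_real (sqrt (2 * pi))"

text \<open>
  The Fourier integral of an $L^2$ function need not converge absolutely, so the transform is the
  limit in $L^2$ of the integrals over $[-R,R]$.
\<close>

definition is_fourier :: "(real \<Rightarrow> complex) \<Rightarrow> (real \<Rightarrow> complex) \<Rightarrow> bool" where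
  "is_fourier u v \<longleftrightarrow> v \<in> L2 \<and>
     ((\<lambda>R. \<integral>\<^sup>+\<xi>. ennreal ((cmod (fourier_trunc R u \<xi> - v \<xi>))\<^sup>2) \<partial>lborel) \<longlongrightarrow> 0) at_top"

definition fourier :: "(real \<Rightarrow> complex) \<Rightarrow> real \<Rightarrow> complex" where
  "fourier u = (SOME v. is_fourier u v)"

definition sobolev :: "nat \<Rightarrow> (real \<Rightarrow> complex) set" where
  "sobolev m = {u \<in> L2. integrable lborel (\<lambda>\<xi>. (1 + \<bar>\<xi>\<bar> ^ (2 * m)) * (cmod (fourier u \<xi>))\<^sup>2)}"

definition sobolev_norm :: "nat \<Rightarrow> (real \<Rightarrow> complex) \<Rightarrow> real" where
  "sobolev_norm m u = sqrt (LINT \<xi>|lborel. (1 + \<bar>\<xi>\<bar> ^ (2 * m)) * (cmod (fourier u \<xi>))\<^sup>2)"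

definition sobolev_dist :: "nat \<Rightarrow> (real \<Rightarrow> complex) \<Rightarrow> (real \<Rightarrow> complex) \<Rightarrow> real" where
  "sobolev_dist m u v = sobolev_norm m (\<lambda>x. u x - v x)"

definition sobolev_setdist :: "nat \<Rightarrow> (real \<Rightarrow> complex) \<Rightarrow> (real \<Rightarrow> complex) set \<Rightarrow> real" where
  "sobolev_setdist m u \<Gamma> = (INF v\<in>\<Gamma>. sobolev_dist m u v)"

section \<open>Test functions and weak derivatives\<close>

definition deriv_x :: "(real \<Rightarrow> complex) \<Rightarrow> real \<Rightarrow> complex" where
  "deriv_x f = (\<lambda>x. vector_derivative f (at x))"

definition test_fun :: "(real \<Rightarrow> complex) \<Rightarrow> bool" where
  "test_fun \<phi> \<longleftrightarrow> (\<forall>n x. (deriv_x ^^ n) \<phi> differentiable (at x)) \<and>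
     (\<exists>K. compact K \<and> (\<forall>x. x \<notin> K \<longrightarrow> \<phi> x = 0))"

definition is_weak_deriv :: "nat \<Rightarrow> (real \<Rightarrow> complex) \<Rightarrow> (real \<Rightarrow> complex) \<Rightarrow> bool" where
  "is_weak_deriv n u v \<longleftrightarrow>
     (\<forall>a b. set_integrable lborel {a..b} v) \<and>
     (\<forall>\<phi>. test_fun \<phi> \<longrightarrow>
        (LINT x|lborel. v x * \<phi> x) = (-1) ^ n * (LINT x|lborel. u x * (deriv_x ^^ n) \<phi> x))"

definition weak_deriv :: "nat \<Rightarrow> (real \<Rightarrow> complex) \<Rightarrow> real \<Rightarrow> complex" where
  "weak_deriv n u = (SOME v. is_weak_deriv n u v)"

definition partial_t :: "(real \<Rightarrow> real \<Rightarrow> complex) \<Rightarrow> real \<Rightarrow> real \<Rightarrow> complex" where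
  "partial_t \<phi> = (\<lambda>t x. vector_derivative (\<lambda>s. \<phi> s x) (at t))"

definition partial_x :: "(real \<Rightarrow> real \<Rightarrow> complex) \<Rightarrow> real \<Rightarrow> real \<Rightarrow> complex" where
  "partial_x \<phi> = (\<lambda>t. deriv_x (\<phi> t))"

text \<open>
  Smooth functions of time and space with compact support in $J \times R$, for $J$ an open
  set of times. Asking only for the partial derivatives in the order $\partial_t^i \partial_x^j$
  is enough: they are continuous, so by Schwarz's theorem the other orders give the same functions.
\<close>

definition test_fun2 :: "real set \<Rightarrow> (real \<Rightarrow> real \<Rightarrow> complex) \<Rightarrow> bool" where
  "test_fun2 J \<phi> \<longleftrightarrow>
     (\<forall>i j. let g = (partial_t ^^ i) ((partial_x ^^ j) \<phi>) in
        continuous_on UNIV (\<lambda>(t, x). g t x) \<and>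
        (\<forall>t x. (\<lambda>s. g s x) differentiable (at t)) \<and>
        (\<forall>t x. g t differentiable (at x))) \<and>
     (\<exists>K. compact K \<and> K \<subseteq> J \<times> UNIV \<and> (\<forall>t x. (t, x) \<notin> K \<longrightarrow> \<phi> t x = 0))"

section \<open>The equation\<close>

definition nonlin :: "real \<Rightarrow> complex \<Rightarrow> complex" where
  "nonlin p z = complex_of_real (cmod z powr (p - 2)) * z"

text \<open>
  Distributional form of
  $i \partial_t \psi = \frac{(-1)^m}{2} \partial_x^{2m} \psi - |\psi|^{p-2} \psi$ on the interior of
  the time interval $I$, for $\psi \in C(I; H^m)$. Moving $\partial_t$ to the test function gives
  one sign and moving $\partial_x^{2m}$ gives none. The integrals are iterated because
  representatives chosen time by time need not be jointly measurable.
\<close>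

definition solution_on :: "nat \<Rightarrow> real \<Rightarrow> real set \<Rightarrow> (real \<Rightarrow> real \<Rightarrow> complex) \<Rightarrow> bool" where
  "solution_on m p I \<psi> \<longleftrightarrow>
     (\<forall>t\<in>I. \<psi> t \<in> sobolev m) \<and>
     (\<forall>t\<in>I. ((\<lambda>s. sobolev_dist m (\<psi> s) (\<psi> t)) \<longlongrightarrow> 0) (at t within I)) \<and>
     (\<forall>\<phi>. test_fun2 (interior I) \<phi> \<longrightarrow>
        - \<i> * (LINT t|lborel. LINT x|lborel. \<psi> t x * partial_t \<phi> t x) =
        (-1) ^ m / 2 * (LINT t|lborel. LINT x|lborel. \<psi> t x * (partial_x ^^ (2 * m)) \<phi> t x)
        - (LINT t|lborel. LINT x|lborel. nonlin p (\<psi> t x) * \<phi> t x))"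

definition cauchy_solution ::
  "nat \<Rightarrow> real \<Rightarrow> real \<Rightarrow> (real \<Rightarrow> complex) \<Rightarrow> (real \<Rightarrow> real \<Rightarrow> complex) \<Rightarrow> bool" where
  "cauchy_solution m p \<tau> u\<^sub>0 \<psi> \<longleftrightarrow>
     solution_on m p {0..<\<tau>} \<psi> \<and> (0 < \<tau> \<longrightarrow> (AE x in lborel. \<psi> 0 x = u\<^sub>0 x))"

definition stationary_solution :: "nat \<Rightarrow> real \<Rightarrow> real \<Rightarrow> (real \<Rightarrow> complex) \<Rightarrow> bool" where
  "stationary_solution m p \<omega> u \<longleftrightarrow>
     (\<forall>\<phi>. test_fun \<phi> \<longrightarrow>
        (-1) ^ m / 2 * (LINT x|lborel. u x * (deriv_x ^^ (2 * m)) \<phi> x)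
        - (LINT x|lborel. nonlin p (u x) * \<phi> x)
        = complex_of_real \<omega> * (LINT x|lborel. u x * \<phi> x))"

definition energy :: "nat \<Rightarrow> real \<Rightarrow> (real \<Rightarrow> complex) \<Rightarrow> real" where
  "energy m p u =
     (LINT x|lborel. 1 / 2 * (cmod (weak_deriv m u x))\<^sup>2 - 2 / p * cmod (u x) powr p)"

definition charge :: "(real \<Rightarrow> complex) \<Rightarrow> real" where
  "charge u = (LINT x|lborel. (cmod (u x))\<^sup>2)"

section \<open>The flow\<close>

definition flow_domain :: "nat \<Rightarrow> ((real \<Rightarrow> complex) \<Rightarrow> ereal) \<Rightarrow> (real \<times> (real \<Rightarrow> complex)) set" where
  "flow_domain m T = {(t, v). v \<in> sobolev m \<and> 0 \<le> t \<and> ereal t < T v}"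

definition flow_continuous_at ::
  "nat \<Rightarrow> ((real \<Rightarrow> complex) \<Rightarrow> ereal) \<Rightarrow> (real \<Rightarrow> (real \<Rightarrow> complex) \<Rightarrow> real \<Rightarrow> complex) \<Rightarrow>
   real \<Rightarrow> (real \<Rightarrow> complex) \<Rightarrow> bool" where
  "flow_continuous_at m T \<gamma> t v \<longleftrightarrow>
     (\<forall>\<epsilon>>0. \<exists>\<eta>>0. \<forall>(s, w) \<in> flow_domain m T.
        \<bar>s - t\<bar> < \<eta> \<and> sobolev_dist m w v < \<eta> \<longrightarrow> sobolev_dist m (\<gamma> s w) (\<gamma> t v) < \<epsilon>)"

definition well_behaved_until ::
  "nat \<Rightarrow> real \<Rightarrow> ((real \<Rightarrow> complex) \<Rightarrow> ereal) \<Rightarrow> (real \<Rightarrow> (real \<Rightarrow> complex) \<Rightarrow> real \<Rightarrow> complex) \<Rightarrow>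
   (real \<Rightarrow> complex) \<Rightarrow> real \<Rightarrow> bool" where
  "well_behaved_until m p T \<gamma> u\<^sub>0 \<tau> \<longleftrightarrow>
     cauchy_solution m p \<tau> u\<^sub>0 (\<lambda>t. \<gamma> t u\<^sub>0) \<and>
     (\<forall>\<psi>. cauchy_solution m p \<tau> u\<^sub>0 \<psi> \<longrightarrow>
        (\<forall>t\<in>{0..<\<tau>}. AE x in lborel. \<psi> t x = \<gamma> t u\<^sub>0 x)) \<and>
     (\<forall>t\<in>{0..<\<tau>}. flow_continuous_at m T \<gamma> t u\<^sub>0) \<and>
     (\<forall>t\<in>{0..<\<tau>}. energy m p (\<gamma> t u\<^sub>0) = energy m p u\<^sub>0 \<and> charge (\<gamma> t u\<^sub>0) = charge u\<^sub>0)"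

text \<open>
  The lifespan $T$ occurs on both sides, since the continuity requirement refers to the domain of
  the flow. It is therefore characterised by an equation rather than defined.
\<close>

definition is_flow ::
  "nat \<Rightarrow> real \<Rightarrow> ((real \<Rightarrow> complex) \<Rightarrow> ereal) \<Rightarrow> (real \<Rightarrow> (real \<Rightarrow> complex) \<Rightarrow> real \<Rightarrow> complex) \<Rightarrow> bool" where
  "is_flow m p T \<gamma> \<longleftrightarrow>
     (\<forall>u\<^sub>0\<in>sobolev m. T u\<^sub>0 = Sup {ereal \<tau> |\<tau>. 0 \<le> \<tau> \<and> well_behaved_until m p T \<gamma> u\<^sub>0 \<tau>})"

definition global_states :: "nat \<Rightarrow> ((real \<Rightarrow> complex) \<Rightarrow> ereal) \<Rightarrow> (real \<Rightarrow> complex) set" where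
  "global_states m T = {u \<in> sobolev m. T u = \<infinity>}"

definition globally_well_posed ::
  "nat \<Rightarrow> real \<Rightarrow> ((real \<Rightarrow> complex) \<Rightarrow> ereal) \<Rightarrow> (real \<Rightarrow> (real \<Rightarrow> complex) \<Rightarrow> real \<Rightarrow> complex) \<Rightarrow> bool" where
  "globally_well_posed m p T \<gamma> \<longleftrightarrow> is_flow m p T \<gamma> \<and> global_states m T = sobolev m"

section \<open>Solitons\<close>

definition invariant_set ::
  "((real \<Rightarrow> complex) \<Rightarrow> ereal) \<Rightarrow> (real \<Rightarrow> (real \<Rightarrow> complex) \<Rightarrow> real \<Rightarrow> complex) \<Rightarrow>
   (real \<Rightarrow> complex) set \<Rightarrow> bool" where
  "invariant_set T \<gamma> \<Gamma> \<longleftrightarrow> (\<forall>u\<in>\<Gamma>. \<forall>t. 0 \<le> t \<and> ereal t < T u \<longrightarrow> \<gamma> t u \<in> \<Gamma>)"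

definition stable_set ::
  "nat \<Rightarrow> ((real \<Rightarrow> complex) \<Rightarrow> ereal) \<Rightarrow> (real \<Rightarrow> (real \<Rightarrow> complex) \<Rightarrow> real \<Rightarrow> complex) \<Rightarrow>
   (real \<Rightarrow> complex) set \<Rightarrow> bool" where
  "stable_set m T \<gamma> \<Gamma> \<longleftrightarrow>
     (\<forall>\<epsilon>>0. \<exists>\<eta>>0. \<forall>u\<in>sobolev m. sobolev_setdist m u \<Gamma> \<le> \<eta> \<longrightarrow>
        (\<forall>t. 0 \<le> t \<and> ereal t < T u \<longrightarrow> sobolev_setdist m (\<gamma> t u) \<Gamma> \<le> \<epsilon>))"

definition compact_up_to_translations :: "nat \<Rightarrow> (real \<Rightarrow> complex) set \<Rightarrow> bool" where
  "compact_up_to_translations m \<Gamma> \<longleftrightarrow>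
     (\<forall>u. (\<forall>n::nat. u n \<in> \<Gamma>) \<longrightarrow>
        (\<exists>r \<tau>. strict_mono (r :: nat \<Rightarrow> nat) \<and>
           (\<exists>w\<in>sobolev m. (\<lambda>k. sobolev_dist m (\<lambda>x. u (r k) (x - \<tau> k)) w) \<longlonglongrightarrow> 0)))"

definition soliton_set ::
  "nat \<Rightarrow> ((real \<Rightarrow> complex) \<Rightarrow> ereal) \<Rightarrow> (real \<Rightarrow> (real \<Rightarrow> complex) \<Rightarrow> real \<Rightarrow> complex) \<Rightarrow>
   (real \<Rightarrow> complex) set \<Rightarrow> bool" where
  "soliton_set m T \<gamma> \<Gamma> \<longleftrightarrow>
     \<Gamma> \<subseteq> global_states m T \<and> invariant_set T \<gamma> \<Gamma> \<and> stable_set m T \<gamma> \<Gamma> \<and>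
     compact_up_to_translations m \<Gamma>"

definition hylomorphic_soliton ::
  "nat \<Rightarrow> real \<Rightarrow> ((real \<Rightarrow> complex) \<Rightarrow> ereal) \<Rightarrow> (real \<Rightarrow> (real \<Rightarrow> complex) \<Rightarrow> real \<Rightarrow> complex) \<Rightarrow>
   (real \<Rightarrow> complex) \<Rightarrow> bool" where
  "hylomorphic_soliton m p T \<gamma> u\<^sub>0 \<longleftrightarrow>
     (\<exists>\<Gamma> e\<^sub>0 c\<^sub>0. u\<^sub>0 \<in> \<Gamma> \<and> soliton_set m T \<gamma> \<Gamma> \<and>
        \<Gamma> = {u \<in> sobolev m. energy m p u = e\<^sub>0 \<and> \<bar>charge u\<bar> = c\<^sub>0} \<and>
        (\<exists>u\<in>sobolev m. \<bar>charge u\<bar> = c\<^sub>0 \<and> energy m p u = e\<^sub>0) \<and>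
        (\<forall>u\<in>sobolev m. \<bar>charge u\<bar> = c\<^sub>0 \<longrightarrow> e\<^sub>0 \<le> energy m p u))"

end

theory Submission
  imports Defs "HOL-Probability.Probability" "HOL-Complex_Analysis.Great_Picard"
begin

text \<open>
  The solitons are the minimizers of the energy under a prescribed charge \<open>c\<close>. Write $I(c)$ for the
  infimum. It is finite because $p < 4m+2$ makes the potential energy grow more slowly than the
  kinetic energy at fixed charge (\<open>energy_coercive\<close>), and it is negative because spreading a bump
  out lowers its kinetic energy faster than its potential energy (\<open>negative_energy_exists\<close>).

  Multiplying a function by a constant $t > 1$ scales the kinetic energy by $t^2$ and the potential
  energy by $t^p$. Comparison with the rescaled function, whose charge is \<open>c\<close>, gives
  $E(u) \ge (C(u)/c)\, I(c)$, with a strict gain if $0 < C(u) < c$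
  (\<open>energy_amplitude_scaling\<close>). This rules out that a minimizing sequence loses part of its charge:
  since $I(c) < 0$, its potential energy stays away from zero, so its supremum does, and suitable
  translates have a nonzero pointwise limit $g$ along a subsequence. Charge, kinetic energy and
  potential energy of the sequence split, in the limit, into those of $g$ and those of the remainder
  (\<open>pointwise_limit_splitting\<close>). If the charge of $g$ were less than \<open>c\<close>, the strict gain for $g$ and
  the inequality for the remainder would add up to more than $I(c)$. So the remainder has charge
  tending to zero, hence no potential energy in the limit, hence no kinetic energy either, and the
  convergence is strong (\<open>minimizing_sequences_compact\<close>).

  Existence of minimizers and compactness of their set \<open>\<Gamma>\<close> up to translations are immediate. Stability
  uses that the flow conserves energy and charge: a solution that starts close to \<open>\<Gamma>\<close> has at all times
  almost the energy and charge of \<open>\<Gamma>\<close>, so a sequence of counterexamples would be a minimizing sequence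
  that stays away from \<open>\<Gamma>\<close>. Minimality along rescaled perturbations gives the stationary equation with
  the Lagrange multiplier as frequency (\<open>first_variation\<close>), and rotating the phase of a stationary
  solution solves the evolution equation (\<open>standing_wave_solution\<close>). The parameter \<open>\<delta>\<close> is the charge,
  which tells the solitons apart.

  The Sobolev norm is defined on the Fourier side and the energy through weak derivatives, so the
  argument rests on the Plancherel theorem. A Gaussian convergence factor shows that the transform
  does not increase the $L^2$ norm (\<open>FT_contraction\<close>); that it preserves the norm follows from the
  inversion formula, which is tested against indicators of intervals (\<open>fourier_inversion\<close>). Functions in
  $H^m$ have integrable transforms, so they have continuous representatives, and those of a bounded set
  share a modulus of continuity; compactness can therefore be argued with pointwise limits.
\<close>

section \<open>Square-integrable functions\<close>

text \<open>
  \<open>charge\<close> is the square of the $L^2$ norm.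
\<close>

definition l2n :: "(real \<Rightarrow> complex) \<Rightarrow> real" where "l2n f = sqrt (charge f)"

lemma L2I: "f \<in> borel_measurable borel \<Longrightarrow> integrable lborel (\<lambda>x. (cmod (f x))\<^sup>2) \<Longrightarrow> f \<in> L2"
  by (simp add: L2_def)

lemma L2_measurable [measurable_dest]: "f \<in> L2 \<Longrightarrow> f \<in> borel_measurable borel"
  by (simp add: L2_def)

lemma L2_integrable: "f \<in> L2 \<Longrightarrow> integrable lborel (\<lambda>x. (cmod (f x))\<^sup>2)"
  by (simp add: L2_def)

lemma charge_nonneg: "0 \<le> charge f"
  unfolding charge_def by (intro integral_nonneg_AE) auto

lemma l2n_nonneg: "0 \<le> l2n f"
  by (simp add: l2n_def charge_nonneg)

lemma l2n_sq: "(l2n f)\<^sup>2 = charge f"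
  by (simp add: l2n_def charge_nonneg)

lemma nn_integral_charge: "f \<in> L2 \<Longrightarrow> (\<integral>\<^sup>+x. ennreal ((cmod (f x))\<^sup>2) \<partial>lborel) = ennreal (charge f)"
  unfolding charge_def by (intro nn_integral_eq_integral L2_integrable) auto

lemma L2_of_nn_integral:
  assumes "f \<in> borel_measurable borel" "(\<integral>\<^sup>+x. ennreal ((cmod (f x))\<^sup>2) \<partial>lborel) \<le> ennreal B"
  shows "f \<in> L2" "0 \<le> B \<Longrightarrow> charge f \<le> B"
proof -
  have [measurable]: "f \<in> borel_measurable borel" by fact
  have "(\<integral>\<^sup>+x. ennreal ((cmod (f x))\<^sup>2) \<partial>lborel) < \<infinity>"
    using assms(2) le_less_trans by fastforce
  hence "integrable lborel (\<lambda>x. (cmod (f x))\<^sup>2)"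
    by (intro integrableI_bounded) auto
  thus 1: "f \<in> L2" by (intro L2I) auto
  show "charge f \<le> B" if "0 \<le> B"
    using assms(2) nn_integral_charge[OF 1] that by (simp add: ennreal_le_iff)
qed

lemma L2_dominated:
  assumes "g \<in> L2" "f \<in> borel_measurable borel" "AE x in lborel. cmod (f x) \<le> B * cmod (g x)"
  shows "f \<in> L2"
proof -
  have [measurable]: "f \<in> borel_measurable borel" "g \<in> borel_measurable borel"
    using assms L2_measurable by auto
  have "integrable lborel (\<lambda>x. (cmod (f x))\<^sup>2)"
  proof (rule Bochner_Integration.integrable_bound)
    show "integrable lborel (\<lambda>x. B\<^sup>2 * (cmod (g x))\<^sup>2)"
      by (intro integrable_mult_right L2_integrable assms)
    show "AE x in lborel. norm ((cmod (f x))\<^sup>2) \<le> norm (B\<^sup>2 * (cmod (g x))\<^sup>2)"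
      using assms(3)
    proof eventually_elim
      case (elim x)
      hence "(cmod (f x))\<^sup>2 \<le> (B * cmod (g x))\<^sup>2" by (intro power_mono) auto
      thus ?case by (simp add: power_mult_distrib)
    qed
  qed auto
  thus ?thesis by (intro L2I) auto
qed

lemma charge_mono:
  assumes "g \<in> L2" "f \<in> L2" "AE x in lborel. cmod (f x) \<le> cmod (g x)"
  shows "charge f \<le> charge g"
  unfolding charge_def
proof (rule integral_mono_AE[OF L2_integrable L2_integrable])
  show "AE x in lborel. (cmod (f x))\<^sup>2 \<le> (cmod (g x))\<^sup>2"
    using assms(3) by eventually_elim (auto intro: power_mono)
qed (use assms in auto)

lemma L2_bounded_mult:
  assumes "f \<in> L2" "h \<in> borel_measurable borel" "\<And>x. cmod (h x) \<le> B"
  shows "(\<lambda>x. h x * f x) \<in> L2"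
proof (rule L2_dominated[OF assms(1)])
  show "(\<lambda>x. h x * f x) \<in> borel_measurable borel"
    using assms(1,2) by (measurable; simp add: L2_def)
  show "AE x in lborel. cmod (h x * f x) \<le> B * cmod (f x)"
    using assms(3) by (auto simp: norm_mult intro!: mult_right_mono)
qed

lemma L2_cmult: "f \<in> L2 \<Longrightarrow> (\<lambda>x. c * f x) \<in> L2"
  by (rule L2_bounded_mult[where B = "cmod c"]) auto

lemma borel_measurable_cnj [measurable (raw)]:
  "f \<in> borel_measurable M \<Longrightarrow> (\<lambda>x. cnj (f x)) \<in> borel_measurable M"
  by (rule measurable_compose[OF _ borel_measurable_continuous_onI]) (auto intro!: continuous_intros)

lemma L2_cnj: "f \<in> L2 \<Longrightarrow> (\<lambda>x. cnj (f x)) \<in> L2"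
  by (rule L2_dominated[where g = f and B = 1]) auto

lemma L2_cmod: "f \<in> L2 \<Longrightarrow> (\<lambda>x. complex_of_real (cmod (f x))) \<in> L2"
  by (rule L2_dominated[where g = f and B = 1]) auto

lemma L2_indicator: "f \<in> L2 \<Longrightarrow> A \<in> sets borel \<Longrightarrow> (\<lambda>x. indicator A x * f x) \<in> L2"
  by (rule L2_bounded_mult[where B = 1]) (auto simp: indicator_def)

lemma L2_zero: "(\<lambda>x. 0) \<in> L2" by (intro L2I) auto

lemma L2_add:
  assumes "f \<in> L2" "g \<in> L2" shows "(\<lambda>x. f x + g x) \<in> L2"
proof -
  have [measurable]: "f \<in> borel_measurable borel" "g \<in> borel_measurable borel"
    using assms L2_measurable by auto
  have "integrable lborel (\<lambda>x. (cmod (f x + g x))\<^sup>2)"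
  proof (rule Bochner_Integration.integrable_bound)
    show "integrable lborel (\<lambda>x. 2 * ((cmod (f x))\<^sup>2 + (cmod (g x))\<^sup>2))"
      by (intro integrable_mult_right Bochner_Integration.integrable_add L2_integrable assms)
    show "AE x in lborel. norm ((cmod (f x + g x))\<^sup>2) \<le> norm (2 * ((cmod (f x))\<^sup>2 + (cmod (g x))\<^sup>2))"
    proof (rule AE_I2)
      fix x
      have "(cmod (f x + g x))\<^sup>2 \<le> (cmod (f x) + cmod (g x))\<^sup>2"
        by (intro power_mono norm_triangle_ineq) auto
      also have "\<dots> \<le> 2 * ((cmod (f x))\<^sup>2 + (cmod (g x))\<^sup>2)"
        using sum_squares_bound[of "cmod (f x)" "cmod (g x)"] by (simp add: power2_sum)
      finally show "norm ((cmod (f x + g x))\<^sup>2) \<le> norm (2 * ((cmod (f x))\<^sup>2 + (cmod (g x))\<^sup>2))"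
        by simp
    qed
  qed auto
  thus ?thesis by (intro L2I) auto
qed

lemma L2_diff: "f \<in> L2 \<Longrightarrow> g \<in> L2 \<Longrightarrow> (\<lambda>x. f x - g x) \<in> L2"
  using L2_add[of f "\<lambda>x. (-1) * g x"] L2_cmult[of g "-1"] by simp

lemma L2_affine: "f \<in> L2 \<Longrightarrow> c \<noteq> 0 \<Longrightarrow> (\<lambda>x. f (t + c * x)) \<in> L2"
  using lborel_integrable_real_affine[of "\<lambda>x. (cmod (f x))\<^sup>2" c t]
  by (auto simp: L2_def)

lemma charge_affine: "c \<noteq> 0 \<Longrightarrow> charge (\<lambda>x. f (t + c * x)) = charge f / \<bar>c\<bar>"
  unfolding charge_def
  by (subst (2) lborel_integral_real_affine[of c _ t]) auto

lemma charge_cmult: "charge (\<lambda>x. c * f x) = (cmod c)\<^sup>2 * charge f"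
  unfolding charge_def by (simp add: norm_mult power_mult_distrib)

lemma l2n_cmult: "l2n (\<lambda>x. c * f x) = cmod c * l2n f"
  by (simp add: l2n_def charge_cmult real_sqrt_mult)

lemma charge_cong_AE:
  "f \<in> borel_measurable borel \<Longrightarrow> g \<in> borel_measurable borel \<Longrightarrow> AE x in lborel. f x = g x \<Longrightarrow> charge f = charge g"
  unfolding charge_def by (intro integral_cong_AE) auto

lemma charge_minus_commute: "charge (\<lambda>x. f x - g x) = charge (\<lambda>x. g x - f x)"
proof -
  have "(\<lambda>x. (cmod (f x - g x))\<^sup>2) = (\<lambda>x. (cmod (g x - f x))\<^sup>2)" by (simp add: norm_minus_commute)
  thus ?thesis unfolding charge_def by (rule arg_cong)
qed

lemma charge_cnj: "charge (\<lambda>x. cnj (f x)) = charge f"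
  unfolding charge_def by simp

lemma charge_eq_0_iff: "f \<in> L2 \<Longrightarrow> charge f = 0 \<longleftrightarrow> (AE x in lborel. f x = 0)"
  unfolding charge_def by (subst integral_nonneg_eq_0_iff_AE) (auto simp: L2_integrable)

lemma L2_mult_integrable:
  assumes "f \<in> L2" "g \<in> L2" shows "integrable lborel (\<lambda>x. f x * g x)"
proof (rule Bochner_Integration.integrable_bound)
  show "integrable lborel (\<lambda>x. (cmod (f x))\<^sup>2 + (cmod (g x))\<^sup>2)"
    by (intro Bochner_Integration.integrable_add L2_integrable assms)
  show "(\<lambda>x. f x * g x) \<in> borel_measurable lborel"
    using assms by (auto simp: L2_def)
  show "AE x in lborel. norm (f x * g x) \<le> norm ((cmod (f x))\<^sup>2 + (cmod (g x))\<^sup>2)"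
  proof (rule AE_I2)
    fix x
    have "2 * (cmod (f x) * cmod (g x)) \<le> (cmod (f x))\<^sup>2 + (cmod (g x))\<^sup>2"
      using sum_squares_bound[of "cmod (f x)" "cmod (g x)"] by simp
    moreover have "0 \<le> cmod (f x) * cmod (g x)" by simp
    ultimately show "norm (f x * g x) \<le> norm ((cmod (f x))\<^sup>2 + (cmod (g x))\<^sup>2)"
      unfolding norm_mult real_norm_def by linarith
  qed
qed

lemma L2_Cauchy_Schwarz_abs:
  assumes "f \<in> L2" "g \<in> L2"
  shows "(LINT x|lborel. cmod (f x * g x)) \<le> l2n f * l2n g"
proof -
  have [measurable]: "f \<in> borel_measurable borel" "g \<in> borel_measurable borel"
    using assms L2_measurable by auto
  let ?I = "LINT x|lborel. cmod (f x * g x)"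
  have I0: "0 \<le> ?I" by (intro integral_nonneg_AE) auto
  have eq: "(\<integral>\<^sup>+x. ennreal (cmod (f x)) * ennreal (cmod (g x)) \<partial>lborel) = ennreal ?I"
    using nn_integral_eq_integral[OF integrable_norm[OF L2_mult_integrable[OF assms]]]
    by (simp add: norm_mult ennreal_mult)
  have "(ennreal ?I)\<^sup>2 \<le> (\<integral>\<^sup>+x. (ennreal (cmod (f x)))\<^sup>2 \<partial>lborel) * (\<integral>\<^sup>+x. (ennreal (cmod (g x)))\<^sup>2 \<partial>lborel)"
    unfolding eq[symmetric] by (rule Cauchy_Schwarz_nn_integral) auto
  also have "\<dots> = ennreal (charge f * charge g)"
    using nn_integral_charge[OF assms(1)] nn_integral_charge[OF assms(2)]
    by (simp add: ennreal_power ennreal_mult charge_nonneg)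
  finally have "?I\<^sup>2 \<le> charge f * charge g"
    using I0 by (simp add: ennreal_power ennreal_le_iff charge_nonneg)
  hence "sqrt (?I\<^sup>2) \<le> sqrt (charge f * charge g)" by (rule real_sqrt_le_mono)
  thus ?thesis using I0 by (simp add: l2n_def real_sqrt_mult)
qed

lemma L2_Cauchy_Schwarz:
  assumes "f \<in> L2" "g \<in> L2"
  shows "cmod (LINT x|lborel. f x * g x) \<le> l2n f * l2n g"
  using integral_norm_bound[of lborel "\<lambda>x. f x * g x"] L2_Cauchy_Schwarz_abs[OF assms]
  by (rule order_trans)

lemma charge_add:
  assumes "f \<in> L2" "g \<in> L2"
  shows "charge (\<lambda>x. f x + g x) = charge f + charge g + 2 * Re (LINT x|lborel. f x * cnj (g x))"
proof -
  have i: "integrable lborel (\<lambda>x. f x * cnj (g x))"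
    by (intro L2_mult_integrable L2_cnj assms)
  have "(cmod (f x + g x))\<^sup>2 = (cmod (f x))\<^sup>2 + (cmod (g x))\<^sup>2 + 2 * Re (f x * cnj (g x))" for x
    unfolding cmod_power2 by (simp add: power2_eq_square algebra_simps)
  hence "charge (\<lambda>x. f x + g x) =
      (LINT x|lborel. (cmod (f x))\<^sup>2 + (cmod (g x))\<^sup>2 + 2 * Re (f x * cnj (g x)))"
    unfolding charge_def by (intro Bochner_Integration.integral_cong) auto
  also have "\<dots> = (LINT x|lborel. (cmod (f x))\<^sup>2 + (cmod (g x))\<^sup>2) + (LINT x|lborel. 2 * Re (f x * cnj (g x)))"
    by (intro Bochner_Integration.integral_add Bochner_Integration.integrable_add L2_integrable assms
        integrable_mult_right integrable_Re i)
  also have "(LINT x|lborel. (cmod (f x))\<^sup>2 + (cmod (g x))\<^sup>2) = charge f + charge g"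
    unfolding charge_def by (intro Bochner_Integration.integral_add L2_integrable assms)
  also have "(LINT x|lborel. 2 * Re (f x * cnj (g x))) = 2 * (LINT x|lborel. Re (f x * cnj (g x)))"
    by (rule integral_mult_right_zero)
  also have "(LINT x|lborel. Re (f x * cnj (g x))) = Re (LINT x|lborel. f x * cnj (g x))"
    using i by (rule integral_Re)
  finally show ?thesis .
qed

lemma l2n_triangle:
  assumes "f \<in> L2" "g \<in> L2"
  shows "l2n (\<lambda>x. f x + g x) \<le> l2n f + l2n g"
proof -
  have "Re (LINT x|lborel. f x * cnj (g x)) \<le> l2n f * l2n g"
    using L2_Cauchy_Schwarz[OF assms(1) L2_cnj[OF assms(2)]] complex_Re_le_cmod order_trans
    unfolding l2n_def charge_cnj by blast
  hence "charge (\<lambda>x. f x + g x) \<le> (l2n f + l2n g)\<^sup>2"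
    using charge_add[OF assms] by (simp add: power2_sum l2n_sq)
  thus ?thesis unfolding l2n_def[of "\<lambda>x. f x + g x"]
    by (intro real_le_lsqrt) (auto simp: l2n_nonneg charge_nonneg)
qed

lemma l2n_minus_commute: "l2n (\<lambda>x. f x - g x) = l2n (\<lambda>x. g x - f x)"
  unfolding l2n_def charge_minus_commute[of f g] ..

lemma l2n_diff_triangle:
  assumes "f \<in> L2" "g \<in> L2" "h \<in> L2"
  shows "l2n (\<lambda>x. f x - h x) \<le> l2n (\<lambda>x. f x - g x) + l2n (\<lambda>x. g x - h x)"
  using l2n_triangle[OF L2_diff[OF assms(1,2)] L2_diff[OF assms(2,3)]] by simp

lemma l2n_reverse_triangle:
  assumes "f \<in> L2" "g \<in> L2"
  shows "\<bar>l2n f - l2n g\<bar> \<le> l2n (\<lambda>x. f x - g x)"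
  using l2n_diff_triangle[OF assms(1,2) L2_zero] l2n_diff_triangle[OF assms(2,1) L2_zero]
    l2n_minus_commute[of f g] by simp

definition l2_conv :: "(nat \<Rightarrow> real \<Rightarrow> complex) \<Rightarrow> (real \<Rightarrow> complex) \<Rightarrow> bool" where
  "l2_conv f g \<longleftrightarrow> (\<lambda>n. l2n (\<lambda>x. f n x - g x)) \<longlonglongrightarrow> 0"

lemma l2_conv_l2n:
  assumes "l2_conv f g" "\<And>n. f n \<in> L2" "g \<in> L2"
  shows "(\<lambda>n. l2n (f n)) \<longlonglongrightarrow> l2n g"
proof -
  have "(\<lambda>n. l2n (f n) - l2n g) \<longlonglongrightarrow> 0"
    by (rule Lim_null_comparison[OF _ assms(1)[unfolded l2_conv_def]])
       (use l2n_reverse_triangle[OF assms(2,3)] in auto)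
  thus ?thesis by (simp add: LIM_zero_iff)
qed

lemma l2_conv_dominated:
  assumes "l2_conv f g" "\<And>n. l2n (\<lambda>x. f' n x - g' x) \<le> C * l2n (\<lambda>x. f n x - g x)"
  shows "l2_conv f' g'"
  unfolding l2_conv_def
  by (rule Lim_null_comparison[OF _ tendsto_mult_right_zero[OF assms(1)[unfolded l2_conv_def], of C]])
     (use assms(2) l2n_nonneg in auto)

lemma l2_conv_integral_mult:
  assumes "l2_conv f g" "l2_conv f' g'" "\<And>n. f n \<in> L2" "g \<in> L2" "\<And>n. f' n \<in> L2" "g' \<in> L2"
  shows "(\<lambda>n. LINT x|lborel. f n x * f' n x) \<longlonglongrightarrow> (LINT x|lborel. g x * g' x)"
proof -
  have "(\<lambda>n. (LINT x|lborel. f n x * f' n x) - (LINT x|lborel. g x * g' x)) \<longlonglongrightarrow> 0"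
  proof (rule Lim_null_comparison)
    show "\<forall>\<^sub>F n in sequentially. norm ((LINT x|lborel. f n x * f' n x) - (LINT x|lborel. g x * g' x))
       \<le> l2n (\<lambda>x. f n x - g x) * l2n (f' n) + l2n g * l2n (\<lambda>x. f' n x - g' x)"
    proof (rule always_eventually, rule allI)
      fix n
      have 1: "(\<lambda>x. f n x - g x) \<in> L2" "(\<lambda>x. f' n x - g' x) \<in> L2" using assms L2_diff by auto
      have "(LINT x|lborel. f n x * f' n x) - (LINT x|lborel. g x * g' x)
        = (LINT x|lborel. (f n x - g x) * f' n x) + (LINT x|lborel. g x * (f' n x - g' x))"
        by (subst Bochner_Integration.integral_add[symmetric])
           (use assms 1 L2_mult_integrable in \<open>auto simp: algebra_simps
              simp flip: Bochner_Integration.integral_diff intro!: L2_mult_integrable\<close>)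
      also have "norm \<dots> \<le> l2n (\<lambda>x. f n x - g x) * l2n (f' n) + l2n g * l2n (\<lambda>x. f' n x - g' x)"
        by (rule order_trans[OF norm_triangle_ineq])
           (intro add_mono L2_Cauchy_Schwarz 1 assms)
      finally show "norm ((LINT x|lborel. f n x * f' n x) - (LINT x|lborel. g x * g' x))
       \<le> l2n (\<lambda>x. f n x - g x) * l2n (f' n) + l2n g * l2n (\<lambda>x. f' n x - g' x)" .
    qed
    have "(\<lambda>n. l2n (\<lambda>x. f n x - g x) * l2n (f' n) + l2n g * l2n (\<lambda>x. f' n x - g' x))
       \<longlonglongrightarrow> 0 * l2n g' + l2n g * 0"
      using assms l2_conv_l2n[OF assms(2,5,6)] unfolding l2_conv_def
      by (intro tendsto_intros) auto
    thus "(\<lambda>n. l2n (\<lambda>x. f n x - g x) * l2n (f' n) + l2n g * l2n (\<lambda>x. f' n x - g' x)) \<longlonglongrightarrow> 0"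
      by simp
  qed
  thus ?thesis by (simp add: LIM_zero_iff)
qed

lemma L2_Fatou:
  assumes "\<And>n. f n \<in> L2" "g \<in> borel_measurable borel" "AE x in lborel. (\<lambda>n. f n x) \<longlonglongrightarrow> g x"
    and "\<forall>\<^sub>F n in sequentially. charge (f n) \<le> B" "0 \<le> B"
  shows "g \<in> L2" "charge g \<le> B"
proof -
  have [measurable]: "\<And>n. f n \<in> borel_measurable borel" "g \<in> borel_measurable borel"
    using assms L2_measurable by auto
  have "(\<integral>\<^sup>+x. ennreal ((cmod (g x))\<^sup>2) \<partial>lborel) =
      (\<integral>\<^sup>+x. liminf (\<lambda>n. ennreal ((cmod (f n x))\<^sup>2)) \<partial>lborel)"
  proof (rule nn_integral_cong_AE, use assms(3) in eventually_elim)
    case (elim x)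
    hence "(\<lambda>n. ennreal ((cmod (f n x))\<^sup>2)) \<longlonglongrightarrow> ennreal ((cmod (g x))\<^sup>2)"
      by (intro tendsto_ennrealI tendsto_intros)
    thus ?case using lim_imp_Liminf[OF sequentially_bot] by metis
  qed
  also have "\<dots> \<le> liminf (\<lambda>n. \<integral>\<^sup>+x. ennreal ((cmod (f n x))\<^sup>2) \<partial>lborel)"
    by (rule nn_integral_liminf) auto
  also have "\<dots> \<le> liminf (\<lambda>n. ennreal B)"
    by (rule Liminf_mono) (use assms(4) in eventually_elim, simp add: nn_integral_charge assms(1) ennreal_leI)
  also have "\<dots> = ennreal B" by (simp add: Liminf_const)
  finally have *: "(\<integral>\<^sup>+x. ennreal ((cmod (g x))\<^sup>2) \<partial>lborel) \<le> ennreal B" .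
  show "g \<in> L2" "charge g \<le> B" using L2_of_nn_integral[OF assms(2) *] assms(5) by auto
qed

text \<open>
  Fatou's lemma, applied to $g - f_n$, bounds the charge of $g - h$ by those of $g - f_n$ for large
  $n$.
\<close>

lemma l2_conv_pointwise_unique:
  assumes "l2_conv f g" "\<And>n. f n \<in> L2" "g \<in> L2" "h \<in> borel_measurable borel"
    and "AE x in lborel. (\<lambda>n. f n x) \<longlonglongrightarrow> h x"
  shows "AE x in lborel. g x = h x"
proof -
  have [measurable]: "\<And>n. f n \<in> borel_measurable borel" "g \<in> borel_measurable borel" "h \<in> borel_measurable borel"
    using assms L2_measurable by auto
  have *: "(\<lambda>x. g x - h x) \<in> L2 \<and> charge (\<lambda>x. g x - h x) \<le> e" if "e > 0" for e
  proof -
    have "(\<lambda>n. (l2n (\<lambda>x. f n x - g x))\<^sup>2) \<longlonglongrightarrow> 0\<^sup>2"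
      using assms(1) unfolding l2_conv_def by (intro tendsto_intros)
    hence "(\<lambda>n. charge (\<lambda>x. f n x - g x)) \<longlonglongrightarrow> 0" by (simp add: l2n_sq)
    hence ev: "\<forall>\<^sub>F n in sequentially. charge (\<lambda>x. g x - f n x) \<le> e"
      using order_tendstoD(2)[OF \<open>(\<lambda>n. charge (\<lambda>x. f n x - g x)) \<longlonglongrightarrow> 0\<close> that]
      by (subst charge_minus_commute) (auto elim!: eventually_mono)
    have "AE x in lborel. (\<lambda>n. g x - f n x) \<longlonglongrightarrow> g x - h x"
      using assms(5) by eventually_elim (intro tendsto_intros)
    from L2_Fatou[OF _ _ this ev] show ?thesis
      using L2_diff[OF assms(3) assms(2)] that by auto
  qed
  hence "charge (\<lambda>x. g x - h x) \<le> 0 + e" if "e > 0" for e using that by simp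
  hence "charge (\<lambda>x. g x - h x) \<le> 0" by (rule field_le_epsilon)
  hence "charge (\<lambda>x. g x - h x) = 0" using charge_nonneg by (simp add: order_antisym)
  thus ?thesis using *[of 1] charge_eq_0_iff by fastforce
qed

lemma l2_conv_unique:
  assumes "l2_conv f g" "l2_conv f h" "\<And>n. f n \<in> L2" "g \<in> L2" "h \<in> L2"
  shows "AE x in lborel. g x = h x"
proof -
  have "(\<lambda>n. l2n (\<lambda>x. f n x - g x) + l2n (\<lambda>x. f n x - h x)) \<longlonglongrightarrow> 0 + 0"
    using assms unfolding l2_conv_def by (intro tendsto_intros)
  moreover have "l2n (\<lambda>x. g x - h x) \<le> l2n (\<lambda>x. f n x - g x) + l2n (\<lambda>x. f n x - h x)" for n
    using l2n_diff_triangle[OF assms(4,3,5), of n] l2n_minus_commute[of "f n" g] by simp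
  ultimately have "l2n (\<lambda>x. g x - h x) \<le> 0"
    by (metis (no_types, lifting) LIMSEQ_le_const add.right_neutral)
  hence "charge (\<lambda>x. g x - h x) = 0"
    by (metis l2n_nonneg l2n_sq order_antisym zero_power2)
  thus ?thesis using charge_eq_0_iff[OF L2_diff[OF assms(4,5)]] by simp
qed

text \<open>
  Along a subsequence whose steps $d_j$ have norm at most $2^{-j}$, the sum $\sum_j 2^j |d_j|^2$ has
  finite integral, hence is finite almost everywhere. At such points the steps decay geometrically
  and the subsequence converges. Fatou's lemma then compares the whole sequence with the limit.
\<close>

lemma L2_complete:
  assumes f: "\<And>n. f n \<in> L2"
    and C: "\<And>e. 0 < e \<Longrightarrow> \<exists>N. \<forall>n\<ge>N. \<forall>k\<ge>N. l2n (\<lambda>x. f n x - f k x) < e"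
  obtains g where "g \<in> L2" "l2_conv f g"
proof -
  have [measurable]: "\<And>n. f n \<in> borel_measurable borel" using f L2_measurable by auto
  have "\<exists>N. \<forall>n\<ge>N. \<forall>k\<ge>N. l2n (\<lambda>x. f n x - f k x) < (1/2)^j" for j :: nat
    using C[of "(1/2)^j"] by simp
  then obtain N where N: "\<And>j n k. n \<ge> N j \<Longrightarrow> k \<ge> N j \<Longrightarrow> l2n (\<lambda>x. f n x - f k x) < (1/2)^j"
    by metis
  \<comment> \<open>partial sums make the indices increasing while keeping each above its threshold\<close>
  define r where "r j = (\<Sum>i\<le>j. N i) + j" for j
  have rN: "r j \<ge> N j" for j unfolding r_def by (simp add: atMost_Suc sum.remove[of _ j] trans_le_add1)
  have rmono: "strict_mono r" unfolding strict_mono_Suc_iff r_def by simp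
  define d where "d j x = f (r (Suc j)) x - f (r j) x" for j x
  have [measurable]: "d j \<in> borel_measurable borel" for j unfolding d_def by measurable
  have dL2: "d j \<in> L2" for j unfolding d_def by (intro L2_diff f)
  have dn: "charge (d j) \<le> (1/4)^j" for j
  proof -
    have "l2n (d j) \<le> (1/2)^j"
      using N[OF _ rN[of j], of "r (Suc j)"] rN[of j] strict_mono_mono[OF rmono]
      unfolding d_def by (meson le_SucI less_imp_le monoD order_refl order_trans)
    hence "(l2n (d j))\<^sup>2 \<le> ((1/2)^j)\<^sup>2" by (intro power_mono l2n_nonneg)
    thus ?thesis by (simp add: l2n_sq power_mult[symmetric] mult.commute[of j] power_mult power2_eq_square[of "1/2"])
  qed
  have "(\<integral>\<^sup>+x. (\<Sum>j. ennreal (2^j * (cmod (d j x))\<^sup>2)) \<partial>lborel) =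
        (\<Sum>j. \<integral>\<^sup>+x. ennreal (2^j * (cmod (d j x))\<^sup>2) \<partial>lborel)"
    by (rule nn_integral_suminf) auto
  also have "\<dots> = (\<Sum>j. ennreal (2^j * charge (d j)))"
    by (simp add: ennreal_mult nn_integral_cmult nn_integral_charge[OF dL2] charge_nonneg)
  also have "\<dots> \<le> (\<Sum>j. ennreal ((1/2)^j))"
  proof (intro suminf_le ennreal_leI)
    fix j
    have "2^j * charge (d j) \<le> 2^j * (1/4)^j" using dn by (intro mult_left_mono) auto
    thus "2^j * charge (d j) \<le> (1/2)^j" by (simp add: power_mult_distrib[symmetric])
  qed auto
  also have "\<dots> < \<infinity>"
    by (subst suminf_ennreal_eq[where x = 2]) (use geometric_sums[of "1/2::real"] in auto)
  finally have fin: "(\<integral>\<^sup>+x. (\<Sum>j. ennreal (2^j * (cmod (d j x))\<^sup>2)) \<partial>lborel) < \<infinity>" .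
  have "AE x in lborel. (\<Sum>j. ennreal (2^j * (cmod (d j x))\<^sup>2)) \<noteq> \<infinity>"
    by (rule nn_integral_PInf_AE) (use fin in auto)
  hence conv: "AE x in lborel. convergent (\<lambda>n. f (r n) x)"
  proof eventually_elim
    case (elim x)
    hence s: "summable (\<lambda>j. 2^j * (cmod (d j x))\<^sup>2)" 
      by (intro summable_suminf_not_top) auto
    hence "bounded (range (\<lambda>j. 2^j * (cmod (d j x))\<^sup>2))"
      using summable_LIMSEQ_zero convergentI convergent_imp_bounded by blast
    then obtain B where B: "\<And>j. 2^j * (cmod (d j x))\<^sup>2 \<le> B" "B \<ge> 0"
    proof -
      from \<open>bounded _\<close> obtain B where B: "\<And>j. norm (2^j * (cmod (d j x))\<^sup>2) \<le> B"
        unfolding bounded_iff by auto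
      have "2^j * (cmod (d j x))\<^sup>2 \<le> B" for j using B[of j] by simp
      moreover have "0 \<le> B" using B[of 0] norm_ge_zero order_trans by blast
      ultimately show thesis using that by blast
    qed
    have db: "norm (d j x) \<le> sqrt B * (sqrt (1/2))^j" for j
    proof -
      have "(cmod (d j x))\<^sup>2 \<le> B * (1/2)^j"
        using B(1)[of j] by (simp add: field_simps)
      hence "cmod (d j x) \<le> sqrt (B * (1/2)^j)" by (rule real_le_rsqrt)
      thus ?thesis by (simp add: real_sqrt_mult real_sqrt_power)
    qed
    have "summable (\<lambda>j. sqrt B * (sqrt (1/2))^j)"
      by (intro summable_mult summable_geometric) auto
    hence "summable (\<lambda>j. d j x)" by (rule summable_comparison_test'[where N = 0]) (rule db)
    hence "convergent (\<lambda>n. \<Sum>j<n. d j x)" by (simp add: summable_iff_convergent)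
    moreover have "(\<Sum>j<n. d j x) = f (r n) x - f (r 0) x" for n
      unfolding d_def by (rule sum_lessThan_telescope[of "\<lambda>j. f (r j) x"])
    ultimately have "convergent (\<lambda>n. f (r n) x - f (r 0) x)" by simp
    from convergent_add[OF this convergent_const[of "f (r 0) x"]] show ?case by simp
  qed
  define g where "g x = lim (\<lambda>n. f (r n) x)" for x
  have [measurable]: "g \<in> borel_measurable borel" unfolding g_def by measurable
  have lim: "AE x in lborel. (\<lambda>n. f (r n) x) \<longlonglongrightarrow> g x"
    using conv unfolding g_def by eventually_elim (simp add: convergent_LIMSEQ_iff)
  have key: "(\<lambda>x. f n x - g x) \<in> L2 \<and> charge (\<lambda>x. f n x - g x) \<le> ((1/2)^j)\<^sup>2" if "n \<ge> N j" for n j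
  proof -
    have "AE x in lborel. (\<lambda>k. f n x - f (r k) x) \<longlonglongrightarrow> f n x - g x"
      using lim by eventually_elim (intro tendsto_intros)
    moreover have "\<forall>\<^sub>F k in sequentially. charge (\<lambda>x. f n x - f (r k) x) \<le> ((1/2)^j)\<^sup>2"
      using eventually_ge_at_top[of "N j"]
    proof eventually_elim
      case (elim k)
      hence "l2n (\<lambda>x. f n x - f (r k) x) \<le> (1/2)^j"
        using N[OF that, of "r k"] seq_suble[OF rmono, of k] by fastforce
      hence "(l2n (\<lambda>x. f n x - f (r k) x))\<^sup>2 \<le> ((1/2)^j)\<^sup>2" by (intro power_mono l2n_nonneg)
      thus ?case by (simp add: l2n_sq)
    qed
    ultimately show ?thesis using L2_Fatou[of "\<lambda>k x. f n x - f (r k) x" "\<lambda>x. f n x - g x"] L2_diff f by simp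
  qed
  have gL2: "g \<in> L2"
    using L2_diff[OF f[of "N 0"] conjunct1[OF key[of 0 "N 0"]]] by simp
  have "l2_conv f g" unfolding l2_conv_def
  proof (rule LIMSEQ_I)
    fix e :: real assume "e > 0"
    then obtain j where j: "(1/2)^j < e" using real_arch_pow_inv[of e "1/2"] by auto
    have "norm (l2n (\<lambda>x. f n x - g x) - 0) < e" if "n \<ge> N j" for n
    proof -
      have "l2n (\<lambda>x. f n x - g x) \<le> (1/2)^j"
        unfolding l2n_def using key[OF that] by (intro real_le_lsqrt) auto
      thus ?thesis using j l2n_nonneg by simp
    qed
    thus "\<exists>no. \<forall>n\<ge>no. norm (l2n (\<lambda>x. f n x - g x) - 0) < e" by blast
  qed
  with gL2 that show thesis by blast
qed

text \<open>
  Half-lines are closed under intersection and generate the Borel sets, so the integral of $f$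
  over $A \cap [-N,N]$ vanishes for every Borel set $A$.
\<close>

lemma AE_zero_of_interval_integrals:
  fixes f :: "real \<Rightarrow> complex"
  assumes int: "\<And>a b. set_integrable lborel {a..b} f"
    and zero: "\<And>a b. a < b \<Longrightarrow> (LINT x:{a..b}|lborel. f x) = 0"
  shows "AE x in lborel. f x = 0"
proof -
  have "AE x in lborel. indicator {- real N..real N} x *\<^sub>R f x = 0" for N :: nat
  proof (rule sigma_finite_measure.density_zero[OF sigma_finite_lborel])
    let ?g = "\<lambda>x. indicator {- real N..real N} x *\<^sub>R f x"
    show g: "integrable lborel ?g" using int unfolding set_integrable_def by blast
    have gm: "set_integrable lborel A ?g" if "A \<in> sets borel" for A
      unfolding set_integrable_def by (rule integrable_mult_indicator[OF _ g]) (use that in simp)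
    have whole: "(LINT x|lborel. ?g x) = 0"
    proof (cases "N = 0")
      case True
      have "AE x in lborel. ?g x = 0"
        using AE_lborel_singleton[of "0::real"] by eventually_elim (auto simp: True indicator_def)
      thus ?thesis by (rule integral_eq_zero_AE)
    next
      case False
      thus ?thesis using zero[of "- real N" "real N"] by (simp add: set_lebesgue_integral_def)
    qed
    fix A :: "real set" assume "A \<in> sets lborel"
    hence "A \<in> sigma_sets UNIV (range atMost)" by (simp add: borel_eq_atMost)
    have st: "Int_stable (range (atMost :: real \<Rightarrow> real set))" by (auto simp: Int_stable_def)
    have cl: "range (atMost :: real \<Rightarrow> real set) \<subseteq> Pow UNIV" by auto
    have sb: "sigma_sets UNIV (range atMost) = sets (borel :: real measure)"
      by (simp add: borel_eq_atMost)
    from \<open>A \<in> sigma_sets UNIV (range atMost)\<close> show "set_lebesgue_integral lborel A ?g = 0"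
    proof (induction rule: sigma_sets_induct_disjoint[OF st cl, consumes 1, case_names basic empty compl union])
      case (basic A)
      then obtain a where a: "A = {..a}" by auto
      show ?case
      proof (cases "a > - real N")
        case False
        have "AE x in lborel. indicator A x *\<^sub>R ?g x = 0"
          using AE_lborel_singleton[of "- real N"] by eventually_elim (use False a in \<open>auto simp: indicator_def\<close>)
        thus ?thesis unfolding set_lebesgue_integral_def by (rule integral_eq_zero_AE)
      next
        case True
        show ?thesis
        proof (cases "a \<le> real N")
          case True
          hence "set_lebesgue_integral lborel A ?g = set_lebesgue_integral lborel {- real N..a} f"
            unfolding set_lebesgue_integral_def a by (intro Bochner_Integration.integral_cong) (auto simp: indicator_def)
          thus ?thesis using zero \<open>a > - real N\<close> by simp
        next
          case False
          hence "set_lebesgue_integral lborel A ?g = (LINT x|lborel. ?g x)"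
            unfolding set_lebesgue_integral_def a by (intro Bochner_Integration.integral_cong) (auto simp: indicator_def)
          thus ?thesis using whole by simp
        qed
      qed
    next
      case (compl A)
      hence A: "A \<in> sets borel" using sb by simp
      have "set_lebesgue_integral lborel (UNIV - A) ?g = (LINT x|lborel. ?g x - indicator A x *\<^sub>R ?g x)"
        unfolding set_lebesgue_integral_def by (intro Bochner_Integration.integral_cong) (auto simp: indicator_def)
      also have "\<dots> = (LINT x|lborel. ?g x) - set_lebesgue_integral lborel A ?g"
        unfolding set_lebesgue_integral_def
        by (intro Bochner_Integration.integral_diff g) (use gm[OF A] in \<open>auto simp: set_integrable_def\<close>)
      finally show ?case using whole compl by simp
    next
      case (union A)
      hence A: "A i \<in> sets borel" for i using sb by auto
      have "set_lebesgue_integral lborel (\<Union> (range A)) ?g = (\<Sum>i. set_lebesgue_integral lborel (A i) ?g)"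
        by (rule lebesgue_integral_countable_add)
           (use A union gm in \<open>auto simp: disjoint_family_on_def\<close>)
      thus ?case using union by simp
    qed (simp add: set_lebesgue_integral_def)
  qed
  hence "AE x in lborel. \<forall>N. indicator {- real N..real N} x *\<^sub>R f x = 0"
    by (subst AE_all_countable) blast
  thus ?thesis
  proof eventually_elim
    case (elim x)
    obtain N :: nat where "\<bar>x\<bar> \<le> real N" using real_arch_simple[of "\<bar>x\<bar>"] by blast
    hence "x \<in> {- real N..real N}" by (simp add: abs_le_iff)
    thus ?case using elim[rule_format, of N] by simp
  qed
qed

section \<open>The Fourier integral\<close>

text \<open>
  The integral is meaningful for integrable functions only; on $L^2$ the transform is the limit of
  the integrals of truncated functions.
\<close>

definition FT :: "(real \<Rightarrow> complex) \<Rightarrow> real \<Rightarrow> complex" where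
  "FT u \<xi> = (LINT y|lborel. u y * exp (- \<i> * complex_of_real (y * \<xi>))) / complex_of_real (sqrt (2 * pi))"

definition trunc :: "real \<Rightarrow> (real \<Rightarrow> complex) \<Rightarrow> real \<Rightarrow> complex" where
  "trunc R u y = indicator {-R..R} y * u y"

lemma fourier_trunc_eq: "fourier_trunc R u = FT (trunc R u)"
  unfolding fourier_trunc_def FT_def trunc_def set_lebesgue_integral_def
  by (intro ext arg_cong2[where f = "(/)"] Bochner_Integration.integral_cong)
     (auto simp: indicator_def)

lemma FT_measurable [measurable]:
  assumes [measurable]: "u \<in> borel_measurable borel"
  shows "FT u \<in> borel_measurable borel"
proof -
  have "(\<lambda>\<xi>. LINT y|lborel. u y * exp (- \<i> * complex_of_real (y * \<xi>))) \<in> borel_measurable borel"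
    by (rule lborel.borel_measurable_lebesgue_integral) (measurable; simp)
  thus ?thesis unfolding FT_def[abs_def] by measurable
qed

lemma cmod_exp_i_real [simp]: "cmod (exp (- (\<i> * complex_of_real t))) = 1"
  "cmod (exp (\<i> * complex_of_real t)) = 1"
  by (simp_all add: norm_exp_eq_Re)

lemma FT_integrand_integrable:
  assumes "integrable lborel u"
  shows "integrable lborel (\<lambda>y. u y * exp (- \<i> * complex_of_real (y * \<xi>)))"
proof (rule Bochner_Integration.integrable_bound[OF assms])
  have [measurable]: "u \<in> borel_measurable borel" using assms by auto
  show "(\<lambda>y. u y * exp (- \<i> * complex_of_real (y * \<xi>))) \<in> borel_measurable lborel" by (measurable; simp)
  show "AE y in lborel. norm (u y * exp (- \<i> * complex_of_real (y * \<xi>))) \<le> norm (u y)"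
    using cmod_exp_i_real(1)[of "_ * \<xi>"] by (auto simp: norm_mult)
qed

lemma FT_bound:
  assumes "integrable lborel u"
  shows "cmod (FT u \<xi>) \<le> (LINT y|lborel. cmod (u y)) / sqrt (2 * pi)"
proof -
  have "cmod (LINT y|lborel. u y * exp (- \<i> * complex_of_real (y * \<xi>)))
      \<le> (LINT y|lborel. cmod (u y * exp (- \<i> * complex_of_real (y * \<xi>))))"
    by (rule integral_norm_bound)
  also have "\<dots> = (LINT y|lborel. cmod (u y))"
    using cmod_exp_i_real(1)[of "_ * \<xi>"] by (simp add: norm_mult)
  finally show ?thesis unfolding FT_def by (simp add: norm_divide divide_right_mono)
qed

lemma FT_add: "integrable lborel u \<Longrightarrow> integrable lborel v \<Longrightarrow> FT (\<lambda>x. u x + v x) \<xi> = FT u \<xi> + FT v \<xi>"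
  unfolding FT_def using FT_integrand_integrable[of u \<xi>] FT_integrand_integrable[of v \<xi>]
  by (simp add: ring_distribs add_divide_distrib)

lemma FT_cmult: "FT (\<lambda>x. c * u x) \<xi> = c * FT u \<xi>"
  unfolding FT_def by (simp add: mult.assoc)

lemma FT_diff: "integrable lborel u \<Longrightarrow> integrable lborel v \<Longrightarrow> FT (\<lambda>x. u x - v x) \<xi> = FT u \<xi> - FT v \<xi>"
  using FT_add[of u "\<lambda>x. (-1) * v x" \<xi>] FT_cmult[of "-1" v \<xi>] by simp

lemma FT_reflect: "FT (\<lambda>x. u (- x)) \<xi> = FT u (- \<xi>)"
  unfolding FT_def
  by (subst lborel_integral_real_affine[where c = "-1" and t = 0]) auto

lemma FT_cnj: "FT (\<lambda>x. cnj (u x)) \<xi> = cnj (FT u (- \<xi>))"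
proof -
  have "cnj (LINT y|lborel. u y * exp (- \<i> * complex_of_real (y * - \<xi>))) =
      (LINT y|lborel. cnj (u y * exp (- \<i> * complex_of_real (y * - \<xi>))))"
    by (rule Bochner_Integration.integral_cnj[symmetric])
  thus ?thesis unfolding FT_def by (simp add: exp_cnj)
qed

text \<open>
  Up to the factor $1/\sqrt{2\pi}$, both sides are the double integral of $u(x) v(\xi) e^{-i x \xi}$.
\<close>

lemma FT_multiplication_formula:
  assumes u: "integrable lborel u" and v: "integrable lborel v"
  shows "(LINT \<xi>|lborel. FT u \<xi> * v \<xi>) = (LINT x|lborel. u x * FT v x)"
proof -
  let ?h = "\<lambda>(x, \<xi>). u x * v \<xi> * exp (- \<i> * complex_of_real (x * \<xi>))"
  have [measurable]: "u \<in> borel_measurable borel" "v \<in> borel_measurable borel" using u v by auto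
  have hm: "?h \<in> borel_measurable (lborel \<Otimes>\<^sub>M lborel)" by (measurable; simp)
  have cm: "cmod (exp (- (\<i> * (complex_of_real x * complex_of_real y)))) = 1" for x y
    using cmod_exp_i_real(1)[of "x * y"] by simp
  have int: "integrable (lborel \<Otimes>\<^sub>M lborel) ?h"
  proof (rule lborel_pair.Fubini_integrable[OF hm])
    have "(\<lambda>x. LINT y|lborel. norm (?h (x, y))) = (\<lambda>x. cmod (u x) * (LINT y|lborel. cmod (v y)))"
      by (simp add: norm_mult cm)
    thus "integrable lborel (\<lambda>x. LINT y|lborel. norm (?h (x, y)))"
      using u by (simp add: integrable_mult_left)
    show "AE x in lborel. integrable lborel (\<lambda>y. ?h (x, y))"
    proof (rule AE_I2)
      fix x
      have "integrable lborel (\<lambda>y. u x * (v y * exp (- \<i> * complex_of_real (y * x))))"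
        by (intro integrable_mult_right FT_integrand_integrable v)
      thus "integrable lborel (\<lambda>y. ?h (x, y))" by (simp add: mult_ac)
    qed
  qed
  have "(LINT \<xi>|lborel. LINT x|lborel. u x * v \<xi> * exp (- \<i> * complex_of_real (x * \<xi>)))
     = (LINT x|lborel. LINT \<xi>|lborel. u x * v \<xi> * exp (- \<i> * complex_of_real (x * \<xi>)))"
    using lborel_pair.Fubini_integral[OF int] by simp
  moreover have "(LINT x|lborel. u x * v \<xi> * exp (- \<i> * complex_of_real (x * \<xi>))) =
      v \<xi> * (LINT x|lborel. u x * exp (- \<i> * complex_of_real (x * \<xi>)))" for \<xi>
    by (subst integral_mult_right_zero[symmetric]) (simp add: mult_ac)
  moreover have "(LINT \<xi>|lborel. u x * v \<xi> * exp (- \<i> * complex_of_real (x * \<xi>))) =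
      u x * (LINT \<xi>|lborel. v \<xi> * exp (- \<i> * complex_of_real (\<xi> * x)))" for x
    by (subst integral_mult_right_zero[symmetric]) (simp add: mult_ac)
  ultimately have "(LINT \<xi>|lborel. v \<xi> * (LINT x|lborel. u x * exp (- \<i> * complex_of_real (x * \<xi>)))) =
    (LINT x|lborel. u x * (LINT \<xi>|lborel. v \<xi> * exp (- \<i> * complex_of_real (\<xi> * x))))"
    by simp
  thus ?thesis unfolding FT_def
    by (simp add: mult.commute[of _ "v _"])
qed

text \<open>
  A convergence factor on the Fourier side. Its transform is, up to normalization, a normal density
  of standard deviation \<open>\<epsilon>\<close>, which concentrates as \<open>\<epsilon>\<close> tends to zero.
\<close>

definition gauss :: "real \<Rightarrow> real \<Rightarrow> complex" where
  "gauss \<epsilon> \<xi> = complex_of_real (exp (- ((\<epsilon> * \<xi>)\<^sup>2) / 2))"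

lemma gauss_measurable [measurable]: "gauss \<epsilon> \<in> borel_measurable borel"
  unfolding gauss_def[abs_def] by measurable

lemma gauss_eq: "gauss \<epsilon> \<xi> = complex_of_real (sqrt (2 * pi) * std_normal_density (\<epsilon> * \<xi>))"
  unfolding gauss_def std_normal_density_def by simp

lemma gauss_integrable: "\<epsilon> > 0 \<Longrightarrow> integrable lborel (gauss \<epsilon>)"
proof -
  assume e: "\<epsilon> > 0"
  have "integrable lborel (\<lambda>x. std_normal_density (0 + \<epsilon> * x))"
    using e by (intro lborel_integrable_real_affine integrable_normal_density) auto
  hence "integrable lborel (\<lambda>x. complex_of_real (sqrt (2 * pi) * std_normal_density (\<epsilon> * x)))"
    by (intro integrable_of_real integrable_mult_right) simp
  thus ?thesis unfolding gauss_eq[abs_def] .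
qed

lemma std_normal_density_Fourier:
  "(LINT s|lborel. complex_of_real (std_normal_density s) * exp (\<i> * complex_of_real (t * s)))
     = complex_of_real (exp (- (t\<^sup>2) / 2))"
proof -
  have "char std_normal_distribution t = complex_of_real (exp (- (t\<^sup>2) / 2))"
    by (simp add: char_std_normal_distribution)
  moreover have "char std_normal_distribution t =
      (LINT s|lborel. std_normal_density s *\<^sub>R exp (\<i> * complex_of_real (t * s)))"
    unfolding char_def by (subst integral_density) (auto intro!: borel_measurable_continuous_onI continuous_intros)
  ultimately show ?thesis by (simp add: scaleR_conv_of_real)
qed

lemma FT_modulated_gauss:
  assumes e: "\<epsilon> > 0"
  shows "FT (\<lambda>\<xi>. gauss \<epsilon> \<xi> * exp (\<i> * complex_of_real (x * \<xi>))) y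
    = complex_of_real (sqrt (2 * pi) * normal_density x \<epsilon> y)"
proof -
  have ph: "((x - y) / \<epsilon>) * (\<epsilon> * \<xi>) = (x - y) * \<xi>" for \<xi> using e by simp
  have "(LINT \<xi>|lborel. gauss \<epsilon> \<xi> * exp (\<i> * complex_of_real (x * \<xi>)) * exp (- \<i> * complex_of_real (\<xi> * y)))
     = (LINT \<xi>|lborel. complex_of_real (sqrt (2 * pi)) * (complex_of_real (std_normal_density (\<epsilon> * \<xi>)) *
            exp (\<i> * complex_of_real (((x - y) / \<epsilon>) * (\<epsilon> * \<xi>)))))"
    unfolding ph unfolding gauss_eq
    by (intro Bochner_Integration.integral_cong)
       (auto simp: mult.assoc exp_add[symmetric] algebra_simps)
  also have "\<dots> = complex_of_real (sqrt (2 * pi)) * (LINT \<xi>|lborel. complex_of_real (std_normal_density (\<epsilon> * \<xi>)) *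
            exp (\<i> * complex_of_real (((x - y) / \<epsilon>) * (\<epsilon> * \<xi>))))"
    by (rule integral_mult_right_zero)
  also have "(LINT \<xi>|lborel. complex_of_real (std_normal_density (\<epsilon> * \<xi>)) *
            exp (\<i> * complex_of_real (((x - y) / \<epsilon>) * (\<epsilon> * \<xi>)))) =
       (LINT s|lborel. complex_of_real (std_normal_density s) * exp (\<i> * complex_of_real (((x - y) / \<epsilon>) * s))) / complex_of_real \<epsilon>"
    using e by (subst (2) lborel_integral_real_affine[where c = \<epsilon> and t = 0])
      (auto simp: scaleR_conv_of_real)
  also have "\<dots> = complex_of_real (exp (- (((x - y) / \<epsilon>)\<^sup>2) / 2) / \<epsilon>)"
    by (subst std_normal_density_Fourier) simp
  also have "exp (- (((x - y) / \<epsilon>)\<^sup>2) / 2) / \<epsilon> = sqrt (2 * pi) * normal_density x \<epsilon> y"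
  proof -
    have "sqrt (2 * pi * \<epsilon>\<^sup>2) = sqrt (2 * pi) * \<epsilon>" using e by (simp add: real_sqrt_mult)
    thus ?thesis using e unfolding normal_density_def
      by (simp add: power_divide power2_commute[of x y])
  qed
  finally show ?thesis unfolding FT_def by simp
qed

text \<open>
  The multiplication formula is used twice: once to bring $f$ back to the physical side, once for
  $g$, where the modulated Gaussian turns into a normal density centred at $x$. Every appeal to
  Fubini is then to a double integral.
\<close>

lemma FT_inner_gauss:
  assumes f: "integrable lborel f" and g: "integrable lborel g" and e: "\<epsilon> > 0"
  shows "integrable lborel (\<lambda>\<xi>. gauss \<epsilon> \<xi> * cnj (FT g \<xi>))"
    "(LINT \<xi>|lborel. FT f \<xi> * (gauss \<epsilon> \<xi> * cnj (FT g \<xi>))) =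
     (LINT x|lborel. f x * cnj (LINT y|lborel. g y * complex_of_real (normal_density x \<epsilon> y)))"
proof -
  have [measurable]: "f \<in> borel_measurable borel" "g \<in> borel_measurable borel" using f g by auto
  show k: "integrable lborel (\<lambda>\<xi>. gauss \<epsilon> \<xi> * cnj (FT g \<xi>))"
  proof (rule Bochner_Integration.integrable_bound)
    show "integrable lborel (\<lambda>\<xi>. ((LINT y|lborel. cmod (g y)) / sqrt (2 * pi)) * cmod (gauss \<epsilon> \<xi>))"
      by (intro integrable_mult_right integrable_norm gauss_integrable e)
    show "AE \<xi> in lborel. norm (gauss \<epsilon> \<xi> * cnj (FT g \<xi>))
       \<le> norm (((LINT y|lborel. cmod (g y)) / sqrt (2 * pi)) * cmod (gauss \<epsilon> \<xi>))"
    proof (rule AE_I2)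
      fix \<xi>
      have "cmod (gauss \<epsilon> \<xi>) * cmod (FT g \<xi>) \<le> cmod (gauss \<epsilon> \<xi>) * ((LINT y|lborel. cmod (g y)) / sqrt (2 * pi))"
        by (intro mult_left_mono FT_bound g) auto
      thus "norm (gauss \<epsilon> \<xi> * cnj (FT g \<xi>))
       \<le> norm (((LINT y|lborel. cmod (g y)) / sqrt (2 * pi)) * cmod (gauss \<epsilon> \<xi>))"
        by (simp add: norm_mult mult.commute)
    qed
  qed auto
  have h: "integrable lborel (\<lambda>\<xi>. gauss \<epsilon> \<xi> * exp (\<i> * complex_of_real (x * \<xi>)))" for x
    by (rule Bochner_Integration.integrable_bound[OF gauss_integrable[OF e]])
       (use cmod_exp_i_real(2)[of "x * _"] in \<open>auto simp: norm_mult\<close>)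
  have "FT (\<lambda>\<xi>. gauss \<epsilon> \<xi> * cnj (FT g \<xi>)) x = cnj (LINT y|lborel. g y * complex_of_real (normal_density x \<epsilon> y))" for x
  proof -
    have "(LINT \<xi>|lborel. gauss \<epsilon> \<xi> * cnj (FT g \<xi>) * exp (- \<i> * complex_of_real (\<xi> * x))) =
       cnj (LINT \<xi>|lborel. FT g \<xi> * (gauss \<epsilon> \<xi> * exp (\<i> * complex_of_real (x * \<xi>))))"
      by (subst Bochner_Integration.integral_cnj[symmetric], intro Bochner_Integration.integral_cong)
         (auto simp: gauss_def exp_cnj mult_ac)
    also have "(LINT \<xi>|lborel. FT g \<xi> * (gauss \<epsilon> \<xi> * exp (\<i> * complex_of_real (x * \<xi>)))) =
       (LINT y|lborel. g y * FT (\<lambda>\<xi>. gauss \<epsilon> \<xi> * exp (\<i> * complex_of_real (x * \<xi>))) y)"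
      by (rule FT_multiplication_formula[OF g h])
    also have "\<dots> = (LINT y|lborel. complex_of_real (sqrt (2 * pi)) * (g y * complex_of_real (normal_density x \<epsilon> y)))"
      unfolding FT_modulated_gauss[OF e] by (simp add: mult_ac)
    also have "\<dots> = complex_of_real (sqrt (2 * pi)) * (LINT y|lborel. g y * complex_of_real (normal_density x \<epsilon> y))"
      by (rule integral_mult_right_zero)
    finally show ?thesis unfolding FT_def[of "\<lambda>\<xi>. gauss \<epsilon> \<xi> * cnj (FT g \<xi>)"] by simp
  qed
  thus "(LINT \<xi>|lborel. FT f \<xi> * (gauss \<epsilon> \<xi> * cnj (FT g \<xi>))) =
     (LINT x|lborel. f x * cnj (LINT y|lborel. g y * complex_of_real (normal_density x \<epsilon> y)))"
    using FT_multiplication_formula[OF f k] by simp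
qed

lemma normal_density_sym: "normal_density x \<epsilon> y = normal_density y \<epsilon> x"
  unfolding normal_density_def by (simp add: power2_commute)

lemma nn_integral_normal_density: "\<epsilon> > 0 \<Longrightarrow> (\<integral>\<^sup>+y. ennreal (normal_density x \<epsilon> y) \<partial>lborel) = 1"
  by (subst nn_integral_eq_integral) auto

text \<open>
  Estimating the product $|f(x)| |f(y)|$ by half the sum of the squares leaves integrals in which one
  variable occurs in the density only, and there the density has integral one.
\<close>

lemma Schur_normal_density:
  assumes [measurable]: "f \<in> borel_measurable borel" and f: "f \<in> L2" and e: "\<epsilon> > 0"
  shows "(\<integral>\<^sup>+x. \<integral>\<^sup>+y. ennreal (cmod (f x) * cmod (f y) * normal_density x \<epsilon> y) \<partial>lborel \<partial>lborel) \<le> ennreal (charge f)"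
proof -
  let ?N = "\<lambda>x y. ennreal (normal_density x \<epsilon> y)"
  have [measurable]: "(\<lambda>(x, y). normal_density x \<epsilon> y) \<in> borel_measurable (borel \<Otimes>\<^sub>M borel)"
    unfolding normal_density_def by measurable
  have "(\<integral>\<^sup>+x. \<integral>\<^sup>+y. ennreal (cmod (f x) * cmod (f y) * normal_density x \<epsilon> y) \<partial>lborel \<partial>lborel) \<le>
     (\<integral>\<^sup>+x. \<integral>\<^sup>+y. ennreal ((cmod (f x))\<^sup>2 / 2) * ?N x y + ennreal ((cmod (f y))\<^sup>2 / 2) * ?N x y \<partial>lborel \<partial>lborel)"
  proof (intro nn_integral_mono)
    fix x y
    have "cmod (f x) * cmod (f y) \<le> (cmod (f x))\<^sup>2 / 2 + (cmod (f y))\<^sup>2 / 2"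
      using sum_squares_bound[of "cmod (f x)" "cmod (f y)"] by simp
    hence "cmod (f x) * cmod (f y) * normal_density x \<epsilon> y \<le> ((cmod (f x))\<^sup>2 / 2 + (cmod (f y))\<^sup>2 / 2) * normal_density x \<epsilon> y"
      by (intro mult_right_mono) auto
    thus "ennreal (cmod (f x) * cmod (f y) * normal_density x \<epsilon> y) \<le>
       ennreal ((cmod (f x))\<^sup>2 / 2) * ?N x y + ennreal ((cmod (f y))\<^sup>2 / 2) * ?N x y"
    proof -
      let ?A = "(cmod (f x))\<^sup>2 / 2" and ?B = "(cmod (f y))\<^sup>2 / 2" and ?n = "normal_density x \<epsilon> y"
      assume le: "cmod (f x) * cmod (f y) * ?n \<le> (?A + ?B) * ?n"
      have "ennreal (cmod (f x) * cmod (f y) * ?n) \<le> ennreal (?A * ?n + ?B * ?n)"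
        using le by (intro ennreal_leI) (simp add: ring_distribs)
      also have "\<dots> = ennreal (?A * ?n) + ennreal (?B * ?n)"
        by (rule ennreal_plus) auto
      also have "\<dots> = ennreal ?A * ennreal ?n + ennreal ?B * ennreal ?n"
        by (simp only: ennreal_mult'' normal_density_nonneg)
      finally show ?thesis .
    qed
  qed
  also have "\<dots> = (\<integral>\<^sup>+x. \<integral>\<^sup>+y. ennreal ((cmod (f x))\<^sup>2 / 2) * ?N x y \<partial>lborel \<partial>lborel) +
       (\<integral>\<^sup>+x. \<integral>\<^sup>+y. ennreal ((cmod (f y))\<^sup>2 / 2) * ?N x y \<partial>lborel \<partial>lborel)"
    by (subst nn_integral_add[symmetric]) (auto intro!: nn_integral_cong nn_integral_add)
  also have "(\<integral>\<^sup>+x. \<integral>\<^sup>+y. ennreal ((cmod (f y))\<^sup>2 / 2) * ?N x y \<partial>lborel \<partial>lborel) =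
     (\<integral>\<^sup>+y. \<integral>\<^sup>+x. ennreal ((cmod (f y))\<^sup>2 / 2) * ?N x y \<partial>lborel \<partial>lborel)"
    by (rule lborel_pair.Fubini') measurable
  also have "\<dots> = (\<integral>\<^sup>+y. \<integral>\<^sup>+x. ennreal ((cmod (f y))\<^sup>2 / 2) * ?N y x \<partial>lborel \<partial>lborel)"
    by (simp add: normal_density_sym)
  also have "(\<integral>\<^sup>+x. \<integral>\<^sup>+y. ennreal ((cmod (f x))\<^sup>2 / 2) * ?N x y \<partial>lborel \<partial>lborel) = (\<integral>\<^sup>+x. ennreal ((cmod (f x))\<^sup>2 / 2) \<partial>lborel)"
    using e by (subst nn_integral_cmult) (auto simp: nn_integral_normal_density)
  also have "(\<integral>\<^sup>+x. ennreal ((cmod (f x))\<^sup>2 / 2) \<partial>lborel) + (\<integral>\<^sup>+x. ennreal ((cmod (f x))\<^sup>2 / 2) \<partial>lborel)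
     = (\<integral>\<^sup>+x. ennreal ((cmod (f x))\<^sup>2) \<partial>lborel)"
    by (subst nn_integral_add[symmetric]) (auto simp flip: ennreal_plus)
  also have "\<dots> = ennreal (charge f)" by (rule nn_integral_charge[OF f])
  finally show ?thesis .
qed

text \<open>
  With a Gaussian factor under the integral the bound is the preceding lemma, uniformly in
  \<open>\<epsilon>\<close>; Fatou's lemma removes the factor. That the norm is preserved does not come out of this and
  has to wait for the inversion formula.
\<close>

lemma FT_contraction:
  assumes i: "integrable lborel f" and f: "f \<in> L2"
  shows "FT f \<in> L2" "charge (FT f) \<le> charge f"
proof -
  have [measurable]: "f \<in> borel_measurable borel" using f L2_measurable by auto
  have gb: "(\<integral>\<^sup>+\<xi>. ennreal ((cmod (FT f \<xi>))\<^sup>2 * cmod (gauss \<epsilon> \<xi>)) \<partial>lborel) \<le> ennreal (charge f)" if e: "\<epsilon> > 0" for \<epsilon>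
  proof -
    have eq: "(cmod (FT f \<xi>))\<^sup>2 * cmod (gauss \<epsilon> \<xi>) = Re (FT f \<xi> * (gauss \<epsilon> \<xi> * cnj (FT f \<xi>)))" for \<xi>
      unfolding gauss_def cmod_power2 by (simp add: power2_eq_square algebra_simps)
    have int: "integrable lborel (\<lambda>\<xi>. FT f \<xi> * (gauss \<epsilon> \<xi> * cnj (FT f \<xi>)))"
    proof (rule Bochner_Integration.integrable_bound)
      show "integrable lborel (\<lambda>\<xi>. ((LINT y|lborel. cmod (f y)) / sqrt (2 * pi)) * cmod (gauss \<epsilon> \<xi> * cnj (FT f \<xi>)))"
        by (intro integrable_mult_right integrable_norm FT_inner_gauss(1)[OF i i e])
      show "AE \<xi> in lborel. norm (FT f \<xi> * (gauss \<epsilon> \<xi> * cnj (FT f \<xi>)))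
         \<le> norm (((LINT y|lborel. cmod (f y)) / sqrt (2 * pi)) * cmod (gauss \<epsilon> \<xi> * cnj (FT f \<xi>)))"
      proof (rule AE_I2)
        fix \<xi>
        have "cmod (FT f \<xi>) * cmod (gauss \<epsilon> \<xi> * cnj (FT f \<xi>)) \<le> ((LINT y|lborel. cmod (f y)) / sqrt (2 * pi)) * cmod (gauss \<epsilon> \<xi> * cnj (FT f \<xi>))"
          by (intro mult_right_mono FT_bound i) auto
        thus "norm (FT f \<xi> * (gauss \<epsilon> \<xi> * cnj (FT f \<xi>)))
         \<le> norm (((LINT y|lborel. cmod (f y)) / sqrt (2 * pi)) * cmod (gauss \<epsilon> \<xi> * cnj (FT f \<xi>)))"
          unfolding norm_mult real_norm_def abs_mult abs_norm_cancel
          by (meson abs_ge_self mult_right_mono norm_ge_zero mult_nonneg_nonneg order_trans)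
      qed
    qed auto
    have intR: "integrable lborel (\<lambda>\<xi>. (cmod (FT f \<xi>))\<^sup>2 * cmod (gauss \<epsilon> \<xi>))"
      unfolding eq by (rule integrable_Re[OF int])
    have "(LINT \<xi>|lborel. (cmod (FT f \<xi>))\<^sup>2 * cmod (gauss \<epsilon> \<xi>)) = Re (LINT \<xi>|lborel. FT f \<xi> * (gauss \<epsilon> \<xi> * cnj (FT f \<xi>)))"
      unfolding eq by (rule integral_Re[OF int])
    also have "\<dots> \<le> cmod (LINT x|lborel. f x * cnj (LINT y|lborel. f y * complex_of_real (normal_density x \<epsilon> y)))"
      unfolding FT_inner_gauss(2)[OF i i e] by (rule complex_Re_le_cmod)
    finally have 0: "(LINT \<xi>|lborel. (cmod (FT f \<xi>))\<^sup>2 * cmod (gauss \<epsilon> \<xi>)) \<le>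
      cmod (LINT x|lborel. f x * cnj (LINT y|lborel. f y * complex_of_real (normal_density x \<epsilon> y)))" .
    have "(\<integral>\<^sup>+\<xi>. ennreal ((cmod (FT f \<xi>))\<^sup>2 * cmod (gauss \<epsilon> \<xi>)) \<partial>lborel) =
       ennreal (LINT \<xi>|lborel. (cmod (FT f \<xi>))\<^sup>2 * cmod (gauss \<epsilon> \<xi>))"
      by (rule nn_integral_eq_integral[OF intR]) simp
    hence 1: "(\<integral>\<^sup>+\<xi>. ennreal ((cmod (FT f \<xi>))\<^sup>2 * cmod (gauss \<epsilon> \<xi>)) \<partial>lborel) \<le>
      ennreal (cmod (LINT x|lborel. f x * cnj (LINT y|lborel. f y * complex_of_real (normal_density x \<epsilon> y))))"
      using ennreal_leI[OF 0] by simp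
    have lem: "ennreal (norm (integral\<^sup>L lborel h)) \<le> (\<integral>\<^sup>+x. ennreal (norm (h x)) \<partial>lborel)" for h :: "real \<Rightarrow> complex"
    proof (cases "integrable lborel h")
      case True thus ?thesis by (rule integral_norm_bound_ennreal)
    qed (simp add: not_integrable_integral_eq)
    note 1
    also have "ennreal (cmod (LINT x|lborel. f x * cnj (LINT y|lborel. f y * complex_of_real (normal_density x \<epsilon> y))))
       \<le> (\<integral>\<^sup>+x. ennreal (cmod (f x * cnj (LINT y|lborel. f y * complex_of_real (normal_density x \<epsilon> y)))) \<partial>lborel)"
      by (rule lem)
    also have "\<dots> \<le> (\<integral>\<^sup>+x. \<integral>\<^sup>+y. ennreal (cmod (f x) * cmod (f y) * normal_density x \<epsilon> y) \<partial>lborel \<partial>lborel)"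
    proof (rule nn_integral_mono)
      fix x
      have "ennreal (cmod (f x * cnj (LINT y|lborel. f y * complex_of_real (normal_density x \<epsilon> y))))
        = ennreal (cmod (f x)) * ennreal (cmod (LINT y|lborel. f y * complex_of_real (normal_density x \<epsilon> y)))"
        by (simp add: norm_mult ennreal_mult)
      also have "\<dots> \<le> ennreal (cmod (f x)) * (\<integral>\<^sup>+y. ennreal (cmod (f y * complex_of_real (normal_density x \<epsilon> y))) \<partial>lborel)"
        by (intro mult_left_mono lem) auto
      also have "\<dots> = (\<integral>\<^sup>+y. ennreal (cmod (f x) * cmod (f y) * normal_density x \<epsilon> y) \<partial>lborel)"
        by (subst nn_integral_cmult[symmetric]) (auto simp: norm_mult ennreal_mult mult.assoc)
      finally show "ennreal (cmod (f x * cnj (LINT y|lborel. f y * complex_of_real (normal_density x \<epsilon> y)))) \<le> \<dots>" .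
    qed
    also have "\<dots> \<le> ennreal (charge f)" by (rule Schur_normal_density) (use f e in auto)
    finally show ?thesis .
  qed
  have "(\<integral>\<^sup>+\<xi>. ennreal ((cmod (FT f \<xi>))\<^sup>2) \<partial>lborel) =
      (\<integral>\<^sup>+\<xi>. liminf (\<lambda>n. ennreal ((cmod (FT f \<xi>))\<^sup>2 * cmod (gauss (1 / real (Suc n)) \<xi>))) \<partial>lborel)"
  proof (rule nn_integral_cong)
    fix \<xi>
    have "(\<lambda>n. 1 / real (Suc n)) \<longlonglongrightarrow> 0" using LIMSEQ_inverse_real_of_nat by (simp add: inverse_eq_divide)
    hence "(\<lambda>n. (cmod (FT f \<xi>))\<^sup>2 * cmod (gauss (1 / real (Suc n)) \<xi>)) \<longlonglongrightarrow> (cmod (FT f \<xi>))\<^sup>2 * cmod (complex_of_real (exp (- ((0 * \<xi>)\<^sup>2) / 2)))"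
      unfolding gauss_def by (intro tendsto_intros) auto
    hence "(\<lambda>n. ennreal ((cmod (FT f \<xi>))\<^sup>2 * cmod (gauss (1 / real (Suc n)) \<xi>))) \<longlonglongrightarrow> ennreal ((cmod (FT f \<xi>))\<^sup>2)"
      by (intro tendsto_ennrealI) simp
    thus "ennreal ((cmod (FT f \<xi>))\<^sup>2) = liminf (\<lambda>n. ennreal ((cmod (FT f \<xi>))\<^sup>2 * cmod (gauss (1 / real (Suc n)) \<xi>)))"
      using lim_imp_Liminf[OF sequentially_bot] by metis
  qed
  also have "\<dots> \<le> liminf (\<lambda>n. \<integral>\<^sup>+\<xi>. ennreal ((cmod (FT f \<xi>))\<^sup>2 * cmod (gauss (1 / real (Suc n)) \<xi>)) \<partial>lborel)"
    by (rule nn_integral_liminf) auto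
  also have "\<dots> \<le> liminf (\<lambda>n. ennreal (charge f))"
    by (intro Liminf_mono always_eventually allI gb) simp
  also have "\<dots> = ennreal (charge f)" by (simp add: Liminf_const)
  finally have *: "(\<integral>\<^sup>+\<xi>. ennreal ((cmod (FT f \<xi>))\<^sup>2) \<partial>lborel) \<le> ennreal (charge f)" .
  show "FT f \<in> L2" "charge (FT f) \<le> charge f"
    using L2_of_nn_integral[OF _ *] charge_nonneg by auto
qed

section \<open>The Plancherel theorem\<close>

lemma indicator_L2: "(\<lambda>x. indicator {a..b} x :: complex) \<in> L2"
proof (rule L2I)
  have "(\<lambda>x. (cmod (indicator {a..b} x))\<^sup>2) = (indicator {a..b} :: real \<Rightarrow> real)"
    by (auto simp: indicator_def)
  moreover have "integrable lborel (indicator {a..b} :: real \<Rightarrow> real)"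
    by (rule integrable_real_indicator) (auto simp: emeasure_lborel_Icc_eq)
  ultimately show "integrable lborel (\<lambda>x. (cmod (indicator {a..b} x))\<^sup>2)" by simp
qed simp

lemma trunc_L2: "u \<in> L2 \<Longrightarrow> trunc R u \<in> L2"
  unfolding trunc_def[abs_def] by (intro L2_indicator) auto

lemma L2_integrable_on_interval: "u \<in> L2 \<Longrightarrow> integrable lborel (\<lambda>x. indicator {a..b} x * u x)"
  by (intro L2_mult_integrable indicator_L2)

lemma trunc_integrable: "u \<in> L2 \<Longrightarrow> integrable lborel (trunc R u)"
  unfolding trunc_def[abs_def] by (rule L2_integrable_on_interval)

lemma L2_set_integrable: "u \<in> L2 \<Longrightarrow> set_integrable lborel {a..b} u"
  using L2_integrable_on_interval[of u a b] unfolding set_integrable_def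
  by (auto simp: scaleR_conv_of_real of_real_indicator)

lemma trunc_tail:
  assumes "u \<in> L2" shows "((\<lambda>R. l2n (\<lambda>x. u x - trunc R u x)) \<longlongrightarrow> 0) at_top"
proof -
  have [measurable]: "u \<in> borel_measurable borel" using assms L2_measurable by auto
  have "((\<lambda>R. LINT x|lborel. (cmod (u x - trunc R u x))\<^sup>2) \<longlongrightarrow> (LINT x::real|lborel. 0)) at_top"
  proof (rule integral_dominated_convergence_at_top)
    show "integrable lborel (\<lambda>x. (cmod (u x))\<^sup>2)" by (rule L2_integrable[OF assms])
    show "\<forall>\<^sub>F R in at_top. AE x in lborel. norm ((cmod (u x - trunc R u x))\<^sup>2) \<le> (cmod (u x))\<^sup>2"
      by (intro always_eventually allI AE_I2) (auto simp: trunc_def indicator_def)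
    show "AE x in lborel. ((\<lambda>R. (cmod (u x - trunc R u x))\<^sup>2) \<longlongrightarrow> 0) at_top"
    proof (rule AE_I2, rule tendsto_eventually)
      fix x
      show "\<forall>\<^sub>F R in at_top. (cmod (u x - trunc R u x))\<^sup>2 = 0"
        using eventually_ge_at_top[of "\<bar>x\<bar>"]
        by eventually_elim (auto simp: trunc_def indicator_def abs_le_iff)
    qed
  qed (auto simp: trunc_def)
  hence "((\<lambda>R. sqrt (charge (\<lambda>x. u x - trunc R u x))) \<longlongrightarrow> sqrt 0) at_top"
    unfolding charge_def by (intro tendsto_intros) simp
  thus ?thesis by (simp add: l2n_def)
qed

lemma l2_conv_trunc: "u \<in> L2 \<Longrightarrow> l2_conv (\<lambda>n. trunc (real n) u) u"
  unfolding l2_conv_def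
  by (subst l2n_minus_commute) (rule filterlim_compose[OF trunc_tail filterlim_real_sequentially])

lemma FT_trunc_L2: "u \<in> L2 \<Longrightarrow> FT (trunc R u) \<in> L2"
  by (intro FT_contraction trunc_integrable trunc_L2)

lemma FT_trunc_contraction:
  assumes "u \<in> L2" "v \<in> L2"
  shows "l2n (\<lambda>\<xi>. FT (trunc R u) \<xi> - FT (trunc S v) \<xi>) \<le> l2n (\<lambda>x. trunc R u x - trunc S v x)"
proof -
  have "charge (FT (\<lambda>x. trunc R u x - trunc S v x)) \<le> charge (\<lambda>x. trunc R u x - trunc S v x)"
    by (intro FT_contraction Bochner_Integration.integrable_diff L2_diff trunc_integrable trunc_L2 assms)
  moreover have "FT (\<lambda>x. trunc R u x - trunc S v x) = (\<lambda>\<xi>. FT (trunc R u) \<xi> - FT (trunc S v) \<xi>)"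
    by (rule ext) (intro FT_diff trunc_integrable assms)
  ultimately show ?thesis unfolding l2n_def by simp
qed

text \<open>
  The contraction bounds the distance between the transform of a truncation and the limit by the
  tail of $u$, so convergence along the integers gives convergence along the reals.
\<close>

lemma is_fourierI:
  assumes u: "u \<in> L2" and v: "v \<in> L2" and c: "l2_conv (\<lambda>n. FT (trunc (real n) u)) v"
  shows "is_fourier u v"
proof -
  have bnd: "l2n (\<lambda>\<xi>. FT (trunc R u) \<xi> - v \<xi>) \<le> l2n (\<lambda>x. u x - trunc R u x)" for R
  proof -
    have "(\<lambda>n. l2n (\<lambda>x. trunc R u x - trunc (real n) u x)) \<longlonglongrightarrow> l2n (\<lambda>x. trunc R u x - u x)"
      by (rule l2_conv_l2n[OF l2_conv_dominated[OF l2_conv_trunc[OF u], where C = 1]])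
         (use u trunc_L2 L2_diff l2n_minus_commute[of "trunc _ u" u] in auto)
    moreover have "(\<lambda>n. l2n (\<lambda>\<xi>. FT (trunc R u) \<xi> - FT (trunc (real n) u) \<xi>)) \<longlonglongrightarrow> l2n (\<lambda>\<xi>. FT (trunc R u) \<xi> - v \<xi>)"
      by (rule l2_conv_l2n[OF l2_conv_dominated[OF c, where C = 1]])
         (use u v FT_trunc_L2 L2_diff l2n_minus_commute[of _ v] in auto)
    ultimately have "l2n (\<lambda>\<xi>. FT (trunc R u) \<xi> - v \<xi>) \<le> l2n (\<lambda>x. trunc R u x - u x)"
      using FT_trunc_contraction[OF u u] by (intro LIMSEQ_le) auto
    thus ?thesis using l2n_minus_commute[of u] by simp
  qed
  have "((\<lambda>R. l2n (\<lambda>\<xi>. FT (trunc R u) \<xi> - v \<xi>)) \<longlongrightarrow> 0) at_top"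
    by (rule Lim_null_comparison[OF _ trunc_tail[OF u]]) (use bnd l2n_nonneg in auto)
  hence "((\<lambda>R. ennreal ((l2n (\<lambda>\<xi>. FT (trunc R u) \<xi> - v \<xi>))\<^sup>2)) \<longlongrightarrow> ennreal (0\<^sup>2)) at_top"
    by (intro tendsto_ennrealI tendsto_intros)
  moreover have "(\<integral>\<^sup>+\<xi>. ennreal ((cmod (FT (trunc R u) \<xi> - v \<xi>))\<^sup>2) \<partial>lborel) = ennreal ((l2n (\<lambda>\<xi>. FT (trunc R u) \<xi> - v \<xi>))\<^sup>2)" for R
    unfolding l2n_sq by (rule nn_integral_charge) (intro L2_diff FT_trunc_L2 u v)
  ultimately show ?thesis unfolding is_fourier_def fourier_trunc_eq using v by simp
qed

lemma is_fourierD: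
  assumes u: "u \<in> L2" and "is_fourier u v"
  shows "v \<in> L2" "l2_conv (\<lambda>n. FT (trunc (real n) u)) v"
proof -
  show v: "v \<in> L2" using assms by (simp add: is_fourier_def)
  have "(\<integral>\<^sup>+\<xi>. ennreal ((cmod (FT (trunc R u) \<xi> - v \<xi>))\<^sup>2) \<partial>lborel) = ennreal (charge (\<lambda>\<xi>. FT (trunc R u) \<xi> - v \<xi>))" for R
    by (rule nn_integral_charge) (intro L2_diff FT_trunc_L2 u v)
  hence "((\<lambda>R. ennreal (charge (\<lambda>\<xi>. FT (trunc R u) \<xi> - v \<xi>))) \<longlongrightarrow> 0) at_top"
    using assms(2) unfolding is_fourier_def fourier_trunc_eq by simp
  hence "((\<lambda>R. charge (\<lambda>\<xi>. FT (trunc R u) \<xi> - v \<xi>)) \<longlongrightarrow> 0) at_top"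
    by (simp flip: ennreal_0 add: tendsto_ennreal_iff charge_nonneg)
  hence "((\<lambda>R. l2n (\<lambda>\<xi>. FT (trunc R u) \<xi> - v \<xi>)) \<longlongrightarrow> sqrt 0) at_top"
    unfolding l2n_def by (intro tendsto_intros)
  thus "l2_conv (\<lambda>n. FT (trunc (real n) u)) v"
    unfolding l2_conv_def by (auto intro: filterlim_compose[OF _ filterlim_real_sequentially])
qed

theorem fourier_exists:
  assumes u: "u \<in> L2" shows "is_fourier u (fourier u)"
proof -
  obtain v where "v \<in> L2" "l2_conv (\<lambda>n. FT (trunc (real n) u)) v"
  proof (rule L2_complete)
    show "FT (trunc (real n) u) \<in> L2" for n by (rule FT_trunc_L2[OF u])
    fix e :: real assume "e > 0"
    have "(\<lambda>n. l2n (\<lambda>x. trunc (real n) u x - u x)) \<longlonglongrightarrow> 0"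
      using l2_conv_trunc[OF u] by (simp add: l2_conv_def)
    from LIMSEQ_D[OF this, of "e / 2"] \<open>e > 0\<close>
    obtain N where N: "\<And>n. n \<ge> N \<Longrightarrow> l2n (\<lambda>x. trunc (real n) u x - u x) < e / 2"
      using l2n_nonneg by auto
    have "l2n (\<lambda>\<xi>. FT (trunc (real n) u) \<xi> - FT (trunc (real k) u) \<xi>) < e" if "n \<ge> N" "k \<ge> N" for n k
      using FT_trunc_contraction[OF u u, of n k] N[OF that(1)] N[OF that(2)]
        l2n_diff_triangle[OF trunc_L2[OF u] u trunc_L2[OF u], of n k] l2n_minus_commute[of u "trunc k u"]
      by linarith
    thus "\<exists>N. \<forall>n\<ge>N. \<forall>k\<ge>N. l2n (\<lambda>\<xi>. FT (trunc (real n) u) \<xi> - FT (trunc (real k) u) \<xi>) < e" by blast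
  qed
  hence "is_fourier u v" using is_fourierI[OF u] by blast
  thus ?thesis unfolding fourier_def by (rule someI[where P = "is_fourier u"])
qed

lemma fourier_L2: "u \<in> L2 \<Longrightarrow> fourier u \<in> L2"
  using is_fourierD(1)[OF _ fourier_exists] by blast

lemma fourier_conv: "u \<in> L2 \<Longrightarrow> l2_conv (\<lambda>n. FT (trunc (real n) u)) (fourier u)"
  using is_fourierD(2)[OF _ fourier_exists] by blast

lemma fourier_eqI:
  assumes "u \<in> L2" "v \<in> L2" "l2_conv (\<lambda>n. FT (trunc (real n) u)) v"
  shows "AE \<xi> in lborel. fourier u \<xi> = v \<xi>"
  by (rule l2_conv_unique[OF fourier_conv assms(3)]) (use assms FT_trunc_L2 fourier_L2 in auto)

lemma fourier_cong:
  assumes "u \<in> borel_measurable borel" "v \<in> borel_measurable borel" "AE x in lborel. u x = v x"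
  shows "fourier u = fourier v"
proof -
  have [measurable]: "u \<in> borel_measurable borel" "v \<in> borel_measurable borel" by fact+
  have "fourier_trunc R u \<xi> = fourier_trunc R v \<xi>" for R \<xi>
    unfolding fourier_trunc_def set_lebesgue_integral_def
    by (intro arg_cong2[where f = "(/)"] integral_cong_AE refl)
       (use assms(3) in \<open>auto elim!: eventually_mono\<close>)
  hence "fourier_trunc R u = fourier_trunc R v" for R by blast
  thus ?thesis unfolding fourier_def is_fourier_def by simp
qed

lemma fourier_integrable:
  assumes u: "u \<in> L2" "integrable lborel u"
  shows "AE \<xi> in lborel. fourier u \<xi> = FT u \<xi>"
proof (rule l2_conv_pointwise_unique[OF fourier_conv[OF u(1)]])
  have [measurable]: "u \<in> borel_measurable borel" using u by auto
  show "FT u \<in> borel_measurable borel" by measurable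
  show "AE \<xi> in lborel. (\<lambda>n. FT (trunc (real n) u) \<xi>) \<longlonglongrightarrow> FT u \<xi>"
  proof (rule AE_I2)
    fix \<xi>
    have "(\<lambda>n. LINT y|lborel. trunc (real n) u y * exp (- \<i> * complex_of_real (y * \<xi>)))
       \<longlonglongrightarrow> (LINT y|lborel. u y * exp (- \<i> * complex_of_real (y * \<xi>)))"
    proof (rule integral_dominated_convergence)
      show "integrable lborel (\<lambda>y. cmod (u y))" using u by auto
      show "AE y in lborel. (\<lambda>n. trunc (real n) u y * exp (- \<i> * complex_of_real (y * \<xi>))) \<longlonglongrightarrow> u y * exp (- \<i> * complex_of_real (y * \<xi>))"
      proof (rule AE_I2, rule tendsto_eventually)
        fix y :: real
        obtain N :: nat where "\<bar>y\<bar> \<le> real N" using real_arch_simple[of "\<bar>y\<bar>"] by blast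
        thus "\<forall>\<^sub>F n in sequentially. trunc (real n) u y * exp (- \<i> * complex_of_real (y * \<xi>)) = u y * exp (- \<i> * complex_of_real (y * \<xi>))"
          by (intro eventually_sequentiallyI[of N]) (auto simp: trunc_def indicator_def abs_le_iff)
      qed
      show "AE y in lborel. norm (trunc (real n) u y * exp (- \<i> * complex_of_real (y * \<xi>))) \<le> cmod (u y)" for n
        using cmod_exp_i_real(1)[of "_ * \<xi>"] by (auto simp: trunc_def norm_mult indicator_def)
    qed (auto simp: trunc_def)
    thus "(\<lambda>n. FT (trunc (real n) u) \<xi>) \<longlonglongrightarrow> FT u \<xi>"
      unfolding FT_def by (intro tendsto_intros) auto
  qed
qed (use u FT_trunc_L2 fourier_L2 in auto)

lemma fourier_add:
  assumes "u \<in> L2" "v \<in> L2"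
  shows "AE \<xi> in lborel. fourier (\<lambda>x. u x + v x) \<xi> = fourier u \<xi> + fourier v \<xi>"
proof (rule fourier_eqI)
  have tr: "trunc R (\<lambda>x. u x + v x) = (\<lambda>x. trunc R u x + trunc R v x)" for R
    by (auto simp: trunc_def ring_distribs)
  have FTa: "FT (trunc R (\<lambda>x. u x + v x)) = (\<lambda>\<xi>. FT (trunc R u) \<xi> + FT (trunc R v) \<xi>)" for R
    unfolding tr by (rule ext) (intro FT_add trunc_integrable assms)
  show "l2_conv (\<lambda>n. FT (trunc (real n) (\<lambda>x. u x + v x))) (\<lambda>\<xi>. fourier u \<xi> + fourier v \<xi>)"
    unfolding l2_conv_def
  proof (rule Lim_null_comparison)
    have "(\<lambda>n. l2n (\<lambda>\<xi>. FT (trunc (real n) u) \<xi> - fourier u \<xi>) + l2n (\<lambda>\<xi>. FT (trunc (real n) v) \<xi> - fourier v \<xi>)) \<longlonglongrightarrow> 0 + 0"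
      using fourier_conv[OF assms(1)] fourier_conv[OF assms(2)] unfolding l2_conv_def by (intro tendsto_intros)
    thus "(\<lambda>n. l2n (\<lambda>\<xi>. FT (trunc (real n) u) \<xi> - fourier u \<xi>) + l2n (\<lambda>\<xi>. FT (trunc (real n) v) \<xi> - fourier v \<xi>)) \<longlonglongrightarrow> 0" by simp
    show "\<forall>\<^sub>F n in sequentially. norm (l2n (\<lambda>\<xi>. FT (trunc (real n) (\<lambda>x. u x + v x)) \<xi> - (fourier u \<xi> + fourier v \<xi>)))
      \<le> l2n (\<lambda>\<xi>. FT (trunc (real n) u) \<xi> - fourier u \<xi>) + l2n (\<lambda>\<xi>. FT (trunc (real n) v) \<xi> - fourier v \<xi>)"
    proof (intro always_eventually allI)
      fix n
      have "l2n (\<lambda>\<xi>. (FT (trunc (real n) u) \<xi> - fourier u \<xi>) + (FT (trunc (real n) v) \<xi> - fourier v \<xi>))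
        \<le> l2n (\<lambda>\<xi>. FT (trunc (real n) u) \<xi> - fourier u \<xi>) + l2n (\<lambda>\<xi>. FT (trunc (real n) v) \<xi> - fourier v \<xi>)"
        by (intro l2n_triangle L2_diff FT_trunc_L2 fourier_L2 assms)
      thus "norm (l2n (\<lambda>\<xi>. FT (trunc (real n) (\<lambda>x. u x + v x)) \<xi> - (fourier u \<xi> + fourier v \<xi>)))
      \<le> l2n (\<lambda>\<xi>. FT (trunc (real n) u) \<xi> - fourier u \<xi>) + l2n (\<lambda>\<xi>. FT (trunc (real n) v) \<xi> - fourier v \<xi>)"
        unfolding FTa using l2n_nonneg by (simp add: algebra_simps)
    qed
  qed
qed (intro L2_add fourier_L2 assms)+

lemma fourier_cmult:
  assumes "u \<in> L2"
  shows "AE \<xi> in lborel. fourier (\<lambda>x. c * u x) \<xi> = c * fourier u \<xi>"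
proof (rule fourier_eqI)
  have tr: "trunc R (\<lambda>x. c * u x) = (\<lambda>x. c * trunc R u x)" for R by (auto simp: trunc_def)
  have FTa: "FT (trunc R (\<lambda>x. c * u x)) = (\<lambda>\<xi>. c * FT (trunc R u) \<xi>)" for R
    unfolding tr by (rule ext) (rule FT_cmult)
  show "l2_conv (\<lambda>n. FT (trunc (real n) (\<lambda>x. c * u x))) (\<lambda>\<xi>. c * fourier u \<xi>)"
    by (rule l2_conv_dominated[OF fourier_conv[OF assms], where C = "cmod c"])
       (simp add: FTa l2n_cmult flip: right_diff_distrib)
qed (intro L2_cmult fourier_L2 assms)+

lemma fourier_diff:
  assumes "u \<in> L2" "v \<in> L2"
  shows "AE \<xi> in lborel. fourier (\<lambda>x. u x - v x) \<xi> = fourier u \<xi> - fourier v \<xi>"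
  using fourier_add[OF assms(1) L2_cmult[OF assms(2), of "-1"]] fourier_cmult[OF assms(2), of "-1"]
  by eventually_elim simp

lemma charge_reflect: "charge (\<lambda>x. f (- x)) = charge f"
  using charge_affine[of "-1" f 0] by simp

lemma L2_reflect: "f \<in> L2 \<Longrightarrow> (\<lambda>x. f (- x)) \<in> L2"
  using L2_affine[of f "-1" 0] by simp

lemma l2_conv_reflect: "l2_conv f g \<Longrightarrow> l2_conv (\<lambda>n x. f n (- x)) (\<lambda>x. g (- x))"
  unfolding l2_conv_def l2n_def using charge_reflect[of "\<lambda>x. f _ x - g x"] by simp

lemma fourier_reflect:
  assumes "u \<in> L2"
  shows "AE \<xi> in lborel. fourier (\<lambda>x. u (- x)) \<xi> = fourier u (- \<xi>)"
proof (rule fourier_eqI)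
  have tr: "trunc R (\<lambda>x. u (- x)) = (\<lambda>x. trunc R u (- x))" for R
    by (rule ext) (auto simp: trunc_def indicator_def)
  show "l2_conv (\<lambda>n. FT (trunc (real n) (\<lambda>x. u (- x)))) (\<lambda>\<xi>. fourier u (- \<xi>))"
    unfolding tr FT_reflect[abs_def] by (rule l2_conv_reflect[OF fourier_conv[OF assms]])
qed (intro L2_reflect fourier_L2 assms)+

lemma fourier_cnj:
  assumes "u \<in> L2"
  shows "AE \<xi> in lborel. fourier (\<lambda>x. cnj (u x)) \<xi> = cnj (fourier u (- \<xi>))"
proof (rule fourier_eqI)
  have tr: "trunc R (\<lambda>x. cnj (u x)) = (\<lambda>x. cnj (trunc R u x))" for R by (auto simp: trunc_def indicator_def)
  show "l2_conv (\<lambda>n. FT (trunc (real n) (\<lambda>x. cnj (u x)))) (\<lambda>\<xi>. cnj (fourier u (- \<xi>)))"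
    unfolding tr FT_cnj[abs_def] 
    by (rule l2_conv_dominated[OF l2_conv_reflect[OF fourier_conv[OF assms]], where C = 1])
       (simp add: l2n_def charge_cnj flip: complex_cnj_diff)
qed (intro L2_reflect[of "\<lambda>x. cnj (fourier u x)", simplified] L2_cnj fourier_L2 assms)+

lemma fourier_multiplication_formula:
  assumes "u \<in> L2" "v \<in> L2"
  shows "(LINT \<xi>|lborel. fourier u \<xi> * v \<xi>) = (LINT x|lborel. u x * fourier v x)"
proof (rule LIMSEQ_unique)
  show "(\<lambda>n. LINT \<xi>|lborel. FT (trunc (real n) u) \<xi> * trunc (real n) v \<xi>) \<longlonglongrightarrow> (LINT \<xi>|lborel. fourier u \<xi> * v \<xi>)"
    by (rule l2_conv_integral_mult[OF fourier_conv l2_conv_trunc])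
       (use assms FT_trunc_L2 trunc_L2 fourier_L2 in auto)
  have "(\<lambda>n. LINT x|lborel. trunc (real n) u x * FT (trunc (real n) v) x) \<longlonglongrightarrow> (LINT x|lborel. u x * fourier v x)"
    by (rule l2_conv_integral_mult[OF l2_conv_trunc fourier_conv])
       (use assms FT_trunc_L2 trunc_L2 fourier_L2 in auto)
  thus "(\<lambda>n. LINT \<xi>|lborel. FT (trunc (real n) u) \<xi> * trunc (real n) v \<xi>) \<longlonglongrightarrow> (LINT x|lborel. u x * fourier v x)"
    by (simp add: FT_multiplication_formula trunc_integrable assms)
qed

text \<open>
  After the substitution $y = x + \varepsilon s$ the density no longer depends on $\varepsilon$,
  and the indicator converges because $x$ is not an endpoint.
\<close>

lemma normal_density_approximates_indicator:
  assumes "a < b" "x \<noteq> a" "x \<noteq> b"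
  shows "(\<lambda>n. LINT y|lborel. indicator {a..b} y * complex_of_real (normal_density x (1 / real (Suc n)) y))
     \<longlonglongrightarrow> indicator {a..b} x"
proof -
  have e0: "(\<lambda>n. 1 / real (Suc n)) \<longlonglongrightarrow> 0" using LIMSEQ_inverse_real_of_nat by (simp add: inverse_eq_divide)
  have sub: "(LINT y|lborel. indicator {a..b} y * complex_of_real (normal_density x \<epsilon> y)) =
     (LINT s|lborel. indicator {a..b} (x + \<epsilon> * s) * complex_of_real (std_normal_density s))" if "\<epsilon> > 0" for \<epsilon>
  proof -
    have "\<epsilon> * normal_density x \<epsilon> (x + \<epsilon> * s) = std_normal_density s" for s
      using that unfolding normal_density_def std_normal_density_def
      by (simp add: real_sqrt_mult power_mult_distrib)
    hence *: "complex_of_real \<epsilon> * (indicator {a..b} (x + \<epsilon> * s) * complex_of_real (normal_density x \<epsilon> (x + \<epsilon> * s)))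
       = indicator {a..b} (x + \<epsilon> * s) * complex_of_real (std_normal_density s)" for s
      by (metis mult.left_commute of_real_mult)
    show ?thesis
      using that by (subst lborel_integral_real_affine[where c = \<epsilon> and t = x])
        (auto simp: scaleR_conv_of_real * simp del: mult_eq_0_iff simp flip: integral_mult_right_zero)
  qed
  have "(\<lambda>n. LINT s|lborel. indicator {a..b} (x + 1 / real (Suc n) * s) * complex_of_real (std_normal_density s))
     \<longlonglongrightarrow> (LINT s|lborel. indicator {a..b} x * complex_of_real (std_normal_density s))"
  proof (rule integral_dominated_convergence)
    show "integrable lborel std_normal_density" by simp
    show "AE s in lborel. (\<lambda>n. indicator {a..b} (x + 1 / real (Suc n) * s) * complex_of_real (std_normal_density s))
        \<longlonglongrightarrow> indicator {a..b} x * complex_of_real (std_normal_density s)"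
    proof (intro AE_I2 tendsto_mult tendsto_const)
      fix s
      have "(\<lambda>n. x + 1 / real (Suc n) * s) \<longlonglongrightarrow> x + 0 * s" by (intro tendsto_intros e0)
      hence l: "(\<lambda>n. x + 1 / real (Suc n) * s) \<longlonglongrightarrow> x" by simp
      have "\<forall>\<^sub>F n in sequentially. indicator {a..b} (x + 1 / real (Suc n) * s) = (indicator {a..b} x :: complex)"
      proof -
        consider "x < a" | "a < x \<and> x < b" | "b < x" using assms by linarith
        thus ?thesis
        proof cases
          case 1 
          show ?thesis using order_tendstoD(2)[OF l 1] by eventually_elim (use 1 in \<open>auto simp: indicator_def\<close>)
        next
          case 2
          show ?thesis using order_tendstoD(2)[OF l conjunct2[OF 2]] order_tendstoD(1)[OF l conjunct1[OF 2]] 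
            by eventually_elim (use 2 in \<open>auto simp: indicator_def\<close>)
        next
          case 3
          show ?thesis using order_tendstoD(1)[OF l 3] by eventually_elim (use 3 in \<open>auto simp: indicator_def\<close>)
        qed
      qed
      thus "(\<lambda>n. indicator {a..b} (x + 1 / real (Suc n) * s) :: complex) \<longlonglongrightarrow> indicator {a..b} x"
        by (rule tendsto_eventually)
    qed
    show "AE s in lborel. norm (indicator {a..b} (x + 1 / real (Suc n) * s) * complex_of_real (std_normal_density s))
       \<le> std_normal_density s" for n
      by (intro AE_I2) (auto simp: norm_mult indicator_def)
  qed auto
  also have "(LINT s|lborel. indicator {a..b} x * complex_of_real (std_normal_density s)) = indicator {a..b} x"
    by (simp add: integral_mult_right_zero)
  finally show ?thesis by (subst sub) auto
qed

text \<open>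
  The limit of \<open>FT_inner_gauss\<close> for \<open>\<epsilon>\<close> tending to zero. On the Fourier side the integrand is
  dominated by a product of two transforms, which are in $L^2$ by the contraction.
\<close>

lemma FT_inner_indicator:
  assumes i: "integrable lborel f" and f: "f \<in> L2" and ab: "a < b"
  shows "(LINT \<xi>|lborel. FT f \<xi> * cnj (FT (indicator {a..b}) \<xi>)) = (LINT x|lborel. f x * indicator {a..b} x)"
proof (rule LIMSEQ_unique)
  have [measurable]: "f \<in> borel_measurable borel" using f L2_measurable by auto
  have e0: "(\<lambda>n. 1 / real (Suc n)) \<longlonglongrightarrow> 0" using LIMSEQ_inverse_real_of_nat by (simp add: inverse_eq_divide)
  have g: "integrable lborel (indicator {a..b} :: real \<Rightarrow> complex)"
    using trunc_integrable L2_mult_integrable[OF indicator_L2[of a b] indicator_L2[of a b]]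
    by (simp flip: indicator_inter_arith)
  have g2: "(indicator {a..b} :: real \<Rightarrow> complex) \<in> L2" using indicator_L2 by simp
  show "(\<lambda>n. LINT \<xi>|lborel. FT f \<xi> * (gauss (1 / real (Suc n)) \<xi> * cnj (FT (indicator {a..b}) \<xi>)))
      \<longlonglongrightarrow> (LINT \<xi>|lborel. FT f \<xi> * cnj (FT (indicator {a..b}) \<xi>))"
  proof (rule integral_dominated_convergence)
    show "integrable lborel (\<lambda>\<xi>. cmod (FT f \<xi> * cnj (FT (indicator {a..b}) \<xi>)))"
      by (intro integrable_norm L2_mult_integrable L2_cnj FT_contraction i f g g2)
    show "AE \<xi> in lborel. (\<lambda>n. FT f \<xi> * (gauss (1 / real (Suc n)) \<xi> * cnj (FT (indicator {a..b}) \<xi>)))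
       \<longlonglongrightarrow> FT f \<xi> * cnj (FT (indicator {a..b}) \<xi>)"
    proof (rule AE_I2)
      fix \<xi>
      have "(\<lambda>n. FT f \<xi> * (gauss (1 / real (Suc n)) \<xi> * cnj (FT (indicator {a..b}) \<xi>)))
       \<longlonglongrightarrow> FT f \<xi> * (complex_of_real (exp (- ((0 * \<xi>)\<^sup>2) / 2)) * cnj (FT (indicator {a..b}) \<xi>))"
        unfolding gauss_def by (intro tendsto_intros e0) auto
      thus "(\<lambda>n. FT f \<xi> * (gauss (1 / real (Suc n)) \<xi> * cnj (FT (indicator {a..b}) \<xi>)))
       \<longlonglongrightarrow> FT f \<xi> * cnj (FT (indicator {a..b}) \<xi>)" by simp
    qed
    show "AE \<xi> in lborel. norm (FT f \<xi> * (gauss (1 / real (Suc n)) \<xi> * cnj (FT (indicator {a..b}) \<xi>)))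
      \<le> cmod (FT f \<xi> * cnj (FT (indicator {a..b}) \<xi>))" for n
      by (intro AE_I2) (auto simp: norm_mult gauss_def intro!: mult_left_mono mult_left_le_one_le)
  qed auto
  have "(\<lambda>n. LINT x|lborel. f x * cnj (LINT y|lborel. indicator {a..b} y * complex_of_real (normal_density x (1 / real (Suc n)) y)))
     \<longlonglongrightarrow> (LINT x|lborel. f x * indicator {a..b} x)"
  proof (rule integral_dominated_convergence)
    show "integrable lborel (\<lambda>x. cmod (f x))" using i by auto
    show "AE x in lborel. (\<lambda>n. f x * cnj (LINT y|lborel. indicator {a..b} y * complex_of_real (normal_density x (1 / real (Suc n)) y)))
       \<longlonglongrightarrow> f x * indicator {a..b} x"
      using AE_lborel_singleton[of a] AE_lborel_singleton[of b]
    proof eventually_elim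
      case (elim x)
      have "(\<lambda>n. f x * cnj (LINT y|lborel. indicator {a..b} y * complex_of_real (normal_density x (1 / real (Suc n)) y)))
       \<longlonglongrightarrow> f x * cnj (indicator {a..b} x)"
        by (intro tendsto_intros normal_density_approximates_indicator ab elim)
      moreover have "cnj (indicator {a..b} x) = (indicator {a..b} x :: complex)" by (simp add: indicator_def)
      ultimately show ?case by simp
    qed
    show "AE x in lborel. norm (f x * cnj (LINT y|lborel. indicator {a..b} y * complex_of_real (normal_density x (1 / real (Suc n)) y)))
      \<le> cmod (f x)" for n
    proof (rule AE_I2)
      fix x
      let ?N = "normal_density x (1 / real (Suc n))"
      have "cmod (LINT y|lborel. indicator {a..b} y * complex_of_real (?N y)) \<le> (LINT y|lborel. ?N y)"
      proof (rule order_trans[OF integral_norm_bound], rule integral_mono_AE)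
        show N: "integrable lborel ?N" by simp
        show "integrable lborel (\<lambda>y. cmod (indicator {a..b} y * complex_of_real (?N y)))"
          by (rule Bochner_Integration.integrable_bound[OF N]) (auto simp: norm_mult indicator_def)
      qed (auto simp: norm_mult indicator_def)
      hence "cmod (LINT y|lborel. indicator {a..b} y * complex_of_real (?N y)) \<le> 1" by simp
      thus "norm (f x * cnj (LINT y|lborel. indicator {a..b} y * complex_of_real (?N y))) \<le> cmod (f x)"
        by (simp add: norm_mult mult_left_le)
    qed
    have [measurable]: "(\<lambda>(x, y). normal_density x \<epsilon> y) \<in> borel_measurable (borel \<Otimes>\<^sub>M borel)" for \<epsilon>
      unfolding normal_density_def by measurable
    have "(\<lambda>x. LINT y|lborel. indicator {a..b} y * complex_of_real (normal_density x \<epsilon> y)) \<in> borel_measurable borel" for \<epsilon>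
      by (rule lborel.borel_measurable_lebesgue_integral) (measurable; simp)
    thus "(\<lambda>x. f x * cnj (LINT y|lborel. indicator {a..b} y * complex_of_real (normal_density x (1 / real (Suc n)) y))) \<in> borel_measurable lborel" for n
      by measurable
  qed auto
  thus "(\<lambda>n. LINT \<xi>|lborel. FT f \<xi> * (gauss (1 / real (Suc n)) \<xi> * cnj (FT (indicator {a..b}) \<xi>)))
     \<longlonglongrightarrow> (LINT x|lborel. f x * indicator {a..b} x)"
    by (subst FT_inner_gauss(2)[OF i g]) auto
qed

text \<open>
  Both sides have the same integral over every interval $J$: the multiplication formula moves one
  transform to the indicator of $J$, and the resulting pairing is evaluated by
  \<open>FT_inner_indicator\<close>, since conjugating the transform of the indicator reflects $J$.
\<close>

theorem fourier_inversion:
  assumes u: "u \<in> L2"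
  shows "AE x in lborel. fourier (fourier u) x = u (- x)"
proof -
  let ?d = "\<lambda>x. fourier (fourier u) x - u (- x)"
  have d: "?d \<in> L2" by (intro L2_diff L2_reflect fourier_L2 u)
  have "AE x in lborel. ?d x = 0"
  proof (rule AE_zero_of_interval_integrals)
    show "set_integrable lborel {a..b} ?d" for a b by (rule L2_set_integrable[OF d])
    fix a b :: real assume ab: "a < b"
    let ?J = "indicator {a..b} :: real \<Rightarrow> complex" and ?K = "indicator {-b..-a} :: real \<Rightarrow> complex"
    have J2: "?J \<in> L2" and K2: "?K \<in> L2" using indicator_L2 by simp_all
    have J1: "integrable lborel ?J" "integrable lborel ?K"
      using L2_mult_integrable[OF J2 J2] L2_mult_integrable[OF K2 K2] by (simp_all flip: indicator_inter_arith)
    have JK: "(\<lambda>x. ?J (- x)) = ?K" by (rule ext) (auto simp: indicator_def)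
    have cnjK: "(\<lambda>x. cnj (?K x)) = ?K" by (rule ext) (auto simp: indicator_def)
    have cK: "cnj (FT ?K \<xi>) = FT ?J \<xi>" for \<xi>
      using FT_cnj[of ?K "- \<xi>"] FT_reflect[of ?J "- \<xi>"] unfolding JK cnjK by simp
    have K: "(LINT \<xi>|lborel. fourier u \<xi> * FT ?J \<xi>) = (LINT x|lborel. u x * ?K x)"
    proof (rule LIMSEQ_unique)
      show "(\<lambda>n. LINT \<xi>|lborel. FT (trunc (real n) u) \<xi> * FT ?J \<xi>) \<longlonglongrightarrow> (LINT \<xi>|lborel. fourier u \<xi> * FT ?J \<xi>)"
        by (rule l2_conv_integral_mult[OF fourier_conv[OF u]])
          (use u FT_trunc_L2 fourier_L2 FT_contraction(1)[OF J1(1) J2] in \<open>auto simp: l2_conv_def l2n_def charge_def\<close>)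
      have "(\<lambda>n. LINT x|lborel. trunc (real n) u x * ?K x) \<longlonglongrightarrow> (LINT x|lborel. u x * ?K x)"
        by (rule l2_conv_integral_mult[OF l2_conv_trunc[OF u]])
          (use u K2 trunc_L2 in \<open>auto simp: l2_conv_def l2n_def charge_def\<close>)
      thus "(\<lambda>n. LINT \<xi>|lborel. FT (trunc (real n) u) \<xi> * FT ?J \<xi>) \<longlonglongrightarrow> (LINT x|lborel. u x * ?K x)"
        using FT_inner_indicator[OF trunc_integrable[OF u] trunc_L2[OF u], of "-b" "-a"] ab by (simp add: cK)
    qed
    have "(LINT x|lborel. fourier (fourier u) x * ?J x) = (LINT \<xi>|lborel. fourier u \<xi> * fourier ?J \<xi>)"
      by (rule fourier_multiplication_formula[OF fourier_L2[OF u] J2])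
    also have "\<dots> = (LINT \<xi>|lborel. fourier u \<xi> * FT ?J \<xi>)"
      by (rule integral_cong_AE)
         (use fourier_integrable[OF J2 J1(1)] fourier_L2[OF u] fourier_L2[OF J2] J2 L2_measurable
          in \<open>auto elim!: eventually_mono\<close>)
    also have "\<dots> = (LINT x|lborel. u (- x) * ?J x)"
      unfolding K by (subst lborel_integral_real_affine[where c = "-1" and t = 0])
         (auto intro!: Bochner_Integration.integral_cong simp: indicator_def)
    finally have "(LINT x|lborel. fourier (fourier u) x * ?J x) - (LINT x|lborel. u (- x) * ?J x) = 0" by simp
    hence "(LINT x|lborel. fourier (fourier u) x * ?J x - u (- x) * ?J x) = 0"
      by (subst Bochner_Integration.integral_diff) (use u J2 fourier_L2 L2_reflect L2_mult_integrable in auto)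
    thus "(LINT x:{a..b}|lborel. ?d x) = 0"
      unfolding set_lebesgue_integral_def
      by (simp add: scaleR_conv_of_real of_real_indicator algebra_simps)
  qed
  thus ?thesis by simp
qed

text \<open>
  The conjugate of the transform of $v$ is the transform of $x \mapsto \overline{v(-x)}$, so the
  multiplication formula produces a double transform, which inversion removes.
\<close>

theorem parseval:
  assumes "u \<in> L2" "v \<in> L2"
  shows "(LINT \<xi>|lborel. fourier u \<xi> * cnj (fourier v \<xi>)) = (LINT x|lborel. u x * cnj (v x))"
proof -
  have v': "(\<lambda>x. cnj (v (- x))) \<in> L2" by (intro L2_cnj L2_reflect assms)
  have m: "fourier u \<in> borel_measurable borel" "fourier v \<in> borel_measurable borel"
    "fourier (fourier u) \<in> borel_measurable borel" "v \<in> borel_measurable borel"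
    "fourier (\<lambda>x. cnj (v (- x))) \<in> borel_measurable borel" "u \<in> borel_measurable borel"
    using assms v' fourier_L2 L2_measurable by auto
  note [measurable] = m
  have nn: "AE x in lborel. P (- x)" if "AE x in lborel. P x" "Measurable.pred borel P" for P :: "real \<Rightarrow> bool"
  proof -
    have "AE x in distr lborel borel uminus. P x"
      using that(1) by (simp only: lborel_distr_uminus)
    thus ?thesis by (subst (asm) AE_distr_iff) (use that(2) in \<open>auto simp: pred_def\<close>)
  qed
  have "AE \<xi> in lborel. fourier (\<lambda>x. cnj (v (- x))) \<xi> = cnj (fourier (\<lambda>x. v (- x)) (- \<xi>))"
    by (rule fourier_cnj) (intro L2_reflect assms)
  moreover have "AE \<xi> in lborel. fourier (\<lambda>x. v (- x)) (- \<xi>) = fourier v (- (- \<xi>))"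
  proof (rule nn[OF fourier_reflect[OF assms(2)]])
    have [measurable]: "fourier (\<lambda>x. v (- x)) \<in> borel_measurable borel" using L2_reflect[OF assms(2)] fourier_L2 L2_measurable by blast
    show "Measurable.pred borel (\<lambda>\<xi>. fourier (\<lambda>x. v (- x)) \<xi> = fourier v (- \<xi>))" by measurable
  qed
  ultimately have "AE \<xi> in lborel. fourier (\<lambda>x. cnj (v (- x))) \<xi> = cnj (fourier v \<xi>)"
    by eventually_elim simp
  hence "(LINT \<xi>|lborel. fourier u \<xi> * cnj (fourier v \<xi>)) = (LINT \<xi>|lborel. fourier u \<xi> * fourier (\<lambda>x. cnj (v (- x))) \<xi>)"
    by (intro integral_cong_AE) (auto elim!: eventually_mono)
  also have "\<dots> = (LINT x|lborel. fourier (fourier u) x * cnj (v (- x)))"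
    by (rule fourier_multiplication_formula[OF fourier_L2[OF assms(1)] v', symmetric])
  also have "\<dots> = (LINT x|lborel. u (- x) * cnj (v (- x)))"
    by (intro integral_cong_AE) (use fourier_inversion[OF assms(1)] in \<open>auto elim!: eventually_mono\<close>)
  also have "\<dots> = (LINT x|lborel. u x * cnj (v x))"
    by (subst (2) lborel_integral_real_affine[where c = "-1" and t = 0]) auto
  finally show ?thesis .
qed

lemma complex_charge: "complex_of_real (charge f) = (LINT x|lborel. f x * cnj (f x))"
proof -
  have "complex_of_real (charge f) = (LINT x|lborel. complex_of_real ((cmod (f x))\<^sup>2))"
    unfolding charge_def by (rule integral_complex_of_real[symmetric])
  thus ?thesis by (simp only: complex_norm_square)
qed

corollary charge_fourier: "u \<in> L2 \<Longrightarrow> charge (fourier u) = charge u"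
  using parseval[of u u] by (simp flip: complex_charge)

lemma fourier_inverse:
  assumes "g \<in> L2"
  shows "AE \<xi> in lborel. fourier (\<lambda>x. fourier g (- x)) \<xi> = g \<xi>"
proof -
  have [measurable]: "fourier (\<lambda>x. g (- x)) \<in> borel_measurable borel" "fourier g \<in> borel_measurable borel"
    using L2_reflect[OF assms] assms fourier_L2 L2_measurable by blast+
  have "fourier (\<lambda>x. fourier g (- x)) = fourier (fourier (\<lambda>x. g (- x)))"
    by (rule fourier_cong) (use fourier_reflect[OF assms] in \<open>auto elim!: eventually_mono\<close>)
  thus ?thesis using fourier_inversion[OF L2_reflect[OF assms]] by simp
qed

text \<open>
  A function with a prescribed integrable transform is given by an absolutely convergent integral
  at every point.
\<close>

lemma fourier_inverse_integrable:
  assumes "g \<in> L2" "integrable lborel g"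
  shows "(\<lambda>x. FT g (- x)) \<in> L2" "AE \<xi> in lborel. fourier (\<lambda>x. FT g (- x)) \<xi> = g \<xi>"
proof -
  show 1: "(\<lambda>x. FT g (- x)) \<in> L2" by (intro L2_reflect FT_contraction assms)
  have g': "(\<lambda>x. g (- x)) \<in> L2" by (intro L2_reflect assms)
  have gi: "integrable lborel (\<lambda>x. g (- x))"
    using lborel_integrable_real_affine[OF assms(2), of "-1" 0] by simp
  have "fourier (\<lambda>x. FT g (- x)) = fourier (fourier (\<lambda>x. g (- x)))"
    by (rule fourier_cong) (use fourier_integrable[OF g' gi] 1 fourier_L2[OF g'] L2_measurable
       in \<open>auto simp: FT_reflect elim!: eventually_mono\<close>)
  thus "AE \<xi> in lborel. fourier (\<lambda>x. FT g (- x)) \<xi> = g \<xi>" using fourier_inversion[OF g'] by simp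
qed

section \<open>Test functions and weak derivatives\<close>

lemma continuous_compact_support_integrable:
  fixes f :: "real \<Rightarrow> 'a :: {banach, second_countable_topology}"
  assumes "continuous_on UNIV f" "\<And>x. \<bar>x\<bar> > R \<Longrightarrow> f x = 0"
  shows "integrable lborel f"
proof -
  have "set_integrable lborel {-R..R} f"
    by (rule borel_integrable_atLeastAtMost') (use assms(1) continuous_on_subset in blast)
  moreover have "(\<lambda>x. indicator {-R..R} x *\<^sub>R f x) = f"
    using assms(2) by (force simp: indicator_def)
  ultimately show ?thesis by (simp add: set_integrable_def)
qed

lemma continuous_compact_support_L2:
  assumes "continuous_on UNIV f" "\<And>x. \<bar>x\<bar> > R \<Longrightarrow> f x = 0"
  shows "f \<in> L2"
proof (rule L2I)
  show "f \<in> borel_measurable borel" by (rule borel_measurable_continuous_onI[OF assms(1)])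
  show "integrable lborel (\<lambda>x. (cmod (f x))\<^sup>2)"
    by (rule continuous_compact_support_integrable[where R = R]) (use assms in \<open>auto intro!: continuous_intros\<close>)
qed

lemma continuous_compact_support_bounded:
  fixes f :: "real \<Rightarrow> complex"
  assumes "continuous_on UNIV f" "\<And>x. \<bar>x\<bar> > R \<Longrightarrow> f x = 0"
  obtains B where "B > 0" "\<And>x. cmod (f x) \<le> B"
proof -
  have "compact (f ` {-R..R})"
    by (intro compact_continuous_image) (use assms(1) continuous_on_subset in blast)+
  then obtain B where B: "B > 0" "\<And>x. x \<in> {-R..R} \<Longrightarrow> cmod (f x) \<le> B"
    using compact_imp_bounded bounded_pos by (metis imageI)
  have "cmod (f x) \<le> B" for x
  proof (cases "\<bar>x\<bar> > R")
    case False
    hence "x \<in> {-R..R}" by auto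
    thus ?thesis by (rule B(2))
  qed (use assms(2) B(1) in auto)
  with B(1) that show thesis by blast
qed

lemma integral_derivative_zero:
  fixes g :: "real \<Rightarrow> complex"
  assumes g: "\<And>x. (g has_vector_derivative g' x) (at x)" and c: "continuous_on UNIV g'"
    and z: "\<And>x. \<bar>x\<bar> > R \<Longrightarrow> g x = 0" "\<And>x. \<bar>x\<bar> > R \<Longrightarrow> g' x = 0" and R: "R \<ge> 0"
  shows "(LINT x|lborel. g' x) = 0"
proof -
  have "(LINT x|lborel. indicator {-(R+1)..R+1} x *\<^sub>R g' x) = g (R+1) - g (-(R+1))"
    by (rule integral_FTC_atLeastAtMost)
       (use g c R in \<open>auto intro: has_vector_derivative_at_within continuous_on_subset\<close>)
  moreover have "(\<lambda>x. indicator {-(R+1)..R+1} x *\<^sub>R g' x) = g'"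
    by (rule ext) (use z(2) R in \<open>force simp: indicator_def\<close>)
  ultimately show ?thesis using z(1)[of "R+1"] z(1)[of "-(R+1)"] R by simp
qed

lemma deriv_x_eqI: "(\<And>x. (f has_vector_derivative f' x) (at x)) \<Longrightarrow> deriv_x f = f'"
  unfolding deriv_x_def by (rule ext) (rule vector_derivative_at)

lemma deriv_x_zero_outside:
  assumes "open U" "x \<in> U" "\<And>y. y \<in> U \<Longrightarrow> f y = 0"
  shows "deriv_x f x = 0"
proof -
  have "(f has_vector_derivative 0) (at x)"
    by (rule has_vector_derivative_transform_within_open[OF has_vector_derivative_const[of 0] assms(1,2)])
       (use assms(3) in auto)
  thus ?thesis unfolding deriv_x_def by (rule vector_derivative_at)
qed

lemma open_abs_greater: "open {y :: real. \<bar>y\<bar> > R}"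
  by (intro open_Collect_less continuous_intros)

lemma test_fun_has_derivative:
  assumes "test_fun \<phi>"
  shows "((deriv_x ^^ n) \<phi> has_vector_derivative (deriv_x ^^ Suc n) \<phi> x) (at x)"
  using assms unfolding test_fun_def deriv_x_def by (auto simp: vector_derivative_works)

lemma test_fun_support:
  assumes "test_fun \<phi>"
  obtains R where "R > 0" "\<And>n x. \<bar>x\<bar> > R \<Longrightarrow> (deriv_x ^^ n) \<phi> x = 0"
proof -
  obtain K where K: "compact K" "\<And>x. x \<notin> K \<Longrightarrow> \<phi> x = 0" using assms by (auto simp: test_fun_def)
  obtain R where R: "R > 0" "\<And>x. x \<in> K \<Longrightarrow> norm x \<le> R"
    using K(1) compact_imp_bounded bounded_pos by metis
  have "(deriv_x ^^ n) \<phi> x = 0" if "\<bar>x\<bar> > R" for n x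
    using that
  proof (induction n arbitrary: x)
    case 0
    hence "x \<notin> K" using R(2)[of x] by auto
    thus ?case using K(2) by simp
  next
    case (Suc n)
    show ?case unfolding funpow.simps comp_def
      by (rule deriv_x_zero_outside[OF open_abs_greater]) (use Suc in auto)
  qed
  with R(1) that show thesis by blast
qed

lemma test_fun_continuous: "test_fun \<phi> \<Longrightarrow> continuous_on UNIV ((deriv_x ^^ n) \<phi>)"
  using test_fun_has_derivative[of \<phi> n] has_vector_derivative_continuous continuous_at_imp_continuous_on by blast

lemma test_fun_deriv: "test_fun \<phi> \<Longrightarrow> test_fun ((deriv_x ^^ k) \<phi>)"
proof -
  assume t: "test_fun \<phi>"
  obtain R where R: "\<And>n x. \<bar>x\<bar> > R \<Longrightarrow> (deriv_x ^^ n) \<phi> x = 0" using test_fun_support[OF t] by metis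
  have "\<forall>x. x \<notin> {-R..R} \<longrightarrow> (deriv_x ^^ k) \<phi> x = 0" using R by force
  hence "\<exists>K. compact K \<and> (\<forall>x. x \<notin> K \<longrightarrow> (deriv_x ^^ k) \<phi> x = 0)" using compact_Icc by blast
  moreover have "(deriv_x ^^ n) ((deriv_x ^^ k) \<phi>) = (deriv_x ^^ (n + k)) \<phi>" for n
    by (simp add: funpow_add)
  ultimately show ?thesis using t unfolding test_fun_def by simp
qed

lemma test_fun_L2: "test_fun \<phi> \<Longrightarrow> (deriv_x ^^ n) \<phi> \<in> L2"
  by (metis test_fun_support continuous_compact_support_L2 test_fun_continuous)

lemma test_fun_integrable: "test_fun \<phi> \<Longrightarrow> integrable lborel ((deriv_x ^^ n) \<phi>)"
  by (metis test_fun_support continuous_compact_support_integrable test_fun_continuous)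

lemma test_fun_bounded:
  assumes "test_fun \<phi>" obtains B where "B > 0" "\<And>x. cmod ((deriv_x ^^ n) \<phi> x) \<le> B"
  by (metis assms test_fun_support continuous_compact_support_bounded test_fun_continuous)

lemma deriv_x_funpow_cmult:
  assumes "test_fun \<phi>" shows "(deriv_x ^^ n) (\<lambda>x. c * \<phi> x) = (\<lambda>x. c * (deriv_x ^^ n) \<phi> x)"
proof (induction n)
  case (Suc n)
  have "deriv_x (\<lambda>x. c * (deriv_x ^^ n) \<phi> x) = (\<lambda>x. c * (deriv_x ^^ Suc n) \<phi> x)"
    by (intro deriv_x_eqI has_vector_derivative_mult_right test_fun_has_derivative assms)
  thus ?case using Suc by simp
qed simp

lemma test_fun_cmult: "test_fun \<phi> \<Longrightarrow> test_fun (\<lambda>x. c * \<phi> x)"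
  unfolding test_fun_def[of "\<lambda>x. c * \<phi> x"] deriv_x_funpow_cmult
  using test_fun_has_derivative[of \<phi>]
  by (auto simp: test_fun_def[of \<phi>] intro!: derivative_intros differentiableI_vector)

lemma deriv_x_funpow_cnj:
  assumes "test_fun \<phi>" shows "(deriv_x ^^ n) (\<lambda>x. cnj (\<phi> x)) = (\<lambda>x. cnj ((deriv_x ^^ n) \<phi> x))"
proof (induction n)
  case (Suc n)
  have "deriv_x (\<lambda>x. cnj ((deriv_x ^^ n) \<phi> x)) = (\<lambda>x. cnj ((deriv_x ^^ Suc n) \<phi> x))"
    by (intro deriv_x_eqI bounded_linear.has_vector_derivative[OF bounded_linear_cnj] test_fun_has_derivative assms)
  thus ?case using Suc by simp
qed simp

lemma test_fun_cnj: "test_fun \<phi> \<Longrightarrow> test_fun (\<lambda>x. cnj (\<phi> x))"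
  unfolding test_fun_def[of "\<lambda>x. cnj (\<phi> x)"] deriv_x_funpow_cnj
  using bounded_linear.has_vector_derivative[OF bounded_linear_cnj test_fun_has_derivative[of \<phi>]]
  by (auto simp: test_fun_def[of \<phi>] intro: differentiableI_vector)

text \<open>
  The derivative of $\varphi(y) e^{-i y \xi}$ has integral zero.
\<close>

lemma FT_deriv_x:
  assumes "test_fun \<phi>" shows "FT (deriv_x \<phi>) \<xi> = \<i> * complex_of_real \<xi> * FT \<phi> \<xi>"
proof -
  let ?e = "\<lambda>y. exp (- \<i> * complex_of_real (y * \<xi>))"
  obtain R where R: "R > 0" "\<And>n x. \<bar>x\<bar> > R \<Longrightarrow> (deriv_x ^^ n) \<phi> x = 0" using test_fun_support[OF assms] by metis
  have d: "(\<phi> has_vector_derivative deriv_x \<phi> x) (at x)" for x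
    using test_fun_has_derivative[OF assms, of 0 x] by simp
  have c: "continuous_on UNIV \<phi>" "continuous_on UNIV (deriv_x \<phi>)"
    using test_fun_continuous[OF assms, of 0] test_fun_continuous[OF assms, of 1] by simp_all
  have z: "\<bar>x\<bar> > R \<Longrightarrow> \<phi> x = 0" "\<bar>x\<bar> > R \<Longrightarrow> deriv_x \<phi> x = 0" for x
    using R(2)[of x 0] R(2)[of x 1] by auto
  have i: "integrable lborel \<phi>" "integrable lborel (deriv_x \<phi>)"
    using test_fun_integrable[OF assms, of 0] test_fun_integrable[OF assms, of 1] by simp_all
  have e: "(?e has_vector_derivative (- \<i> * complex_of_real \<xi>) * ?e y) (at y)" for y
  proof -
    have "((\<lambda>z. exp (- \<i> * (z * complex_of_real \<xi>))) has_field_derivative (- \<i> * complex_of_real \<xi>) * exp (- \<i> * (complex_of_real y * complex_of_real \<xi>))) (at (complex_of_real y))"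
      by (auto intro!: derivative_eq_intros)
    thus ?thesis using has_vector_derivative_real_field by (fastforce simp: o_def)
  qed
  have "(LINT y|lborel. deriv_x \<phi> y * ?e y + \<phi> y * ((- \<i> * complex_of_real \<xi>) * ?e y)) = 0"
  proof (rule integral_derivative_zero[where R = R])
    show "((\<lambda>y. \<phi> y * ?e y) has_vector_derivative deriv_x \<phi> y * ?e y + \<phi> y * ((- \<i> * complex_of_real \<xi>) * ?e y)) (at y)" for y
      using has_vector_derivative_mult[OF d e, of y] by (simp add: add.commute)
    show "continuous_on UNIV (\<lambda>y. deriv_x \<phi> y * ?e y + \<phi> y * ((- \<i> * complex_of_real \<xi>) * ?e y))"
      by (intro continuous_intros c)
  qed (use R z in auto)
  moreover have "(LINT y|lborel. deriv_x \<phi> y * ?e y + \<phi> y * ((- \<i> * complex_of_real \<xi>) * ?e y)) =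
     (LINT y|lborel. deriv_x \<phi> y * ?e y + (- \<i> * complex_of_real \<xi>) * (\<phi> y * ?e y))"
    by (intro Bochner_Integration.integral_cong) auto
  moreover have "\<dots> = (LINT y|lborel. deriv_x \<phi> y * ?e y) + (LINT y|lborel. (- \<i> * complex_of_real \<xi>) * (\<phi> y * ?e y))"
    by (intro Bochner_Integration.integral_add integrable_mult_right FT_integrand_integrable i)
  ultimately have "(LINT y|lborel. deriv_x \<phi> y * ?e y) + (LINT y|lborel. (- \<i> * complex_of_real \<xi>) * (\<phi> y * ?e y)) = 0"
    by simp
  hence "(LINT y|lborel. deriv_x \<phi> y * ?e y) = \<i> * complex_of_real \<xi> * (LINT y|lborel. \<phi> y * ?e y)"
    by (subst (asm) integral_mult_right_zero) (simp add: eq_neg_iff_add_eq_0 add_eq_0_iff)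
  thus ?thesis unfolding FT_def by simp
qed

lemma FT_deriv_x_funpow:
  assumes "test_fun \<phi>" shows "FT ((deriv_x ^^ n) \<phi>) \<xi> = (\<i> * complex_of_real \<xi>) ^ n * FT \<phi> \<xi>"
proof (induction n)
  case (Suc n)
  have "FT ((deriv_x ^^ Suc n) \<phi>) \<xi> = \<i> * complex_of_real \<xi> * FT ((deriv_x ^^ n) \<phi>) \<xi>"
    using FT_deriv_x[OF test_fun_deriv[OF assms, of n]] by simp
  thus ?case using Suc by simp
qed simp

lemma parseval_integrable:
  assumes "u \<in> L2" "\<phi> \<in> L2" "integrable lborel \<phi>"
  shows "(LINT x|lborel. u x * \<phi> x) = (LINT \<xi>|lborel. fourier u \<xi> * FT \<phi> (- \<xi>))"
proof -
  have c: "(\<lambda>x. cnj (\<phi> x)) \<in> L2" "integrable lborel (\<lambda>x. cnj (\<phi> x))" using assms L2_cnj by auto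
  have [measurable]: "fourier u \<in> borel_measurable borel" "fourier (\<lambda>x. cnj (\<phi> x)) \<in> borel_measurable borel"
    "\<phi> \<in> borel_measurable borel"
    using assms c fourier_L2 L2_measurable by auto
  have "(LINT x|lborel. u x * \<phi> x) = (LINT \<xi>|lborel. fourier u \<xi> * cnj (fourier (\<lambda>x. cnj (\<phi> x)) \<xi>))"
    using parseval[OF assms(1) c(1)] by simp
  also have "\<dots> = (LINT \<xi>|lborel. fourier u \<xi> * FT \<phi> (- \<xi>))"
    by (intro integral_cong_AE)
       (use fourier_integrable[OF c] in \<open>auto simp: FT_cnj elim!: eventually_mono\<close>)
  finally show ?thesis .
qed

text \<open>
  Parseval's formula moves the pairing with a test function to the Fourier side, where derivatives of
  the test function are powers of $-i\xi$; comparing them with the powers of $i\xi$ gives the sign.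
\<close>

lemma weak_deriv_exists:
  assumes u: "u \<in> L2" and g: "(\<lambda>\<xi>. (\<i> * complex_of_real \<xi>) ^ n * fourier u \<xi>) \<in> L2" (is "?g \<in> L2")
  shows "is_weak_deriv n u (\<lambda>x. fourier ?g (- x))"
  unfolding is_weak_deriv_def
proof (intro conjI allI impI)
  let ?v = "\<lambda>x. fourier ?g (- x)"
  have v: "?v \<in> L2" by (intro L2_reflect fourier_L2 g)
  show "set_integrable lborel {a..b} ?v" for a b by (rule L2_set_integrable[OF v])
  fix \<phi> assume t: "test_fun \<phi>"
  have t0: "\<phi> \<in> L2" "integrable lborel \<phi>" using test_fun_L2[OF t, of 0] test_fun_integrable[OF t, of 0] by simp_all
  have [measurable]: "fourier u \<in> borel_measurable borel" "fourier ?v \<in> borel_measurable borel" "\<phi> \<in> borel_measurable borel"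
    using u v t0 fourier_L2 L2_measurable by auto
  have "(LINT x|lborel. ?v x * \<phi> x) = (LINT \<xi>|lborel. fourier ?v \<xi> * FT \<phi> (- \<xi>))"
    by (rule parseval_integrable[OF v t0])
  also have "\<dots> = (LINT \<xi>|lborel. ?g \<xi> * FT \<phi> (- \<xi>))"
    by (intro integral_cong_AE) (use fourier_inverse[OF g] in \<open>auto elim!: eventually_mono\<close>)
  also have "\<dots> = (LINT \<xi>|lborel. (-1) ^ n * (fourier u \<xi> * FT ((deriv_x ^^ n) \<phi>) (- \<xi>)))"
  proof (intro Bochner_Integration.integral_cong refl)
    fix \<xi>
    have "(\<i> * complex_of_real \<xi>) ^ n = (-1) ^ n * (\<i> * complex_of_real (- \<xi>)) ^ n"
      by (simp flip: power_mult_distrib)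
    thus "?g \<xi> * FT \<phi> (- \<xi>) = (-1) ^ n * (fourier u \<xi> * FT ((deriv_x ^^ n) \<phi>) (- \<xi>))"
      unfolding FT_deriv_x_funpow[OF t] by simp
  qed
  also have "\<dots> = (-1) ^ n * (LINT \<xi>|lborel. fourier u \<xi> * FT ((deriv_x ^^ n) \<phi>) (- \<xi>))"
    by (rule integral_mult_right_zero)
  also have "(LINT \<xi>|lborel. fourier u \<xi> * FT ((deriv_x ^^ n) \<phi>) (- \<xi>)) = (LINT x|lborel. u x * (deriv_x ^^ n) \<phi> x)"
    by (rule parseval_integrable[OF u test_fun_L2[OF t] test_fun_integrable[OF t], symmetric])
  finally show "(LINT x|lborel. ?v x * \<phi> x) = (-1) ^ n * (LINT x|lborel. u x * (deriv_x ^^ n) \<phi> x)" .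
qed

text \<open>
  For $P = 1$ this is the standard smooth function that vanishes on a half-line. The derivative of
  such a function has the same form with another polynomial, which is the reason for the parameter.
\<close>

definition flat :: "real poly \<Rightarrow> real \<Rightarrow> real" where
  "flat P x = (if x > 0 then poly P (1 / x) * exp (- (1 / x)) else 0)"

lemma poly_exp_limit: "((\<lambda>t. poly P t * exp (- t)) \<longlongrightarrow> (0::real)) at_top"
proof -
  have "((\<lambda>t. \<Sum>i\<le>degree P. coeff P i * (t ^ i / exp t)) \<longlongrightarrow> (\<Sum>i\<le>degree P. coeff P i * 0)) at_top"
    by (intro tendsto_intros tendsto_power_div_exp_0)
  thus ?thesis by (simp add: poly_altdef sum_distrib_right exp_minus divide_inverse mult.assoc)
qed

lemma flat_has_derivative:
  "(flat P has_real_derivative flat (monom 1 2 * (P - pderiv P)) x) (at x)"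
proof -
  let ?Q = "monom 1 2 * (P - pderiv P)"
  consider "x > 0" | "x < 0" | "x = 0" by linarith
  thus ?thesis
  proof cases
    case 1
    have "((\<lambda>x. poly P (1 / x) * exp (- (1 / x))) has_real_derivative poly ?Q (1 / x) * exp (- (1 / x))) (at x)"
      using 1 by (auto intro!: derivative_eq_intros simp: poly_monom field_simps power2_eq_square)
    hence "(flat P has_real_derivative poly ?Q (1 / x) * exp (- (1 / x))) (at x)"
      by (rule has_field_derivative_transform_within_open[OF _ open_greaterThan[of 0]]) (use 1 in \<open>auto simp: flat_def\<close>)
    thus ?thesis using 1 by (simp add: flat_def)
  next
    case 2
    have "(flat P has_real_derivative 0) (at x)"
      by (rule has_field_derivative_transform_within_open[OF DERIV_const[of 0] open_lessThan[of 0]]) (use 2 in \<open>auto simp: flat_def\<close>)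
    thus ?thesis using 2 by (simp add: flat_def)
  next
    case 3
    have "((\<lambda>h. poly (pCons 0 P) (inverse h) * exp (- inverse h)) \<longlongrightarrow> 0) (at_right 0)"
      by (rule filterlim_compose[OF poly_exp_limit filterlim_inverse_at_top_right])
    hence r: "((\<lambda>h. flat P h / h) \<longlongrightarrow> 0) (at_right 0)"
      by (rule Lim_transform_eventually)
         (auto simp: eventually_at_right_less flat_def inverse_eq_divide field_simps
           intro!: eventually_mono[OF eventually_at_right_less[of 0]])
    have "((\<lambda>h. 0) \<longlongrightarrow> 0) (at_left (0::real))" by simp
    hence l: "((\<lambda>h. flat P h / h) \<longlongrightarrow> 0) (at_left 0)"
      by (rule Lim_transform_eventually)
         (auto simp: eventually_at_left_field flat_def intro!: exI[of _ "-1"])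
    have "((\<lambda>h. flat P h / h) \<longlongrightarrow> 0) (at 0)" using l r by (simp add: filterlim_at_split)
    thus ?thesis using 3 by (simp add: DERIV_def flat_def)
  qed
qed

text \<open>
  Each member of this class has a derivative in the class, so its members are smooth and no
  derivative of higher order needs to be computed.
\<close>

inductive smooth_gen :: "(real \<Rightarrow> complex) \<Rightarrow> bool" where
  flat: "smooth_gen (\<lambda>x. complex_of_real (flat P (c * x + d)))"
| const: "smooth_gen (\<lambda>x. z)"
| add: "smooth_gen f \<Longrightarrow> smooth_gen g \<Longrightarrow> smooth_gen (\<lambda>x. f x + g x)"
| mult: "smooth_gen f \<Longrightarrow> smooth_gen g \<Longrightarrow> smooth_gen (\<lambda>x. f x * g x)"

lemma smooth_gen_derivative:
  "smooth_gen f \<Longrightarrow> \<exists>f'. smooth_gen f' \<and> (\<forall>x. (f has_vector_derivative f' x) (at x))"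
proof (induction rule: smooth_gen.induct)
  case (flat P c d)
  let ?Q = "monom 1 2 * (P - pderiv P)"
  have "((\<lambda>x. flat P (c * x + d)) has_real_derivative flat ?Q (c * x + d) * c) (at x)" for x
    by (rule DERIV_chain'[OF _ flat_has_derivative]) (auto intro!: derivative_eq_intros)
  hence "((\<lambda>x. complex_of_real (flat P (c * x + d))) has_vector_derivative complex_of_real (flat ?Q (c * x + d) * c)) (at x)" for x
    by (intro has_vector_derivative_of_real) (simp add: has_real_derivative_iff_has_vector_derivative)
  moreover have "smooth_gen (\<lambda>x. complex_of_real (flat ?Q (c * x + d)) * complex_of_real c)"
    by (intro smooth_gen.intros)
  ultimately show ?case by (intro exI[of _ "\<lambda>x. complex_of_real (flat ?Q (c * x + d) * c)"]) simp
next
  case (const z)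
  show ?case by (intro exI[of _ "\<lambda>x. 0"]) (auto intro: smooth_gen.intros)
next
  case (add f g)
  then obtain f' g' where "smooth_gen f'" "smooth_gen g'" "\<And>x. (f has_vector_derivative f' x) (at x)" "\<And>x. (g has_vector_derivative g' x) (at x)" by blast
  thus ?case by (intro exI[of _ "\<lambda>x. f' x + g' x"]) (auto intro: smooth_gen.intros derivative_intros)
next
  case (mult f g)
  then obtain f' g' where "smooth_gen f'" "smooth_gen g'" "\<And>x. (f has_vector_derivative f' x) (at x)" "\<And>x. (g has_vector_derivative g' x) (at x)" by blast
  thus ?case using mult.hyps
    by (intro exI[of _ "\<lambda>x. f x * g' x + f' x * g x"]) (auto intro: smooth_gen.intros has_vector_derivative_mult)
qed

lemma smooth_gen_deriv_x: "smooth_gen f \<Longrightarrow> smooth_gen ((deriv_x ^^ n) f)"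
proof (induction n)
  case (Suc n)
  then obtain f' where "smooth_gen f'" "\<And>x. ((deriv_x ^^ n) f has_vector_derivative f' x) (at x)"
    using smooth_gen_derivative by blast
  thus ?case using deriv_x_eqI[of "(deriv_x ^^ n) f" f'] by simp
qed simp

lemma smooth_gen_test_fun:
  assumes "smooth_gen f" "\<And>x. x \<notin> {a..b} \<Longrightarrow> f x = 0" shows "test_fun f"
  unfolding test_fun_def
proof (intro conjI allI exI[of _ "{a..b}"] impI)
  fix n x
  show "(deriv_x ^^ n) f differentiable at x"
    using smooth_gen_derivative[OF smooth_gen_deriv_x[OF assms(1), of n]] differentiableI_vector by blast
qed (use assms in auto)

text \<open>
  As \<open>k\<close> grows these test functions increase to the indicator of the open interval from \<open>a\<close> to \<open>b\<close>.
\<close>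

definition bump :: "real \<Rightarrow> real \<Rightarrow> real \<Rightarrow> real \<Rightarrow> complex" where
  "bump k a b x = complex_of_real (flat 1 (k * (x - a))) * complex_of_real (flat 1 (k * (b - x)))"

lemma bump_test_fun: assumes "k > 0" shows "test_fun (bump k a b)"
proof (rule smooth_gen_test_fun)
  have "smooth_gen (\<lambda>x. complex_of_real (flat 1 (k * x + (- k * a))) * complex_of_real (flat 1 ((- k) * x + k * b)))"
    by (intro smooth_gen.intros)
  thus "smooth_gen (bump k a b)" unfolding bump_def[abs_def] by (simp add: algebra_simps)
  show "bump k a b x = 0" if "x \<notin> {a..b}" for x
    using that assms by (auto simp: bump_def flat_def zero_less_mult_iff)
qed

lemma bump_bound: assumes "k > 0" shows "cmod (bump k a b x) \<le> indicator {a..b} x"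
  using assms by (auto simp: bump_def flat_def norm_mult indicator_def zero_less_mult_iff intro!: mult_le_one)

lemma bump_limit:
  assumes "a < x" "x < b" shows "(\<lambda>n. bump (real (Suc n)) a b x) \<longlonglongrightarrow> 1"
proof -
  have l: "(\<lambda>n. flat 1 (real (Suc n) * y)) \<longlonglongrightarrow> 1" if "y > 0" for y
  proof -
    have "(\<lambda>n. exp (- (inverse (real (Suc n)) * inverse y))) \<longlonglongrightarrow> exp (- (0 * inverse y))"
      by (intro tendsto_intros LIMSEQ_inverse_real_of_nat)
    thus ?thesis using that by (simp add: flat_def inverse_eq_divide zero_less_mult_iff)
  qed
  have "(\<lambda>n. complex_of_real (flat 1 (real (Suc n) * (x - a))) * complex_of_real (flat 1 (real (Suc n) * (b - x)))) \<longlonglongrightarrow> complex_of_real 1 * complex_of_real 1"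
    by (intro tendsto_intros l) (use assms in auto)
  thus ?thesis by (simp add: bump_def)
qed

lemma locally_integrable_measurable:
  fixes v :: "real \<Rightarrow> complex"
  assumes "\<And>a b. set_integrable lborel {a..b} v" shows "v \<in> borel_measurable borel"
proof (rule borel_measurable_LIMSEQ_metric)
  show "(\<lambda>x. indicator {- real n..real n} x *\<^sub>R v x) \<in> borel_measurable borel" for n
    using assms[of "- real n" "real n"] unfolding set_integrable_def by auto
  fix x
  obtain N :: nat where "\<bar>x\<bar> \<le> real N" using real_arch_simple[of "\<bar>x\<bar>"] by blast
  thus "(\<lambda>n. indicator {- real n..real n} x *\<^sub>R v x) \<longlonglongrightarrow> v x"
    by (intro tendsto_eventually eventually_sequentiallyI[of N]) (auto simp: indicator_def abs_le_iff)
qed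

lemma locally_integrable_mult_test:
  assumes "\<And>a b. set_integrable lborel {a..b} v" "test_fun \<phi>"
  shows "integrable lborel (\<lambda>x. v x * \<phi> x)"
proof -
  have [measurable]: "v \<in> borel_measurable borel" "\<phi> \<in> borel_measurable borel"
    using locally_integrable_measurable[OF assms(1)] test_fun_L2[OF assms(2), of 0] L2_measurable by auto
  obtain R where R: "\<And>x. \<bar>x\<bar> > R \<Longrightarrow> \<phi> x = 0" using test_fun_support[OF assms(2)] by (metis funpow_0)
  obtain B where B: "\<And>x. cmod (\<phi> x) \<le> B" using test_fun_bounded[OF assms(2), of 0] by auto
  show ?thesis
  proof (rule Bochner_Integration.integrable_bound)
    show "integrable lborel (\<lambda>x. B * cmod (indicator {-R..R} x *\<^sub>R v x))"
      using assms(1) unfolding set_integrable_def by (intro integrable_mult_right integrable_norm)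
    show "AE x in lborel. norm (v x * \<phi> x) \<le> norm (B * cmod (indicator {-R..R} x *\<^sub>R v x))"
    proof (rule AE_I2)
      fix x
      have "0 \<le> B" using B[of 0] norm_ge_zero order_trans by blast
      show "norm (v x * \<phi> x) \<le> norm (B * cmod (indicator {-R..R} x *\<^sub>R v x))"
      proof (cases "\<bar>x\<bar> > R")
        case False
        hence "x \<in> {-R..R}" by auto
        thus ?thesis using B[of x] \<open>0 \<le> B\<close> by (simp add: norm_mult mult.commute mult_right_mono)
      qed (simp add: R)
    qed
  qed measurable
qed

text \<open>
  The bumps approximate the indicator of an interval, so the difference of two weak derivatives has
  integral zero over every interval.
\<close>

lemma weak_deriv_unique:
  assumes "is_weak_deriv n u v" "is_weak_deriv n u w"
  shows "AE x in lborel. v x = w x"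
proof -
  have i: "set_integrable lborel {a..b} v" "set_integrable lborel {a..b} w" for a b
    using assms by (auto simp: is_weak_deriv_def)
  have d: "set_integrable lborel {a..b} (\<lambda>x. v x - w x)" for a b
    using set_integral_diff(1)[OF i] by simp
  have [measurable]: "(\<lambda>x. v x - w x) \<in> borel_measurable borel" by (rule locally_integrable_measurable[OF d])
  have z: "(LINT x|lborel. (v x - w x) * \<phi> x) = 0" if t: "test_fun \<phi>" for \<phi>
  proof -
    have "(LINT x|lborel. v x * \<phi> x) - (LINT x|lborel. w x * \<phi> x) = 0"
      using assms t by (simp add: is_weak_deriv_def)
    thus ?thesis
      using locally_integrable_mult_test[OF i(1) t] locally_integrable_mult_test[OF i(2) t]
      by (simp add: left_diff_distrib)
  qed
  have "AE x in lborel. v x - w x = 0"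
  proof (rule AE_zero_of_interval_integrals[OF d])
    fix a b :: real assume "a < b"
    have "(\<lambda>n. LINT x|lborel. (v x - w x) * bump (real (Suc n)) a b x) \<longlonglongrightarrow> (LINT x|lborel. indicator {a..b} x *\<^sub>R (v x - w x))"
    proof (rule integral_dominated_convergence)
      show "integrable lborel (\<lambda>x. cmod (indicator {a..b} x *\<^sub>R (v x - w x)))"
        using d[of a b] unfolding set_integrable_def by (rule integrable_norm)
      show "AE x in lborel. (\<lambda>n. (v x - w x) * bump (real (Suc n)) a b x) \<longlonglongrightarrow> indicator {a..b} x *\<^sub>R (v x - w x)"
        using AE_lborel_singleton[of a] AE_lborel_singleton[of b]
      proof eventually_elim
        case (elim x)
        show ?case
        proof (cases "x \<in> {a..b}")
          case True
          have "(\<lambda>n. (v x - w x) * bump (real (Suc n)) a b x) \<longlonglongrightarrow> (v x - w x) * 1"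
            by (intro tendsto_intros bump_limit) (use elim True in auto)
          thus ?thesis using True by simp
        next
          case False
          hence "bump (real (Suc n)) a b x = 0" for n using bump_bound[of "real (Suc n)" a b x] by simp
          thus ?thesis using False by simp
        qed
      qed
      show "AE x in lborel. norm ((v x - w x) * bump (real (Suc n)) a b x) \<le> cmod (indicator {a..b} x *\<^sub>R (v x - w x))" for n
      proof (rule AE_I2)
        fix x
        have "cmod (v x - w x) * cmod (bump (real (Suc n)) a b x) \<le> cmod (v x - w x) * indicator {a..b} x"
          by (intro mult_left_mono bump_bound) auto
        thus "norm ((v x - w x) * bump (real (Suc n)) a b x) \<le> cmod (indicator {a..b} x *\<^sub>R (v x - w x))"
          by (simp add: norm_mult mult.commute)
      qed
      have "bump (real (Suc n)) a b \<in> borel_measurable borel" for n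
        using test_fun_L2[OF bump_test_fun, of "real (Suc n)" 0] L2_measurable by auto
      thus "(\<lambda>x. (v x - w x) * bump (real (Suc n)) a b x) \<in> borel_measurable lborel" for n by measurable
    qed auto
    hence "(\<lambda>n. 0) \<longlonglongrightarrow> (LINT x|lborel. indicator {a..b} x *\<^sub>R (v x - w x))"
      by (simp add: z bump_test_fun)
    thus "(LINT x:{a..b}|lborel. v x - w x) = 0"
      unfolding set_lebesgue_integral_def using LIMSEQ_unique tendsto_const by metis
  qed
  thus ?thesis by simp
qed

text \<open>
  With $|\xi|^m$ in place of $(i\xi)^m$ the modulus is still that of the transform of the $m$-th
  derivative, and inner products of two such functions are unchanged.
\<close>

definition wfourier :: "nat \<Rightarrow> (real \<Rightarrow> complex) \<Rightarrow> real \<Rightarrow> complex" where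
  "wfourier m u \<xi> = complex_of_real (\<bar>\<xi>\<bar> ^ m) * fourier u \<xi>"

definition kin :: "nat \<Rightarrow> (real \<Rightarrow> complex) \<Rightarrow> real" where
  "kin m u = charge (wfourier m u)"

lemma wfourier_measurable: "u \<in> L2 \<Longrightarrow> wfourier m u \<in> borel_measurable borel"
  using fourier_L2[of u] L2_measurable unfolding wfourier_def[abs_def] by measurable

lemma cmod_wfourier: "cmod (wfourier m u \<xi>) = \<bar>\<xi>\<bar> ^ m * cmod (fourier u \<xi>)"
  by (simp add: wfourier_def norm_mult norm_power)

text \<open>
  The weak derivative is unique almost everywhere, so the one that is selected agrees with the inverse
  transform of $(i\xi)^n \hat u$.
\<close>

theorem weak_deriv_charge:
  assumes u: "u \<in> L2" and h: "wfourier n u \<in> L2"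
  shows "weak_deriv n u \<in> L2" "charge (weak_deriv n u) = kin n u"
proof -
  let ?g = "\<lambda>\<xi>. (\<i> * complex_of_real \<xi>) ^ n * fourier u \<xi>"
  let ?v = "\<lambda>x. fourier ?g (- x)"
  have eq: "cmod (?g \<xi>) = cmod (wfourier n u \<xi>)" for \<xi>
    by (simp add: norm_mult norm_power cmod_wfourier)
  have [measurable]: "fourier u \<in> borel_measurable borel" using fourier_L2[OF u] L2_measurable by auto
  have g: "?g \<in> L2" by (rule L2_dominated[OF h, where B = 1]) (auto simp: eq)
  have v: "?v \<in> L2" by (intro L2_reflect fourier_L2 g)
  have w: "is_weak_deriv n u ?v" by (rule weak_deriv_exists[OF u g])
  have w': "is_weak_deriv n u (weak_deriv n u)" unfolding weak_deriv_def by (rule someI[where P = "is_weak_deriv n u", OF w])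
  have [measurable]: "weak_deriv n u \<in> borel_measurable borel"
    using w' by (intro locally_integrable_measurable) (auto simp: is_weak_deriv_def)
  have ae: "AE x in lborel. weak_deriv n u x = ?v x" by (rule weak_deriv_unique[OF w' w])
  show "weak_deriv n u \<in> L2"
    by (rule L2_dominated[OF v, where B = 1]) (use ae in \<open>auto elim!: eventually_mono\<close>)
  have "charge (weak_deriv n u) = charge ?v"
    by (rule charge_cong_AE) (use ae v L2_measurable in auto)
  also have "\<dots> = charge ?g" using charge_reflect[of "fourier ?g"] charge_fourier[OF g] by simp
  also have "\<dots> = kin n u" unfolding kin_def charge_def eq ..
  finally show "charge (weak_deriv n u) = kin n u" .
qed

lemma test_fun_wfourier:
  assumes "test_fun \<phi>"
  shows "wfourier n \<phi> \<in> L2" "kin n \<phi> = charge ((deriv_x ^^ n) \<phi>)"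
proof -
  have t0: "\<phi> \<in> L2" "integrable lborel \<phi>" using test_fun_L2[OF assms, of 0] test_fun_integrable[OF assms, of 0] by simp_all
  have D: "FT ((deriv_x ^^ n) \<phi>) \<in> L2" by (intro FT_contraction test_fun_L2 test_fun_integrable assms)
  have ae: "AE \<xi> in lborel. cmod (wfourier n \<phi> \<xi>) = cmod (FT ((deriv_x ^^ n) \<phi>) \<xi>)"
    using fourier_integrable[OF t0]
    by eventually_elim (simp add: cmod_wfourier FT_deriv_x_funpow[OF assms] norm_mult norm_power)
  show h: "wfourier n \<phi> \<in> L2"
    by (rule L2_dominated[OF D _, where B = 1]) (use ae wfourier_measurable[OF t0(1)] in \<open>auto elim!: eventually_mono\<close>)
  have "kin n \<phi> = charge (FT ((deriv_x ^^ n) \<phi>))"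
    unfolding kin_def by (intro order_antisym charge_mono D h) (use ae in \<open>auto elim!: eventually_mono\<close>)
  also have "\<dots> = charge (fourier ((deriv_x ^^ n) \<phi>))"
    by (rule charge_cong_AE) (use fourier_integrable[OF test_fun_L2 test_fun_integrable, OF assms assms, of n] D
         fourier_L2[OF test_fun_L2[OF assms, of n]] L2_measurable in \<open>auto elim!: eventually_mono\<close>)
  also have "\<dots> = charge ((deriv_x ^^ n) \<phi>)" by (rule charge_fourier[OF test_fun_L2[OF assms]])
  finally show "kin n \<phi> = charge ((deriv_x ^^ n) \<phi>)" .
qed

section \<open>Sobolev spaces and the energy\<close>

lemma sobolev_iff: "u \<in> sobolev m \<longleftrightarrow> u \<in> L2 \<and> wfourier m u \<in> L2"
proof (cases "u \<in> L2")
  case True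
  have [measurable]: "fourier u \<in> borel_measurable borel" "wfourier m u \<in> borel_measurable borel"
    using fourier_L2[OF True] wfourier_measurable[OF True] L2_measurable by auto
  have i: "integrable lborel (\<lambda>\<xi>. (cmod (fourier u \<xi>))\<^sup>2)" by (intro L2_integrable fourier_L2 True)
  have eq: "(1 + \<bar>\<xi>\<bar> ^ (2 * m)) * (cmod (fourier u \<xi>))\<^sup>2 = (cmod (fourier u \<xi>))\<^sup>2 + (cmod (wfourier m u \<xi>))\<^sup>2" for \<xi>
    by (simp add: cmod_wfourier power_mult_distrib power_mult[symmetric] mult.commute[of m] ring_distribs)
  show ?thesis
  proof
    assume "u \<in> sobolev m"
    hence "integrable lborel (\<lambda>\<xi>. ((cmod (fourier u \<xi>))\<^sup>2 + (cmod (wfourier m u \<xi>))\<^sup>2) - (cmod (fourier u \<xi>))\<^sup>2)"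
      unfolding sobolev_def mem_Collect_eq eq by (intro Bochner_Integration.integrable_diff i) auto
    thus "u \<in> L2 \<and> wfourier m u \<in> L2" using True by (auto intro!: L2I)
  next
    assume "u \<in> L2 \<and> wfourier m u \<in> L2"
    thus "u \<in> sobolev m" using i unfolding sobolev_def mem_Collect_eq eq
      by (auto intro!: Bochner_Integration.integrable_add L2_integrable)
  qed
qed (auto simp: sobolev_def)

lemma sobolev_L2: "u \<in> sobolev m \<Longrightarrow> u \<in> L2" and sobolev_wfourier: "u \<in> sobolev m \<Longrightarrow> wfourier m u \<in> L2"
  by (auto simp: sobolev_iff)

lemma kin_nonneg: "0 \<le> kin m u" by (simp add: kin_def charge_nonneg)

lemma sobolev_norm_eq:
  assumes "u \<in> sobolev m" shows "sobolev_norm m u = sqrt (charge u + kin m u)"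
proof -
  have L: "u \<in> L2" "wfourier m u \<in> L2" using assms by (auto simp: sobolev_iff)
  have eq: "(1 + \<bar>\<xi>\<bar> ^ (2 * m)) * (cmod (fourier u \<xi>))\<^sup>2 = (cmod (fourier u \<xi>))\<^sup>2 + (cmod (wfourier m u \<xi>))\<^sup>2" for \<xi>
    by (simp add: cmod_wfourier power_mult_distrib power_mult[symmetric] mult.commute[of m] ring_distribs)
  have "(LINT \<xi>|lborel. (cmod (fourier u \<xi>))\<^sup>2 + (cmod (wfourier m u \<xi>))\<^sup>2) = charge (fourier u) + charge (wfourier m u)"
    unfolding charge_def by (intro Bochner_Integration.integral_add L2_integrable fourier_L2 L)
  thus ?thesis unfolding sobolev_norm_def eq kin_def using charge_fourier[OF L(1)] by simp
qed

lemma wfourier_add: "u \<in> L2 \<Longrightarrow> v \<in> L2 \<Longrightarrow> AE \<xi> in lborel. wfourier m (\<lambda>x. u x + v x) \<xi> = wfourier m u \<xi> + wfourier m v \<xi>"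
  using fourier_add[of u v] unfolding wfourier_def by (auto elim!: eventually_mono simp: ring_distribs)

lemma wfourier_cmult: "u \<in> L2 \<Longrightarrow> AE \<xi> in lborel. wfourier m (\<lambda>x. c * u x) \<xi> = c * wfourier m u \<xi>"
  using fourier_cmult[of u c] unfolding wfourier_def by (auto elim!: eventually_mono)

lemma wfourier_cong:
  "u \<in> borel_measurable borel \<Longrightarrow> v \<in> borel_measurable borel \<Longrightarrow> AE x in lborel. u x = v x \<Longrightarrow> wfourier m u = wfourier m v"
  using fourier_cong[of u v] unfolding wfourier_def[abs_def] by simp

lemma sobolev_add: assumes "u \<in> sobolev m" "v \<in> sobolev m" shows "(\<lambda>x. u x + v x) \<in> sobolev m"
proof -
  have L: "u \<in> L2" "wfourier m u \<in> L2" "v \<in> L2" "wfourier m v \<in> L2" using assms by (auto simp: sobolev_iff)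
  have "wfourier m (\<lambda>x. u x + v x) \<in> L2"
    by (rule L2_dominated[OF L2_add[OF L(2,4)], where B = 1])
       (use wfourier_add[OF L(1,3), of m] wfourier_measurable[OF L2_add[OF L(1,3)]] in \<open>auto elim!: eventually_mono\<close>)
  thus ?thesis using L L2_add by (simp add: sobolev_iff)
qed

lemma sobolev_cmult: assumes "u \<in> sobolev m" shows "(\<lambda>x. c * u x) \<in> sobolev m"
proof -
  have L: "u \<in> L2" "wfourier m u \<in> L2" using assms by (auto simp: sobolev_iff)
  have "wfourier m (\<lambda>x. c * u x) \<in> L2"
    by (rule L2_dominated[OF L2_cmult[OF L(2), of c], where B = 1])
       (use wfourier_cmult[OF L(1), of m c] wfourier_measurable[OF L2_cmult[OF L(1)]] in \<open>auto elim!: eventually_mono\<close>)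
  thus ?thesis using L L2_cmult by (simp add: sobolev_iff)
qed

lemma sobolev_diff: "u \<in> sobolev m \<Longrightarrow> v \<in> sobolev m \<Longrightarrow> (\<lambda>x. u x - v x) \<in> sobolev m"
  using sobolev_add[of u m "\<lambda>x. (-1) * v x"] sobolev_cmult[of v m "-1"] by simp

lemma sobolev_cong:
  assumes "u \<in> sobolev m" "v \<in> borel_measurable borel" "AE x in lborel. u x = v x"
  shows "v \<in> sobolev m" "kin m v = kin m u" "charge v = charge u"
proof -
  have u: "u \<in> L2" "u \<in> borel_measurable borel" using assms sobolev_L2 L2_measurable by auto
  have "v \<in> L2" by (rule L2_dominated[OF u(1) assms(2), where B = 1]) (use assms(3) in \<open>auto elim!: eventually_mono\<close>)
  thus "v \<in> sobolev m" "kin m v = kin m u" "charge v = charge u"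
    using assms(1) wfourier_cong[OF u(2) assms(2,3), of m] charge_cong_AE[OF u(2) assms(2,3)]
    by (auto simp: sobolev_iff kin_def)
qed

lemma kin_cmult: assumes "u \<in> L2" shows "kin m (\<lambda>x. c * u x) = (cmod c)\<^sup>2 * kin m u"
proof -
  have "kin m (\<lambda>x. c * u x) = charge (\<lambda>\<xi>. c * wfourier m u \<xi>)" unfolding kin_def
    by (rule charge_cong_AE) (use wfourier_cmult[OF assms, of m c] wfourier_measurable[OF assms, of m]
        wfourier_measurable[OF L2_cmult[OF assms, of c], of m] in auto)
  thus ?thesis by (simp add: charge_cmult kin_def)
qed

lemma kin_add:
  assumes "u \<in> sobolev m" "v \<in> sobolev m"
  shows "kin m (\<lambda>x. u x + v x) = kin m u + kin m v + 2 * Re (LINT \<xi>|lborel. wfourier m u \<xi> * cnj (wfourier m v \<xi>))"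
proof -
  have L: "u \<in> L2" "wfourier m u \<in> L2" "v \<in> L2" "wfourier m v \<in> L2" using assms by (auto simp: sobolev_iff)
  have "kin m (\<lambda>x. u x + v x) = charge (\<lambda>\<xi>. wfourier m u \<xi> + wfourier m v \<xi>)" unfolding kin_def
    by (rule charge_cong_AE) (use wfourier_add[OF L(1,3), of m] wfourier_measurable[OF L2_add[OF L(1,3)], of m] L2_add[OF L(2,4)] L2_measurable in auto)
  thus ?thesis by (simp add: charge_add[OF L(2,4)] kin_def)
qed

lemma l2n_wfourier_diff:
  assumes "u \<in> sobolev m" "v \<in> sobolev m"
  shows "l2n (\<lambda>\<xi>. wfourier m u \<xi> - wfourier m v \<xi>) = sqrt (kin m (\<lambda>x. u x - v x))"
proof -
  have L: "u \<in> L2" "wfourier m u \<in> L2" "v \<in> L2" "wfourier m v \<in> L2" using assms by (auto simp: sobolev_iff)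
  have L1: "(\<lambda>x. (-1) * v x) \<in> L2" using L by (intro L2_cmult)
  have "charge (\<lambda>\<xi>. wfourier m u \<xi> - wfourier m v \<xi>) = charge (wfourier m (\<lambda>x. u x - v x))"
  proof (rule charge_cong_AE)
    show "AE \<xi> in lborel. wfourier m u \<xi> - wfourier m v \<xi> = wfourier m (\<lambda>x. u x - v x) \<xi>"
      using wfourier_add[OF L(1) L1, of m] wfourier_cmult[OF L(3), of m "-1"] by eventually_elim simp
  qed (use L L2_diff wfourier_measurable L2_measurable in auto)
  thus ?thesis by (simp add: l2n_def kin_def)
qed

lemma test_fun_sobolev: "test_fun \<phi> \<Longrightarrow> \<phi> \<in> sobolev m"
  using test_fun_wfourier(1)[of \<phi> m] test_fun_L2[of \<phi> 0] by (simp add: sobolev_iff)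

text \<open>
  Square-integrability of this function for $m \ge 1$ is what makes the transforms of Sobolev
  functions integrable.
\<close>

definition inv_weight :: "nat \<Rightarrow> real \<Rightarrow> complex" where
  "inv_weight m \<xi> = complex_of_real (1 / sqrt (1 + \<bar>\<xi>\<bar> ^ (2 * m)))"

lemma inv_weight_L2: assumes "1 \<le> m" shows "inv_weight m \<in> L2"
proof (rule L2I)
  have pos: "0 < 1 + \<bar>\<xi>\<bar> ^ (2 * m)" for \<xi> :: real by (simp add: add_pos_nonneg)
  have eq: "(cmod (inv_weight m \<xi>))\<^sup>2 = 1 / (1 + \<bar>\<xi>\<bar> ^ (2 * m))" for \<xi>
    unfolding inv_weight_def norm_of_real using pos[of \<xi>] by (simp add: power_divide)
  have ge: "1 + \<xi>\<^sup>2 \<le> 2 * (1 + \<bar>\<xi>\<bar> ^ (2 * m))" for \<xi> :: real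
  proof -
    have "\<xi>\<^sup>2 \<le> 1 + \<bar>\<xi>\<bar> ^ (2 * m)"
    proof (cases "\<bar>\<xi>\<bar> \<le> 1")
      case True
      hence "\<xi>\<^sup>2 \<le> 1" by (simp add: abs_square_le_1)
      also have "1 \<le> 1 + \<bar>\<xi>\<bar> ^ (2 * m)" by simp
      finally show ?thesis .
    next
      case False
      hence "\<bar>\<xi>\<bar> ^ 2 \<le> \<bar>\<xi>\<bar> ^ (2 * m)" using assms by (intro power_increasing) auto
      also have "\<dots> \<le> 1 + \<bar>\<xi>\<bar> ^ (2 * m)" by simp
      finally show ?thesis by simp
    qed
    moreover have "1 \<le> 1 + \<bar>\<xi>\<bar> ^ (2 * m)" by simp
    ultimately have "1 + \<xi>\<^sup>2 \<le> (1 + \<bar>\<xi>\<bar> ^ (2 * m)) + (1 + \<bar>\<xi>\<bar> ^ (2 * m))" by (intro add_mono)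
    thus ?thesis by simp
  qed
  show "inv_weight m \<in> borel_measurable borel" unfolding inv_weight_def[abs_def] by measurable
  show "integrable lborel (\<lambda>\<xi>. (cmod (inv_weight m \<xi>))\<^sup>2)"
  proof (rule Bochner_Integration.integrable_bound)
    show "integrable lborel (\<lambda>x::real. 2 * inverse (1 + x\<^sup>2))"
      using integrable_inverse_1_plus_square by (simp add: set_integrable_def)
    show "AE \<xi> in lborel. norm ((cmod (inv_weight m \<xi>))\<^sup>2) \<le> norm (2 * inverse (1 + \<xi>\<^sup>2))"
    proof (rule AE_I2)
      fix \<xi> :: real
      have "1 / (1 + \<bar>\<xi>\<bar> ^ (2 * m)) \<le> 2 / (1 + \<xi>\<^sup>2)"
        using ge[of \<xi>] pos[of \<xi>] by (simp add: divide_le_eq le_divide_eq add_pos_nonneg field_simps)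
      thus "norm ((cmod (inv_weight m \<xi>))\<^sup>2) \<le> norm (2 * inverse (1 + \<xi>\<^sup>2))"
        unfolding eq using pos[of \<xi>] by (simp add: inverse_eq_divide)
    qed
  qed (simp add: inv_weight_def)
qed

text \<open>
  The Cauchy-Schwarz inequality with weight $1 + |\xi/R|^{2m}$. Choosing the scale $R$ in
  terms of $u$ yields an interpolation inequality. The factor $h$ is $1$ for the supremum and a
  difference of exponentials for the modulus of continuity.
\<close>

lemma fourier_weighted_Cauchy_Schwarz:
  assumes m: "1 \<le> m" and u: "u \<in> sobolev m" and R: "R > 0" and h: "h \<in> borel_measurable borel" "\<And>\<xi>. cmod (h \<xi>) \<le> B"
  shows "integrable lborel (\<lambda>\<xi>. h \<xi> * fourier u \<xi>)"
    "(LINT \<xi>|lborel. cmod (h \<xi> * fourier u \<xi>)) \<le> l2n (\<lambda>\<xi>. h \<xi> * inv_weight m (\<xi> / R)) * sqrt (charge u + kin m u / R ^ (2 * m))"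
proof -
  have L: "u \<in> L2" "wfourier m u \<in> L2" "fourier u \<in> L2" using u fourier_L2 by (auto simp: sobolev_iff)
  have [measurable]: "h \<in> borel_measurable borel" "fourier u \<in> borel_measurable borel" "wfourier m u \<in> borel_measurable borel"
    using h L L2_measurable by auto
  define W where "W \<xi> = complex_of_real (sqrt (1 + \<bar>\<xi> / R\<bar> ^ (2 * m))) * fourier u \<xi>" for \<xi>
  have pos: "0 < 1 + \<bar>\<xi>\<bar> ^ (2 * m)" for \<xi> :: real by (simp add: add_pos_nonneg)
  have [measurable]: "W \<in> borel_measurable borel" unfolding W_def by measurable
  have Wsq: "(cmod (W \<xi>))\<^sup>2 = (cmod (fourier u \<xi>))\<^sup>2 + (cmod (wfourier m u \<xi>))\<^sup>2 / R ^ (2 * m)" for \<xi>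
  proof -
    have "(cmod (W \<xi>))\<^sup>2 = (1 + \<bar>\<xi> / R\<bar> ^ (2 * m)) * (cmod (fourier u \<xi>))\<^sup>2"
      using pos[of "\<xi> / R"] by (simp add: W_def norm_mult power_mult_distrib)
    also have "\<bar>\<xi> / R\<bar> ^ (2 * m) = (\<bar>\<xi>\<bar> ^ m)\<^sup>2 / R ^ (2 * m)"
      using R by (simp add: power_divide power_mult[symmetric] mult.commute)
    finally show ?thesis by (simp add: cmod_wfourier power_mult_distrib ring_distribs)
  qed
  have iW: "integrable lborel (\<lambda>\<xi>. (cmod (fourier u \<xi>))\<^sup>2 + (cmod (wfourier m u \<xi>))\<^sup>2 / R ^ (2 * m))"
    by (intro Bochner_Integration.integrable_add integrable_divide L2_integrable L)
  hence W: "W \<in> L2" by (intro L2I) (auto simp: Wsq)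
  have "charge W = charge (fourier u) + charge (wfourier m u) / R ^ (2 * m)"
    unfolding charge_def Wsq
    by (subst Bochner_Integration.integral_add) (auto intro!: integrable_divide L2_integrable L)
  hence cW: "l2n W = sqrt (charge u + kin m u / R ^ (2 * m))"
    using charge_fourier[OF L(1)] by (simp add: l2n_def kin_def)
  have "(\<lambda>\<xi>. inv_weight m (0 + (1 / R) * \<xi>)) \<in> L2" by (intro L2_affine inv_weight_L2 m) (use R in auto)
  hence H: "(\<lambda>\<xi>. h \<xi> * inv_weight m (\<xi> / R)) \<in> L2" 
    by (intro L2_bounded_mult[where B = B] h) (simp add: mult.commute divide_inverse)
  have eq: "h \<xi> * inv_weight m (\<xi> / R) * W \<xi> = h \<xi> * fourier u \<xi>" for \<xi>
  proof -
    have "inv_weight m (\<xi> / R) * complex_of_real (sqrt (1 + \<bar>\<xi> / R\<bar> ^ (2 * m))) = 1"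
      unfolding inv_weight_def of_real_mult[symmetric] using pos[of "\<xi> / R"] by simp
    thus ?thesis unfolding W_def by (metis mult.assoc mult.right_neutral)
  qed
  show "integrable lborel (\<lambda>\<xi>. h \<xi> * fourier u \<xi>)" using L2_mult_integrable[OF H W] by (simp only: eq)
  show "(LINT \<xi>|lborel. cmod (h \<xi> * fourier u \<xi>)) \<le> l2n (\<lambda>\<xi>. h \<xi> * inv_weight m (\<xi> / R)) * sqrt (charge u + kin m u / R ^ (2 * m))"
    using L2_Cauchy_Schwarz_abs[OF H W] by (simp only: eq cW)
qed

text \<open>
  The inverse transform of the transform, as an absolutely convergent integral.
\<close>

definition cont_rep :: "(real \<Rightarrow> complex) \<Rightarrow> real \<Rightarrow> complex" where
  "cont_rep u x = FT (fourier u) (- x)"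

lemma sobolev_fourier_integrable: "1 \<le> m \<Longrightarrow> u \<in> sobolev m \<Longrightarrow> integrable lborel (fourier u)"
  using fourier_weighted_Cauchy_Schwarz(1)[of m u 1 "\<lambda>_. 1" 1] by simp

lemma cont_rep_measurable: "u \<in> L2 \<Longrightarrow> cont_rep u \<in> borel_measurable borel"
  unfolding cont_rep_def[abs_def] using fourier_L2[of u] L2_measurable by measurable

lemma cont_rep_AE: assumes "1 \<le> m" "u \<in> sobolev m" shows "AE x in lborel. u x = cont_rep u x"
proof -
  have u: "u \<in> L2" using assms sobolev_L2 by auto
  have c: "cont_rep u \<in> L2" unfolding cont_rep_def[abs_def]
    by (intro L2_reflect FT_contraction sobolev_fourier_integrable[OF assms] fourier_L2 u)
  have "AE x in lborel. u (- x) - cont_rep u (- x) = 0"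
    using fourier_inversion[OF u] fourier_integrable[OF fourier_L2[OF u] sobolev_fourier_integrable[OF assms]]
    by eventually_elim (simp add: cont_rep_def)
  hence "charge (\<lambda>x. u (- x) - cont_rep u (- x)) = 0"
    using charge_eq_0_iff[OF L2_reflect[OF L2_diff[OF u c]]] by simp
  hence "charge (\<lambda>x. u x - cont_rep u x) = 0" using charge_reflect[of "\<lambda>x. u x - cont_rep u x"] by simp
  thus ?thesis using charge_eq_0_iff[OF L2_diff[OF u c]] by simp
qed

lemma l2n_inv_weight_scaled: "R > 0 \<Longrightarrow> l2n (\<lambda>\<xi>. inv_weight m (\<xi> / R)) = sqrt R * l2n (inv_weight m)"
  using charge_affine[of "1 / R" "inv_weight m" 0] by (simp add: l2n_def real_sqrt_mult)

lemma sqrt_2pi_ge_1: "1 \<le> sqrt (2 * pi)" using pi_gt3 by simp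

lemma cont_rep_bound:
  assumes "1 \<le> m" "u \<in> sobolev m" "R > 0"
  shows "cmod (cont_rep u x) \<le> l2n (inv_weight m) * sqrt R * sqrt (charge u + kin m u / R ^ (2 * m))"
proof -
  have "cmod (cont_rep u x) \<le> (LINT \<xi>|lborel. cmod (fourier u \<xi>)) / sqrt (2 * pi)"
    unfolding cont_rep_def by (rule FT_bound[OF sobolev_fourier_integrable[OF assms(1,2)]])
  also have "\<dots> \<le> (LINT \<xi>|lborel. cmod (fourier u \<xi>)) / 1"
    by (rule divide_left_mono[OF sqrt_2pi_ge_1]) (use sqrt_2pi_ge_1 in auto)
  also have "\<dots> \<le> l2n (inv_weight m) * sqrt R * sqrt (charge u + kin m u / R ^ (2 * m))"
    using fourier_weighted_Cauchy_Schwarz(2)[OF assms, of "\<lambda>_. 1" 1] by (simp add: l2n_inv_weight_scaled assms mult.commute)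
  finally show ?thesis .
qed

lemma cont_rep_bound1:
  assumes "1 \<le> m" "u \<in> sobolev m" "charge u + kin m u \<le> A"
  shows "cmod (cont_rep u x) \<le> l2n (inv_weight m) * sqrt A"
  using cont_rep_bound[OF assms(1,2), of 1 x] assms(3) l2n_nonneg[of "inv_weight m"]
  by (simp add: mult_left_mono order_trans[OF _ mult_left_mono[OF real_sqrt_le_mono[OF assms(3)]]])

text \<open>
  A modulus of continuity shared by all functions whose Sobolev norm is at most one.
\<close>

definition modulus :: "nat \<Rightarrow> real \<Rightarrow> real" where
  "modulus m h = l2n (\<lambda>\<xi>. (exp (\<i> * complex_of_real (h * \<xi>)) - 1) * inv_weight m \<xi>)"

lemma cont_rep_equicontinuous:
  assumes "1 \<le> m" "u \<in> sobolev m" "charge u + kin m u \<le> A"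
  shows "cmod (cont_rep u x - cont_rep u y) \<le> modulus m (x - y) * sqrt A"
proof -
  let ?h = "\<lambda>\<xi>. exp (\<i> * complex_of_real (x * \<xi>)) - exp (\<i> * complex_of_real (y * \<xi>))"
  have [measurable]: "?h \<in> borel_measurable borel" by measurable
  have hb: "cmod (?h \<xi>) \<le> 2" for \<xi>
    using norm_triangle_ineq4[of "exp (\<i> * complex_of_real (x * \<xi>))" "exp (\<i> * complex_of_real (y * \<xi>))"]
      cmod_exp_i_real(2)[of "x * \<xi>"] cmod_exp_i_real(2)[of "y * \<xi>"] by simp
  note i = sobolev_fourier_integrable[OF assms(1,2)]
  have "cont_rep u x - cont_rep u y = (LINT \<xi>|lborel. ?h \<xi> * fourier u \<xi>) / complex_of_real (sqrt (2 * pi))"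
    unfolding cont_rep_def FT_def diff_divide_distrib[symmetric]
    by (subst Bochner_Integration.integral_diff[symmetric])
       (use FT_integrand_integrable[OF i, of "-x"] FT_integrand_integrable[OF i, of "-y"] in
         \<open>auto simp: algebra_simps intro!: arg_cong2[where f = "(/)"] Bochner_Integration.integral_cong\<close>)
  hence "cmod (cont_rep u x - cont_rep u y) = cmod (LINT \<xi>|lborel. ?h \<xi> * fourier u \<xi>) / sqrt (2 * pi)"
    by (simp add: norm_divide)
  also have "\<dots> \<le> cmod (LINT \<xi>|lborel. ?h \<xi> * fourier u \<xi>) / 1"
    by (rule divide_left_mono[OF sqrt_2pi_ge_1]) (use sqrt_2pi_ge_1 in auto)
  also have "\<dots> \<le> (LINT \<xi>|lborel. cmod (?h \<xi> * fourier u \<xi>))" using integral_norm_bound by simp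
  also have "\<dots> \<le> l2n (\<lambda>\<xi>. ?h \<xi> * inv_weight m (\<xi> / 1)) * sqrt (charge u + kin m u / 1 ^ (2 * m))"
    by (rule fourier_weighted_Cauchy_Schwarz(2)[OF assms(1,2) _ _ hb]) auto
  also have "l2n (\<lambda>\<xi>. ?h \<xi> * inv_weight m (\<xi> / 1)) = modulus m (x - y)"
  proof -
    have "?h \<xi> = exp (\<i> * complex_of_real (y * \<xi>)) * (exp (\<i> * complex_of_real ((x - y) * \<xi>)) - 1)" for \<xi>
      by (simp add: algebra_simps flip: exp_add)
    hence "cmod (?h \<xi> * inv_weight m (\<xi> / 1)) = cmod ((exp (\<i> * complex_of_real ((x - y) * \<xi>)) - 1) * inv_weight m \<xi>)" for \<xi>
      using cmod_exp_i_real(2)[of "y * \<xi>"] by (simp add: norm_mult)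
    thus ?thesis unfolding modulus_def l2n_def charge_def by simp
  qed
  also have "modulus m (x - y) * sqrt (charge u + kin m u / 1 ^ (2 * m)) \<le> modulus m (x - y) * sqrt A"
    using assms(3) by (intro mult_left_mono) (auto simp: modulus_def l2n_nonneg)
  finally show ?thesis .
qed

lemma modulus_tendsto: assumes "1 \<le> m" shows "(modulus m \<longlongrightarrow> 0) (at 0)"
  unfolding tendsto_at_iff_sequentially
proof (intro allI impI)
  fix X :: "nat \<Rightarrow> real" assume X: "X \<longlonglongrightarrow> 0"
  have [measurable]: "inv_weight m \<in> borel_measurable borel" using inv_weight_L2[OF assms] L2_measurable by auto
  have "(\<lambda>n. LINT \<xi>|lborel. (cmod ((exp (\<i> * complex_of_real (X n * \<xi>)) - 1) * inv_weight m \<xi>))\<^sup>2) \<longlonglongrightarrow> (LINT \<xi>::real|lborel. 0)"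
  proof (rule integral_dominated_convergence)
    show "integrable lborel (\<lambda>\<xi>. 4 * (cmod (inv_weight m \<xi>))\<^sup>2)" by (intro integrable_mult_right L2_integrable inv_weight_L2 assms)
    show "AE \<xi> in lborel. (\<lambda>n. (cmod ((exp (\<i> * complex_of_real (X n * \<xi>)) - 1) * inv_weight m \<xi>))\<^sup>2) \<longlonglongrightarrow> 0"
    proof (rule AE_I2)
      fix \<xi>
      have "(\<lambda>n. (cmod ((exp (\<i> * complex_of_real (X n * \<xi>)) - 1) * inv_weight m \<xi>))\<^sup>2) \<longlonglongrightarrow> (cmod ((exp (\<i> * complex_of_real (0 * \<xi>)) - 1) * inv_weight m \<xi>))\<^sup>2"
        by (intro tendsto_intros X)
      thus "(\<lambda>n. (cmod ((exp (\<i> * complex_of_real (X n * \<xi>)) - 1) * inv_weight m \<xi>))\<^sup>2) \<longlonglongrightarrow> 0" by simp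
    qed
    show "AE \<xi> in lborel. norm ((cmod ((exp (\<i> * complex_of_real (X n * \<xi>)) - 1) * inv_weight m \<xi>))\<^sup>2) \<le> 4 * (cmod (inv_weight m \<xi>))\<^sup>2" for n
    proof (rule AE_I2)
      fix \<xi>
      have "cmod (exp (\<i> * complex_of_real (X n * \<xi>)) - 1) \<le> 2"
        using norm_triangle_ineq4[of "exp (\<i> * complex_of_real (X n * \<xi>))" 1] cmod_exp_i_real(2)[of "X n * \<xi>"] by simp
      hence "(cmod (exp (\<i> * complex_of_real (X n * \<xi>)) - 1))\<^sup>2 \<le> 2\<^sup>2" by (intro power_mono) auto
      thus "norm ((cmod ((exp (\<i> * complex_of_real (X n * \<xi>)) - 1) * inv_weight m \<xi>))\<^sup>2) \<le> 4 * (cmod (inv_weight m \<xi>))\<^sup>2"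
        by (simp add: norm_mult power_mult_distrib mult_right_mono)
    qed
  qed auto
  hence "(\<lambda>n. sqrt (charge (\<lambda>\<xi>. (exp (\<i> * complex_of_real (X n * \<xi>)) - 1) * inv_weight m \<xi>))) \<longlonglongrightarrow> sqrt 0"
    unfolding charge_def by (intro tendsto_intros) simp
  thus "(modulus m \<circ> X) \<longlonglongrightarrow> 0" unfolding modulus_def l2n_def comp_def by simp
qed

definition translate :: "real \<Rightarrow> (real \<Rightarrow> complex) \<Rightarrow> real \<Rightarrow> complex" where
  "translate s u x = u (x - s)"

lemma L2_translate: "u \<in> L2 \<Longrightarrow> translate s u \<in> L2"
  using L2_affine[of u 1 "- s"] by (simp add: translate_def[abs_def])

lemma charge_translate: "charge (translate s u) = charge u"
  using charge_affine[of 1 u "- s"] by (simp add: translate_def[abs_def])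

lemma AE_translate:
  assumes "AE x in lborel. P (x::real)" "Measurable.pred borel P" shows "AE x in lborel. P (x - s)"
proof -
  have "((+) (- s)) = (\<lambda>x. x - s)" by (rule ext) simp
  hence "lborel = distr lborel borel (\<lambda>x. x - s)"
    using lborel_distr_plus[of "- s"] by metis
  hence "AE x in distr lborel borel (\<lambda>x. x - s). P x" using assms(1) by metis
  thus ?thesis by (subst (asm) AE_distr_iff) (use assms(2) in \<open>auto simp: pred_def\<close>)
qed

text \<open>
  The translated continuous representative is the inverse transform of $e^{-i s \xi} \hat u(\xi)$,
  which is still integrable.
\<close>

lemma fourier_translate:
  assumes m: "1 \<le> m" and u: "u \<in> sobolev m"
  shows "AE \<xi> in lborel. fourier (translate s u) \<xi> = exp (- \<i> * complex_of_real (s * \<xi>)) * fourier u \<xi>"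
proof -
  let ?g = "\<lambda>\<xi>. exp (- \<i> * complex_of_real (s * \<xi>)) * fourier u \<xi>"
  have L: "u \<in> L2" "fourier u \<in> L2" using u fourier_L2 by (auto simp: sobolev_iff)
  have [measurable]: "fourier u \<in> borel_measurable borel" "u \<in> borel_measurable borel" "cont_rep u \<in> borel_measurable borel"
    using L L2_measurable cont_rep_measurable by auto
  have cm: "cmod (?g \<xi>) = cmod (fourier u \<xi>)" for \<xi>
    using cmod_exp_i_real(1)[of "s * \<xi>"] by (simp add: norm_mult)
  have g2: "?g \<in> L2" by (rule L2_dominated[OF L(2), where B = 1]) (measurable, simp only: cm, simp)
  have g1: "integrable lborel ?g"
    by (rule Bochner_Integration.integrable_bound[OF sobolev_fourier_integrable[OF m u]]) (measurable, simp only: cm, simp)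
  have "FT ?g (- x) = cont_rep u (x - s)" for x
    unfolding cont_rep_def FT_def
    by (intro arg_cong2[where f = "(/)"] Bochner_Integration.integral_cong refl)
       (simp add: algebra_simps flip: exp_add)
  moreover have "AE x in lborel. u (x - s) = cont_rep u (x - s)"
    by (rule AE_translate[OF cont_rep_AE[OF m u]]) measurable
  ultimately have "AE x in lborel. translate s u x = FT ?g (- x)" by (simp add: translate_def)
  hence "fourier (translate s u) = fourier (\<lambda>x. FT ?g (- x))"
    by (intro fourier_cong) (use L2_translate[OF L(1), of s] fourier_inverse_integrable(1)[OF g2 g1] L2_measurable in auto)
  thus ?thesis using fourier_inverse_integrable(2)[OF g2 g1] by simp
qed

lemma translate_sobolev:
  assumes m: "1 \<le> m" and u: "u \<in> sobolev m"
  shows "translate s u \<in> sobolev m" "kin m (translate s u) = kin m u"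
proof -
  have L: "u \<in> L2" "wfourier m u \<in> L2" using u by (auto simp: sobolev_iff)
  have ae: "AE \<xi> in lborel. cmod (wfourier m (translate s u) \<xi>) = cmod (wfourier m u \<xi>)"
    using fourier_translate[OF m u, of s]
  proof eventually_elim
    case (elim \<xi>)
    thus ?case using cmod_exp_i_real(1)[of "s * \<xi>"] by (simp add: cmod_wfourier norm_mult)
  qed
  have h: "wfourier m (translate s u) \<in> L2"
    by (rule L2_dominated[OF L(2), where B = 1])
       (use ae wfourier_measurable[OF L2_translate[OF L(1)]] in \<open>auto elim!: eventually_mono\<close>)
  thus "translate s u \<in> sobolev m" using L2_translate[OF L(1)] by (simp add: sobolev_iff)
  show "kin m (translate s u) = kin m u" unfolding kin_def
    by (intro order_antisym charge_mono h L) (use ae in \<open>auto elim!: eventually_mono\<close>)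
qed

lemma cont_rep_translate:
  assumes m: "1 \<le> m" and u: "u \<in> sobolev m"
  shows "cont_rep (translate s u) x = cont_rep u (x - s)"
proof -
  have [measurable]: "fourier u \<in> borel_measurable borel" "fourier (translate s u) \<in> borel_measurable borel"
    using fourier_L2[OF sobolev_L2[OF u]] fourier_L2[OF L2_translate[OF sobolev_L2[OF u]]] L2_measurable by auto
  have "(LINT \<xi>|lborel. fourier (translate s u) \<xi> * exp (- \<i> * complex_of_real (\<xi> * - x))) =
     (LINT \<xi>|lborel. fourier u \<xi> * exp (- \<i> * complex_of_real (\<xi> * - (x - s))))"
  proof (rule integral_cong_AE)
    show "AE \<xi> in lborel. fourier (translate s u) \<xi> * exp (- \<i> * complex_of_real (\<xi> * - x)) =
       fourier u \<xi> * exp (- \<i> * complex_of_real (\<xi> * - (x - s)))"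
      using fourier_translate[OF m u, of s]
      by eventually_elim (simp add: algebra_simps flip: exp_add)
  qed auto
  thus ?thesis unfolding cont_rep_def FT_def by simp
qed

definition pot :: "real \<Rightarrow> (real \<Rightarrow> complex) \<Rightarrow> real" where
  "pot p u = (LINT x|lborel. cmod (u x) powr p)"

lemma pot_nonneg: "0 \<le> pot p u" unfolding pot_def by (intro integral_nonneg_AE) auto

lemma powr_split:
  fixes y p :: real assumes "0 \<le> y" "2 < p" shows "y powr p = y powr (p - 2) * y\<^sup>2"
proof (cases "y = 0")
  case False
  hence "0 < y" using assms by simp
  have "y powr p = y powr (p - 2) * y powr 2" by (simp flip: powr_add)
  also have "y powr 2 = y\<^sup>2" using \<open>0 < y\<close> by simp
  finally show ?thesis .
qed simp

lemma powr_le_quadratic: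
  fixes p y M :: real assumes "2 < p" "0 \<le> y" "y \<le> M" shows "y powr p \<le> M powr (p - 2) * y\<^sup>2"
  unfolding powr_split[OF assms(2,1)] using assms by (intro mult_right_mono powr_mono2) auto

lemma pot_integrable:
  assumes "2 < p" "u \<in> L2" "AE x in lborel. cmod (u x) \<le> M"
  shows "integrable lborel (\<lambda>x. cmod (u x) powr p)" "pot p u \<le> M powr (p - 2) * charge u"
proof -
  have [measurable]: "u \<in> borel_measurable borel" using assms L2_measurable by auto
  have i: "integrable lborel (\<lambda>x. M powr (p - 2) * (cmod (u x))\<^sup>2)"
    by (intro integrable_mult_right L2_integrable assms)
  have ae: "AE x in lborel. cmod (u x) powr p \<le> M powr (p - 2) * (cmod (u x))\<^sup>2"
    using assms(3) by eventually_elim (rule powr_le_quadratic[OF assms(1)], auto)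
  show 1: "integrable lborel (\<lambda>x. cmod (u x) powr p)"
    by (rule Bochner_Integration.integrable_bound[OF i]) (use ae in \<open>auto elim!: eventually_mono\<close>)
  have "pot p u \<le> (LINT x|lborel. M powr (p - 2) * (cmod (u x))\<^sup>2)"
    unfolding pot_def by (rule integral_mono_AE[OF 1 i ae])
  thus "pot p u \<le> M powr (p - 2) * charge u" unfolding charge_def by simp
qed

lemma sobolev_bounded:
  assumes "1 \<le> m" "u \<in> sobolev m" "charge u + kin m u \<le> A"
  shows "AE x in lborel. cmod (u x) \<le> l2n (inv_weight m) * sqrt A"
  using cont_rep_AE[OF assms(1,2)] by eventually_elim (use cont_rep_bound1[OF assms] in auto)

lemma sobolev_pot_integrable:
  assumes "1 \<le> m" "2 < p" "u \<in> sobolev m" shows "integrable lborel (\<lambda>x. cmod (u x) powr p)"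
  using pot_integrable(1)[OF assms(2) sobolev_L2[OF assms(3)] sobolev_bounded[OF assms(1,3) order_refl]] .

lemma energy_eq:
  assumes "1 \<le> m" "2 < p" "u \<in> sobolev m" shows "energy m p u = kin m u / 2 - 2 / p * pot p u"
proof -
  have L: "u \<in> L2" "wfourier m u \<in> L2" using assms by (auto simp: sobolev_iff)
  note w = weak_deriv_charge[OF L]
  have "energy m p u = (LINT x|lborel. 1 / 2 * (cmod (weak_deriv m u x))\<^sup>2) - (LINT x|lborel. 2 / p * cmod (u x) powr p)"
    unfolding energy_def
    by (intro Bochner_Integration.integral_diff integrable_mult_right L2_integrable w sobolev_pot_integrable[OF assms])
  also have "\<dots> = 1 / 2 * charge (weak_deriv m u) - 2 / p * pot p u"
    unfolding charge_def pot_def by simp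
  finally show ?thesis by (simp add: w)
qed

lemma pot_cmult: "pot p (\<lambda>x. c * u x) = cmod c powr p * pot p u"
  unfolding pot_def by (simp add: norm_mult powr_mult)

lemma pot_affine: "c \<noteq> 0 \<Longrightarrow> pot p (\<lambda>x. u (t + c * x)) = pot p u / \<bar>c\<bar>"
  unfolding pot_def by (subst (2) lborel_integral_real_affine[of c _ t]) auto

lemma pot_translate: "pot p (translate s u) = pot p u"
  using pot_affine[of 1 p u "- s"] by (simp add: translate_def[abs_def])

lemma pot_cong_AE:
  "u \<in> borel_measurable borel \<Longrightarrow> v \<in> borel_measurable borel \<Longrightarrow> AE x in lborel. u x = v x \<Longrightarrow> pot p u = pot p v"
  unfolding pot_def by (intro integral_cong_AE) auto

section \<open>Inequalities for the energy\<close>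

text \<open>
  The mean value theorem, with the derivative at an intermediate point $z$ estimated by
  $p M^{p-2} z$. The case $x = 0$ is separate because \<open>powr\<close> is differentiated at positive
  arguments.
\<close>

lemma powr_diff_bound:
  fixes x y p M :: real
  assumes p: "2 < p" and "0 \<le> x" "x \<le> M" "0 \<le> y" "y \<le> M"
  shows "\<bar>x powr p - y powr p\<bar> \<le> p * M powr (p - 2) * (x + y) * \<bar>x - y\<bar>"
proof -
  have main: "\<bar>x powr p - y powr p\<bar> \<le> p * M powr (p - 2) * (x + y) * \<bar>x - y\<bar>"
    if xy: "0 \<le> x" "x < y" "y \<le> M" for x y :: real
  proof (cases "x = 0")
    case True
    have "y powr p \<le> M powr (p - 2) * y\<^sup>2" by (rule powr_le_quadratic) (use p xy in auto)
    also have "\<dots> \<le> p * (M powr (p - 2) * y\<^sup>2)" using mult_right_mono[of 1 p "M powr (p - 2) * y\<^sup>2"] p by simp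
    finally show ?thesis using True xy by (simp add: power2_eq_square mult_ac)
  next
    case False
    hence x: "x > 0" using xy by simp
    have "\<exists>z. z > x \<and> z < y \<and> y powr p - x powr p = (y - x) * (p * z powr (p - 1))"
      by (rule MVT2[OF xy(2)]) (use x in \<open>auto intro!: derivative_eq_intros\<close>)
    then obtain z where z: "z > x" "z < y" "y powr p - x powr p = (y - x) * (p * z powr (p - 1))" by blast
    have "z powr (p - 1) = z powr ((p - 2) + 1)" by simp
    also have "\<dots> = z powr (p - 2) * z powr 1" by (rule powr_add)
    also have "z powr 1 = z" using z x by simp
    also have "z powr (p - 2) * z \<le> M powr (p - 2) * (x + y)"
      using z x xy p by (intro mult_mono powr_mono2) auto
    finally have "(y - x) * (p * z powr (p - 1)) \<le> (y - x) * (p * (M powr (p - 2) * (x + y)))"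
      using xy p by (intro mult_left_mono) auto
    moreover have "0 \<le> (y - x) * (p * z powr (p - 1))" using xy p by auto
    ultimately show ?thesis using xy z(3) by (simp add: abs_minus_commute[of x y] abs_minus_commute[of "x powr p"] mult_ac)
  qed
  consider "x < y" | "x = y" | "y < x" by linarith
  thus ?thesis
  proof cases
    case 1 thus ?thesis using main assms by blast
  next
    case 2 thus ?thesis by simp
  next
    case 3 thus ?thesis using main[of y x] assms by (simp add: abs_minus_commute add.commute)
  qed
qed

text \<open>
  If $|b| \le |a|$, both $|a+b|^p - |a|^p$ and $|b|^p$ are bounded by multiples of $|a| |b|$. Having
  a product on the right makes the error of the splitting a pairing with a fixed function.
\<close>

lemma Brezis_Lieb_pointwise:
  fixes a b :: complex and p M :: real
  assumes p: "2 < p" and "cmod a \<le> M" "cmod b \<le> M"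
  shows "\<bar>cmod (a + b) powr p - cmod a powr p - cmod b powr p\<bar> \<le> (3 * p + 1) * (2 * M) powr (p - 2) * (cmod a * cmod b)"
proof -
  have main: "\<bar>cmod (a + b) powr p - cmod a powr p - cmod b powr p\<bar> \<le> (3 * p + 1) * (2 * M) powr (p - 2) * (cmod a * cmod b)"
    if ab: "cmod b \<le> cmod a" "cmod a \<le> M" for a b :: complex
  proof -
    have M: "0 \<le> M" using ab norm_ge_zero order_trans by blast
    have s: "cmod (a + b) \<le> cmod a + cmod b" by (rule norm_triangle_ineq)
    let ?C = "(2 * M) powr (p - 2)"
    have "\<bar>cmod (a + b) powr p - cmod a powr p\<bar> \<le> p * ?C * (cmod (a + b) + cmod a) * \<bar>cmod (a + b) - cmod a\<bar>"
    proof (rule powr_diff_bound[OF p])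
      show "cmod (a + b) \<le> 2 * M" "cmod a \<le> 2 * M" using s ab M by linarith+
    qed auto
    also have "\<dots> \<le> p * ?C * (3 * cmod a) * cmod b"
      using p s ab norm_triangle_ineq3[of "a + b" a] by (intro mult_mono mult_left_mono) auto
    finally have 1: "\<bar>cmod (a + b) powr p - cmod a powr p\<bar> \<le> 3 * p * ?C * (cmod a * cmod b)" by (simp add: mult_ac)
    have "cmod b powr p \<le> ?C * (cmod b)\<^sup>2"
      by (rule powr_le_quadratic) (use p ab M in auto)
    also have "\<dots> \<le> ?C * (cmod a * cmod b)" using ab by (intro mult_left_mono) (auto simp: power2_eq_square mult_right_mono)
    finally have 2: "cmod b powr p \<le> ?C * (cmod a * cmod b)" .
    have "0 \<le> cmod b powr p" by simp
    moreover have "(3 * p + 1) * ?C * (cmod a * cmod b) = 3 * p * ?C * (cmod a * cmod b) + ?C * (cmod a * cmod b)"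
      by (simp add: algebra_simps)
    ultimately show ?thesis using 1 2 by linarith
  qed
  show ?thesis
  proof (cases "cmod b \<le> cmod a")
    case True thus ?thesis using main assms by blast
  next
    case False 
    have eq: "cmod (a + b) powr p - cmod a powr p - cmod b powr p = cmod (b + a) powr p - cmod b powr p - cmod a powr p"
      by (simp add: add.commute[of a b])
    show ?thesis unfolding eq mult.commute[of "cmod a" "cmod b"]
      by (rule main) (use False assms in auto)
  qed
qed

lemma powr_convex_below:
  fixes x y p :: real
  assumes p: "1 < p" and "0 \<le> x" "0 \<le> y"
  shows "x powr p + p * (x powr (p - 1) * (y - x)) \<le> y powr p"
proof -
  have q: "1 < p / (p - 1)" "1 / (p / (p - 1)) + 1 / p = 1" using p by (auto simp: field_simps)
  have "x powr (p - 1) * y \<le> (x powr (p - 1)) powr (p / (p - 1)) / (p / (p - 1)) + y powr p / p"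
    by (rule Youngs_inequality) (use p q assms in auto)
  also have "(x powr (p - 1)) powr (p / (p - 1)) = x powr p" using p by (simp add: powr_powr)
  finally have "p * (x powr (p - 1) * y) \<le> p * (x powr p / (p / (p - 1)) + y powr p / p)"
    using p by (intro mult_left_mono) auto
  also have "\<dots> = (p - 1) * x powr p + y powr p" using p by (simp add: field_simps)
  finally have 1: "p * (x powr (p - 1) * y) \<le> (p - 1) * x powr p + y powr p" .
  have "x powr (p - 1) * x = x powr p"
    using assms by (cases "x = 0") (auto simp: powr_mult_base mult.commute)
  thus ?thesis using 1 by (simp add: algebra_simps)
qed

lemma square_powr:
  fixes x q :: real assumes "0 \<le> x" shows "(x\<^sup>2) powr q = x powr (2 * q)"
proof (cases "x = 0")
  case False
  hence "x powr 2 = x\<^sup>2" using assms by simp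
  hence "(x\<^sup>2) powr q = (x powr 2) powr q" by (simp only:)
  also have "\<dots> = x powr (2 * q)" by (rule powr_powr)
  finally show ?thesis .
qed simp

text \<open>
  The multiple of $u$ with charge $c$ has energy at least $I$; its kinetic energy is that of $u$
  times $t^2$ and its potential energy times $t^p$ with $t^2 = c / C(u)$. For $C(u) < c$ the second
  summand is positive, which is strict subadditivity of the minimal energy in the form in which
  it is needed.
\<close>

lemma energy_amplitude_scaling:
  assumes m: "1 \<le> m" and p: "2 < p" and u: "u \<in> sobolev m" and c: "0 < c" and b: "0 < charge u"
    and inf: "\<And>v. v \<in> sobolev m \<Longrightarrow> charge v = c \<Longrightarrow> I \<le> energy m p v"
  shows "charge u / c * I + ((c / charge u) powr (p / 2 - 1) - 1) * (2 / p * pot p u) \<le> energy m p u"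
proof -
  let ?t = "sqrt (c / charge u)"
  have t: "?t > 0" using c b by simp
  have tsq: "?t\<^sup>2 = c / charge u" using c b by simp
  let ?v = "\<lambda>x. complex_of_real ?t * u x"
  have v: "?v \<in> sobolev m" by (rule sobolev_cmult[OF u])
  have "charge ?v = c" using b c by (simp add: charge_cmult)
  hence "I \<le> energy m p ?v" by (rule inf[OF v])
  also have "energy m p ?v = ?t\<^sup>2 * (kin m u / 2) - ?t powr p * (2 / p * pot p u)"
    using t by (simp add: energy_eq[OF m p v] kin_cmult[OF sobolev_L2[OF u]] pot_cmult)
  also have "?t powr p = ?t\<^sup>2 * (c / charge u) powr (p / 2 - 1)"
  proof -
    have "?t powr p = ?t powr (p - 2) * ?t\<^sup>2" by (rule powr_split) (use t p in auto)
    also have "?t powr (p - 2) = (c / charge u) powr (p / 2 - 1)"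
      using c b by (simp add: powr_half_sqrt[symmetric] powr_powr field_simps)
    finally show ?thesis by simp
  qed
  finally have "I \<le> ?t\<^sup>2 * (kin m u / 2 - (c / charge u) powr (p / 2 - 1) * (2 / p * pot p u))"
    by (simp add: algebra_simps)
  hence "charge u / c * I \<le> charge u / c * (?t\<^sup>2 * (kin m u / 2 - (c / charge u) powr (p / 2 - 1) * (2 / p * pot p u)))"
    using b c by (intro mult_left_mono) auto
  also have "\<dots> = kin m u / 2 - (c / charge u) powr (p / 2 - 1) * (2 / p * pot p u)"
    unfolding tsq using b c by simp
  finally show ?thesis unfolding energy_eq[OF m p u] by (simp add: algebra_simps)
qed

text \<open>
  Taking $R^{2m} = 1 + K$ in the bound on the supremum, where $K$ is the kinetic part, bounds
  $|u|^2$ by a multiple of $(1+K)^{1/(2m)}$ and the potential energy by a multiple of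
  $(1+K)^s$ with $s = (p-2)/(4m)$. The assumption on $p$ says that $s < 1$, so a quarter of $1 + K$
  absorbs this up to a constant.
\<close>

lemma energy_coercive:
  fixes A :: real
  assumes m: "1 \<le> m" and p: "2 < p" "p < 4 * real m + 2" and A: "0 \<le> A"
  obtains D where "\<And>u. u \<in> sobolev m \<Longrightarrow> charge u \<le> A \<Longrightarrow> kin m u \<le> 4 * energy m p u + D"
proof -
  define S where "S = l2n (inv_weight m)"
  define q where "q = (p - 2) / 2"
  define s where "s = q / (2 * real m)"
  have S: "0 \<le> S" by (simp add: S_def l2n_nonneg)
  have q: "0 < q" using p by (simp add: q_def)
  have q2: "2 * q = p - 2" by (simp add: q_def)
  have s: "0 < s" "s < 1" using p m q by (auto simp: s_def q_def field_simps)
  define D1 where "D1 = 2 / p * ((S\<^sup>2 * (A + 1)) powr q * A)"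
  have D1: "0 \<le> D1" using p A by (simp add: D1_def)
  \<comment> \<open>above \<open>L\<close> the power is at most a quarter of its argument, below it is bounded\<close>
  define L where "L = (4 * D1) powr (1 / (1 - s))"
  define D2 where "D2 = D1 * L powr s"
  have absorb: "D1 * K powr s \<le> K / 4 + D2" if K: "0 < K" for K
  proof (cases "K \<le> L")
    case True
    have "D1 * K powr s \<le> D2" unfolding D2_def using True K s D1 by (intro mult_left_mono powr_mono2) auto
    thus ?thesis using K by simp
  next
    case False
    have "4 * D1 \<le> K powr (1 - s)"
    proof (cases "D1 = 0")
      case False
      have "4 * D1 = L powr (1 - s)" using D1 False s by (simp add: L_def powr_powr)
      also have "\<dots> \<le> K powr (1 - s)" using \<open>\<not> K \<le> L\<close> s by (intro powr_mono2) (auto simp: L_def)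
      finally show ?thesis .
    qed simp
    hence "4 * D1 * K powr s \<le> K powr (1 - s) * K powr s" by (intro mult_right_mono) auto
    also have "\<dots> = K" using K by (simp flip: powr_add)
    finally have "D1 * K powr s \<le> K / 4" by simp
    moreover have "0 \<le> D2" using D1 by (simp add: D2_def)
    ultimately show ?thesis by linarith
  qed
  have "kin m u \<le> 4 * energy m p u + (1 + 4 * D2)" if u: "u \<in> sobolev m" and cA: "charge u \<le> A" for u
  proof -
    let ?K = "1 + kin m u"
    have K: "1 \<le> ?K" using kin_nonneg by simp
    define R where "R = ?K powr (1 / (2 * real m))"
    have R: "0 < R" using K by (simp add: R_def)
    have "R ^ (2 * m) = R powr (real (2 * m))" using powr_realpow[OF R, of "2 * m"] by simp
    also have "\<dots> = ?K" unfolding R_def powr_powr using m K by simp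
    finally have Rm: "R ^ (2 * m) = ?K" .
    have "charge u + kin m u / R ^ (2 * m) \<le> A + 1"
      unfolding Rm using cA K kin_nonneg[of m u] by (intro add_mono) (auto simp: divide_le_eq)
    hence le: "S * sqrt R * sqrt (charge u + kin m u / R ^ (2 * m)) \<le> S * sqrt R * sqrt (A + 1)"
      using S R by (intro mult_left_mono) auto
    have bd: "AE x in lborel. cmod (u x) \<le> S * sqrt R * sqrt (A + 1)"
      using cont_rep_AE[OF m u]
    proof eventually_elim
      case (elim x)
      show ?case using cont_rep_bound[OF m u R, of x] le elim unfolding S_def by simp
    qed
    let ?M = "S * sqrt R * sqrt (A + 1)"
    have "0 \<le> ?M" using S R A by auto
    hence "?M powr (p - 2) = (?M\<^sup>2) powr q" by (simp only: square_powr q2)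
    also have "?M\<^sup>2 = (S\<^sup>2 * (A + 1)) * R" using R A by (simp add: power_mult_distrib)
    also have "\<dots> powr q = (S\<^sup>2 * (A + 1)) powr q * R powr q" using R A by (simp add: powr_mult)
    also have "R powr q = ?K powr s" unfolding R_def powr_powr s_def by simp
    finally have Mp: "?M powr (p - 2) = (S\<^sup>2 * (A + 1)) powr q * ?K powr s" .
    have "2 / p * pot p u \<le> 2 / p * (?M powr (p - 2) * charge u)"
      using pot_integrable(2)[OF p(1) sobolev_L2[OF u] bd] p by (intro mult_left_mono) auto
    also have "\<dots> \<le> 2 / p * (?M powr (p - 2) * A)" using cA p by (intro mult_left_mono) auto
    also have "\<dots> = D1 * ?K powr s" unfolding Mp D1_def by simp
    also have "\<dots> \<le> ?K / 4 + D2" by (rule absorb) (use K in simp)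
    finally have "2 / p * pot p u \<le> ?K / 4 + D2" .
    moreover have "k \<le> 4 * (k / 2 - X) + (1 + 4 * D)" if "X \<le> (1 + k) / 4 + D" for X k D :: real
      using that by (simp add: field_simps)
    ultimately show ?thesis unfolding energy_eq[OF m p(1) u] by blast
  qed
  thus thesis using that by blast
qed

lemma test_fun_dilate:
  assumes t: "test_fun \<phi>" and l: "l > 0"
  shows "(deriv_x ^^ n) (\<lambda>x. \<phi> (l * x)) = (\<lambda>x. complex_of_real (l ^ n) * (deriv_x ^^ n) \<phi> (l * x))"
    "test_fun (\<lambda>x. \<phi> (l * x))"
proof -
  have d: "((\<lambda>x. complex_of_real (l ^ n) * (deriv_x ^^ n) \<phi> (l * x)) has_vector_derivative
      complex_of_real (l ^ Suc n) * (deriv_x ^^ Suc n) \<phi> (l * x)) (at x)" for n x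
  proof -
    have "((\<lambda>x. (deriv_x ^^ n) \<phi> (l * x)) has_vector_derivative (l *\<^sub>R (deriv_x ^^ Suc n) \<phi> (l * x))) (at x)"
    proof -
      have "((\<lambda>x. l * x) has_vector_derivative l) (at x)"
        unfolding has_real_derivative_iff_has_vector_derivative[symmetric]
        by (auto intro!: derivative_eq_intros)
      from vector_diff_chain_at[OF this test_fun_has_derivative[OF t]] show ?thesis by (simp add: o_def)
    qed
    from has_vector_derivative_mult_right[OF this, of "complex_of_real (l ^ n)"] show ?thesis
      by (simp add: scaleR_conv_of_real mult_ac)
  qed
  show eq: "(deriv_x ^^ n) (\<lambda>x. \<phi> (l * x)) = (\<lambda>x. complex_of_real (l ^ n) * (deriv_x ^^ n) \<phi> (l * x))" for n
  proof (induction n)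
    case (Suc n)
    show ?case using deriv_x_eqI[OF d, of n] Suc by simp
  qed simp
  obtain R where R: "\<And>x. \<bar>x\<bar> > R \<Longrightarrow> \<phi> x = 0" using test_fun_support[OF t] by (metis funpow_0)
  show "test_fun (\<lambda>x. \<phi> (l * x))" unfolding test_fun_def eq
  proof (intro conjI allI exI[of _ "{- (R / l)..R / l}"] impI)
    show "(\<lambda>x. complex_of_real (l ^ n) * (deriv_x ^^ n) \<phi> (l * x)) differentiable at x" for n x
      using d[of n x] differentiableI_vector by blast
    fix x assume "x \<notin> {- (R / l)..R / l}"
    hence "\<bar>l * x\<bar> > R" using l by (auto simp: abs_mult field_simps abs_if split: if_splits)
    thus "\<phi> (l * x) = 0" by (rule R)
  qed simp
qed

lemma pot_pos:
  assumes "1 \<le> m" "2 < p" "u \<in> sobolev m" "0 < charge u" shows "0 < pot p u"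
proof -
  have [measurable]: "u \<in> borel_measurable borel" using assms sobolev_L2 L2_measurable by blast
  have "pot p u \<noteq> 0"
  proof
    assume "pot p u = 0"
    hence "AE x in lborel. cmod (u x) powr p = 0"
      using integral_nonneg_eq_0_iff_AE[OF sobolev_pot_integrable[OF assms(1-3)]] unfolding pot_def by simp
    hence "AE x in lborel. u x = 0" by (auto elim!: eventually_mono)
    hence "charge u = 0" using charge_eq_0_iff sobolev_L2[OF assms(3)] by blast
    thus False using assms(4) by simp
  qed
  thus ?thesis using pot_nonneg[of p u] by simp
qed

text \<open>
  Dilating a bump by $L$ at fixed charge multiplies its kinetic energy by $L^{-2m}$ and its
  potential energy by $L^{-(p-2)/2}$. The second exponent is the smaller one in absolute value, so the
  potential energy wins for large $L$.
\<close>

lemma negative_energy_exists: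
  assumes m: "1 \<le> m" and p: "2 < p" "p < 4 * real m + 2" and c: "0 < c"
  obtains u where "u \<in> sobolev m" "charge u = c" "energy m p u < 0"
proof -
  let ?g = "bump 1 0 1"
  have tg: "test_fun ?g" by (rule bump_test_fun) simp
  have g: "?g \<in> sobolev m" "?g \<in> L2" using test_fun_sobolev[OF tg] sobolev_L2 by auto
  have "charge ?g \<noteq> 0"
  proof
    assume "charge ?g = 0"
    hence "AE x in lborel. ?g x = 0" using charge_eq_0_iff[OF g(2)] by simp
    hence "AE x in lborel. x \<notin> {0<..<1::real}"
      by eventually_elim (auto simp: bump_def flat_def)
    hence "emeasure lborel {0<..<1::real} = 0" by (subst (asm) AE_iff_measurable[of "{0<..<1::real}"]) auto
    thus False by simp
  qed
  hence a: "0 < charge ?g" using charge_nonneg[of ?g] by simp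
  define q where "q = (p - 2) / 2"
  have q: "0 < q" "q < 2 * real m" using p by (auto simp: q_def)
  have q2: "2 * q = p - 2" by (simp add: q_def)
  define V where "V = 2 / p * pot p ?g"
  have V: "0 < V" using pot_pos[OF m p(1) g(1) a] p by (simp add: V_def)
  define B where "B = (c / charge ?g) powr q * V"
  have B: "0 < B" using c a V by (simp add: B_def)
  define K where "K = kin m ?g"
  have K: "0 \<le> K" by (simp add: K_def kin_nonneg)
  \<comment> \<open>the energy of the dilated bump is negative as soon as $L^{2m-q} > K/(2B)$\<close>
  define L where "L = (K / (2 * B) + 1) powr (1 / (2 * real m - q))"
  have L0: "0 < K / (2 * B) + 1" using K B by (simp add: add_nonneg_pos)
  have L: "0 < L" unfolding L_def using L0 by simp
  have Lp: "L powr (2 * real m - q) = K / (2 * B) + 1" unfolding L_def powr_powr using q L0 by simp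
  define v where "v x = ?g ((1 / L) * x)" for x
  have tv: "test_fun v" unfolding v_def[abs_def] by (rule test_fun_dilate[OF tg]) (use L in simp)
  have v: "v \<in> sobolev m" "v \<in> L2" using test_fun_sobolev[OF tv] sobolev_L2 by auto
  have cv: "charge v = L * charge ?g" using charge_affine[of "1 / L" ?g 0] L by (simp add: v_def[abs_def])
  have pv: "pot p v = L * pot p ?g" using pot_affine[of "1 / L" p ?g 0] L by (simp add: v_def[abs_def])
  have kv: "kin m v = L * (1 / L) ^ (2 * m) * K"
  proof -
    have "kin m v = charge (\<lambda>x. complex_of_real ((1 / L) ^ m) * (deriv_x ^^ m) ?g ((1 / L) * x))"
      unfolding test_fun_wfourier(2)[OF tv] unfolding v_def[abs_def]
      by (subst test_fun_dilate(1)[OF tg]) (use L in auto)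
    also have "\<dots> = ((1 / L) ^ m)\<^sup>2 * charge (\<lambda>x. (deriv_x ^^ m) ?g (0 + (1 / L) * x))"
      unfolding charge_cmult norm_of_real using L by simp
    also have "charge (\<lambda>x. (deriv_x ^^ m) ?g (0 + (1 / L) * x)) = L * K"
      unfolding K_def test_fun_wfourier(2)[OF tg] by (subst charge_affine) (use L in auto)
    finally show ?thesis by (simp add: power_mult[symmetric] mult_ac)
  qed
  define k where "k = sqrt (c / (L * charge ?g))"
  have k: "0 < k" "k\<^sup>2 = c / (L * charge ?g)" using c L a by (auto simp: k_def)
  let ?u = "\<lambda>x. complex_of_real k * v x"
  have u: "?u \<in> sobolev m" by (rule sobolev_cmult[OF v(1)])
  have cu: "charge ?u = c" unfolding charge_cmult cv using k L a by simp
  have kp: "k powr p = k\<^sup>2 * ((c / charge ?g) powr q * L powr (- q))"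
  proof -
    have "k powr p = k powr (p - 2) * k\<^sup>2" by (rule powr_split) (use k p in auto)
    also have "k powr (p - 2) = (k\<^sup>2) powr q"
      using k(1) by (simp only: square_powr[OF less_imp_le] q2)
    also have "(k\<^sup>2) powr q = (c / charge ?g) powr q * L powr (- q)"
    proof -
      have "k\<^sup>2 = (c / charge ?g) * L powr (- 1)" unfolding k(2) using L by (simp add: powr_minus_divide)
      also have "\<dots> powr q = (c / charge ?g) powr q * (L powr (- 1)) powr q" using c a by (simp add: powr_mult powr_divide)
      also have "(L powr (- 1)) powr q = L powr (- q)" unfolding powr_powr by simp
      finally show ?thesis .
    qed
    finally show ?thesis by simp
  qed
  have Lm: "(1 / L) ^ (2 * m) = L powr (- (2 * real m))"
    using L by (simp add: powr_minus_divide powr_realpow[symmetric] power_one_over)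
  have "energy m p ?u = k\<^sup>2 * kin m v / 2 - 2 / p * (k powr p * pot p v)"
    unfolding energy_eq[OF m p(1) u] using k(1) by (simp add: kin_cmult[OF v(2)] pot_cmult)
  also have "\<dots> = k\<^sup>2 * L * (L powr (- (2 * real m)) * K / 2 - L powr (- q) * B)"
    unfolding kv pv kp Lm B_def V_def by (simp add: algebra_simps)
  also have "\<dots> < 0"
  proof -
    have "K / 2 < (K / (2 * B) + 1) * B" using B by (simp add: field_simps)
    also have "\<dots> = L powr (2 * real m - q) * B" unfolding Lp ..
    finally have "L powr (- (2 * real m)) * (K / 2) < L powr (- (2 * real m)) * (L powr (2 * real m - q) * B)"
      using L by (intro mult_strict_left_mono) auto
    also have "\<dots> = L powr (- q) * B" using L by (simp add: mult.assoc[symmetric] powr_add[symmetric])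
    finally have "L powr (- (2 * real m)) * K / 2 - L powr (- q) * B < 0" by simp
    moreover have "0 < k\<^sup>2 * L" using k(1) L by simp
    ultimately show ?thesis by (simp add: mult_pos_neg)
  qed
  finally show thesis using that u cu by blast
qed

section \<open>Splitting along a pointwise limit\<close>

lemma modulus_0: "modulus m 0 = 0"
  by (simp add: modulus_def l2n_def charge_def)

lemma modulus_small:
  assumes "1 \<le> m" "0 < e" obtains d where "0 < d" "\<And>h. \<bar>h\<bar> < d \<Longrightarrow> modulus m h < e"
proof -
  obtain d where d: "0 < d" "\<And>h. h \<noteq> 0 \<Longrightarrow> \<bar>h\<bar> < d \<Longrightarrow> \<bar>modulus m h\<bar> < e"
    using LIM_D[OF modulus_tendsto[OF assms(1)] assms(2)] by auto
  have "modulus m h < e" if "\<bar>h\<bar> < d" for h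
    using d(2)[of h] that assms(2) modulus_0 by (cases "h = 0") (simp, fastforce)
  with d(1) that show thesis by blast
qed

text \<open>
  A diagonal sequence converges at all rational points; the common modulus of continuity extends
  this to all points.
\<close>

lemma cont_rep_pointwise_convergent_subsequence:
  assumes m: "1 \<le> m" and v: "\<And>n. v n \<in> sobolev m" "\<And>n. charge (v n) + kin m (v n) \<le> A"
  obtains r g where "strict_mono (r :: nat \<Rightarrow> nat)" "\<And>x. (\<lambda>k. cont_rep (v (r k)) x) \<longlonglongrightarrow> g x"
proof -
  have "countable (\<rat> :: real set)" by (rule countable_rat)
  then obtain r where r: "strict_mono (r :: nat \<Rightarrow> nat)" "\<And>x. x \<in> \<rat> \<Longrightarrow> \<exists>l. (\<lambda>k. cont_rep (v (r k)) x) \<longlonglongrightarrow> l"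
    using function_convergent_subsequence[of "\<rat>" "\<lambda>n. cont_rep (v n)" "l2n (inv_weight m) * sqrt A"] cont_rep_bound1[OF m v] by metis
  have A: "0 \<le> A" using v(2)[of 0] charge_nonneg[of "v 0"] kin_nonneg[of m "v 0"] by linarith
  have "convergent (\<lambda>k. cont_rep (v (r k)) x)" for x
    unfolding convergent_eq_Cauchy[symmetric] convergent_def
  proof (rule metric_CauchyI[THEN Cauchy_convergent[unfolded convergent_def]])
    fix e :: real assume e: "0 < e"
    have "0 < sqrt A + 1" using A by (simp add: add_nonneg_pos)
    hence "0 < e / (3 * (sqrt A + 1))" using e by (intro divide_pos_pos mult_pos_pos) auto
    then obtain d where d: "0 < d" "\<And>h. \<bar>h\<bar> < d \<Longrightarrow> modulus m h < e / (3 * (sqrt A + 1))"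
      using modulus_small[OF m] by metis
    obtain q where q: "q \<in> \<rat>" "\<bar>x - q\<bar> < d"
      using Rats_dense_in_real[of "x - d" "x + d"] d(1) by (metis abs_diff_less_iff less_add_same_cancel1 less_trans diff_less_eq abs_minus_commute)
    have close: "cmod (cont_rep (v n) x - cont_rep (v n) q) < e / 3" for n
    proof -
      have "cmod (cont_rep (v n) x - cont_rep (v n) q) \<le> modulus m (x - q) * sqrt A" by (rule cont_rep_equicontinuous[OF m v])
      also have "\<dots> \<le> e / (3 * (sqrt A + 1)) * sqrt A" using d(2)[OF q(2)] A by (intro mult_right_mono) auto
      also have "\<dots> < e / 3"
      proof -
        have "sqrt A / (sqrt A + 1) < 1" using A by (simp add: divide_less_eq add_nonneg_pos)
        hence "e / 3 * (sqrt A / (sqrt A + 1)) < e / 3 * 1" using e by (intro mult_strict_left_mono) auto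
        thus ?thesis by (simp add: field_simps)
      qed
      finally show ?thesis .
    qed
    obtain l where "(\<lambda>k. cont_rep (v (r k)) q) \<longlonglongrightarrow> l" using r(2)[OF q(1)] by blast
    hence "Cauchy (\<lambda>k. cont_rep (v (r k)) q)" by (rule LIMSEQ_imp_Cauchy)
    then obtain N where N: "\<And>j k. j \<ge> N \<Longrightarrow> k \<ge> N \<Longrightarrow> dist (cont_rep (v (r j)) q) (cont_rep (v (r k)) q) < e / 3"
      using e metric_CauchyD[of _ "e / 3"] by (metis zero_less_divide_iff zero_less_numeral)
    have "dist (cont_rep (v (r j)) x) (cont_rep (v (r k)) x) < e" if "j \<ge> N" "k \<ge> N" for j k
    proof -
      let ?a = "cont_rep (v (r j))" and ?b = "cont_rep (v (r k))"
      have "dist (?a x) (?b x) \<le> dist (?a x) (?a q) + dist (?a q) (?b q) + dist (?b q) (?b x)"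
        by (meson add_right_mono dist_triangle order_trans)
      thus ?thesis using close[of "r j"] close[of "r k"] N[OF that] by (simp add: dist_norm norm_minus_commute)
    qed
    thus "\<exists>N. \<forall>j\<ge>N. \<forall>k\<ge>N. dist (cont_rep (v (r j)) x) (cont_rep (v (r k)) x) < e" by blast
  qed
  hence "(\<lambda>k. cont_rep (v (r k)) x) \<longlonglongrightarrow> lim (\<lambda>k. cont_rep (v (r k)) x)" for x
    by (simp add: convergent_LIMSEQ_iff)
  thus thesis by (rule that[OF r(1)])
qed

lemma l2n_le: "charge f \<le> A \<Longrightarrow> l2n f \<le> sqrt A"
  by (simp add: l2n_def)

text \<open>
  The Cauchy-Schwarz inequality makes the contribution of the tail of $f$ small uniformly in $n$.
\<close>

lemma weakly_null_of_truncations: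
  assumes g: "\<And>n. g n \<in> L2" "\<And>n. charge (g n) \<le> A"
    and lim: "\<And>R. (\<lambda>n. LINT x|lborel. g n x * trunc R f x) \<longlonglongrightarrow> 0" and f: "f \<in> L2"
  shows "(\<lambda>n. LINT x|lborel. g n x * f x) \<longlonglongrightarrow> 0"
proof (rule LIMSEQ_I)
  fix e :: real assume e: "0 < e"
  have A: "0 \<le> A" using g(2)[of 0] charge_nonneg[of "g 0"] by linarith
  have "0 < sqrt A + 1" using A by (simp add: add_nonneg_pos)
  hence "0 < e / (2 * (sqrt A + 1))" using e by (intro divide_pos_pos mult_pos_pos) auto
  from LIMSEQ_D[OF l2_conv_trunc[OF f, unfolded l2_conv_def] this] obtain R :: nat
    where R: "l2n (\<lambda>x. trunc (real R) f x - f x) < e / (2 * (sqrt A + 1))"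
    using l2n_nonneg by fastforce
  from LIMSEQ_D[OF lim[of "real R"], of "e / 2"] e obtain N
    where N: "\<And>n. n \<ge> N \<Longrightarrow> cmod (LINT x|lborel. g n x * trunc (real R) f x) < e / 2" by auto
  have "norm ((LINT x|lborel. g n x * f x) - 0) < e" if n: "n \<ge> N" for n
  proof -
    let ?t = "\<lambda>x. f x - trunc (real R) f x"
    have t: "?t \<in> L2" by (intro L2_diff trunc_L2 f)
    have "(LINT x|lborel. g n x * f x) = (LINT x|lborel. g n x * trunc (real R) f x + g n x * ?t x)"
      by (simp add: algebra_simps)
    also have "\<dots> = (LINT x|lborel. g n x * trunc (real R) f x) + (LINT x|lborel. g n x * ?t x)"
      by (intro Bochner_Integration.integral_add L2_mult_integrable g t trunc_L2 f)
    finally have "cmod (LINT x|lborel. g n x * f x) \<le> cmod (LINT x|lborel. g n x * trunc (real R) f x) + cmod (LINT x|lborel. g n x * ?t x)"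
      by (simp only: norm_triangle_ineq)
    moreover have "cmod (LINT x|lborel. g n x * ?t x) \<le> l2n (g n) * l2n ?t"
      by (rule L2_Cauchy_Schwarz[OF g(1) t])
    moreover have "l2n (g n) * l2n ?t \<le> sqrt A * (e / (2 * (sqrt A + 1)))"
      using R l2n_minus_commute[of f "trunc (real R) f"] l2n_le[OF g(2)] A l2n_nonneg by (intro mult_mono) auto
    moreover have "sqrt A * (e / (2 * (sqrt A + 1))) \<le> e / 2"
    proof -
      have "sqrt A / (sqrt A + 1) \<le> 1" using A by (simp add: divide_le_eq add_nonneg_pos)
      hence "e / 2 * (sqrt A / (sqrt A + 1)) \<le> e / 2 * 1" using e by (intro mult_left_mono) auto
      thus ?thesis by (simp add: field_simps)
    qed
    ultimately show ?thesis using N[OF n] unfolding diff_zero by linarith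
  qed
  thus "\<exists>N. \<forall>n\<ge>N. norm ((LINT x|lborel. g n x * f x) - 0) < e" by blast
qed

lemma pointwise_null_integral:
  assumes d: "\<And>n. d n \<in> L2" "\<And>n. charge (d n) \<le> A" "\<And>n x. cmod (d n x) \<le> M"
    and lim: "\<And>x. (\<lambda>n. d n x) \<longlonglongrightarrow> 0" and f: "f \<in> L2"
  shows "(\<lambda>n. LINT x|lborel. cmod (d n x * f x)) \<longlonglongrightarrow> 0"
proof -
  have [measurable]: "\<And>n. d n \<in> borel_measurable borel" "f \<in> borel_measurable borel" using d f L2_measurable by auto
  let ?d = "\<lambda>n x. complex_of_real (cmod (d n x))" and ?f = "\<lambda>x. complex_of_real (cmod (f x))"
  have cd: "charge (?d n) \<le> A" for n using d(2)[of n] by (simp add: charge_def)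
  have "(\<lambda>n. LINT x|lborel. ?d n x * ?f x) \<longlonglongrightarrow> 0"
  proof (rule weakly_null_of_truncations[where g = ?d, OF L2_cmod[OF d(1)] cd _ L2_cmod[OF f]])
    fix R
    have "(\<lambda>n. LINT x|lborel. ?d n x * trunc R ?f x) \<longlonglongrightarrow> (LINT x::real|lborel. 0)"
    proof (rule integral_dominated_convergence)
      show "integrable lborel (\<lambda>x. M * cmod (trunc R ?f x))"
        by (intro integrable_mult_right integrable_norm trunc_integrable L2_cmod f)
      show "AE x in lborel. (\<lambda>n. ?d n x * trunc R ?f x) \<longlonglongrightarrow> 0"
      proof (rule AE_I2)
        fix x
        have "(\<lambda>n. ?d n x) \<longlonglongrightarrow> complex_of_real 0" by (intro tendsto_of_real tendsto_norm_zero lim)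
        hence "(\<lambda>n. ?d n x) \<longlonglongrightarrow> 0" by simp
        thus "(\<lambda>n. ?d n x * trunc R ?f x) \<longlonglongrightarrow> 0" by (rule tendsto_mult_left_zero)
      qed
      show "AE x in lborel. norm (?d n x * trunc R ?f x) \<le> M * cmod (trunc R ?f x)" for n
        using d(3) by (auto simp: norm_mult intro!: mult_right_mono)
    qed (auto simp: trunc_def)
    thus "(\<lambda>n. LINT x|lborel. ?d n x * trunc R ?f x) \<longlonglongrightarrow> 0" by simp
  qed
  hence "(\<lambda>n. Re (LINT x|lborel. complex_of_real (cmod (d n x * f x)))) \<longlonglongrightarrow> Re 0"
    by (intro tendsto_Re) (simp add: norm_mult)
  thus ?thesis by simp
qed

lemma wfourier_mult_trunc: "wfourier m u \<xi> * trunc R f \<xi> = fourier u \<xi> * (complex_of_real (\<bar>\<xi>\<bar> ^ m) * trunc R f \<xi>)"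
  by (simp add: wfourier_def mult_ac)

lemma weighted_trunc_L2:
  assumes "f \<in> L2" shows "(\<lambda>\<xi>. complex_of_real (\<bar>\<xi>\<bar> ^ m) * trunc R f \<xi>) \<in> L2"
proof -
  have [measurable]: "f \<in> borel_measurable borel" using assms L2_measurable by auto
  show ?thesis
  proof (rule L2_dominated[OF assms, where B = "\<bar>R\<bar> ^ m"])
    show "AE \<xi> in lborel. cmod (complex_of_real (\<bar>\<xi>\<bar> ^ m) * trunc R f \<xi>) \<le> \<bar>R\<bar> ^ m * cmod (f \<xi>)"
    proof (rule AE_I2)
      fix \<xi>
      have "\<bar>\<xi>\<bar> ^ m \<le> \<bar>R\<bar> ^ m" if "\<xi> \<in> {-R..R}" using that by (intro power_mono) auto
      thus "cmod (complex_of_real (\<bar>\<xi>\<bar> ^ m) * trunc R f \<xi>) \<le> \<bar>R\<bar> ^ m * cmod (f \<xi>)"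
        by (auto simp: trunc_def norm_mult norm_power indicator_def intro!: mult_right_mono)
    qed
  qed (simp add: trunc_def)
qed

text \<open>
  The remainders $d_n = f_n - g$ tend to zero pointwise under a uniform bound, hence weakly in
  $L^2$, and by the multiplication formula so do their transforms. The error terms are pairings of
  $d_n$ with $g$ for the charge and the potential energy, and pairings of $|\xi|^m \hat d_n$ with
  $|\xi|^m \hat g$ for the kinetic part. That $|\xi|^m \hat g$ is in $L^2$ follows from weak
  convergence as well, by testing with its own truncations.
\<close>

lemma pointwise_limit_splitting:
  assumes m: "1 \<le> m" and p: "2 < p"
    and f: "\<And>n. f n \<in> sobolev m" "\<And>n. charge (f n) + kin m (f n) \<le> A" "\<And>n x. cmod (f n x) \<le> M"
    and lim: "\<And>x. (\<lambda>n. f n x) \<longlonglongrightarrow> g x"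
  shows "g \<in> sobolev m"
    "(\<lambda>n. charge (f n) - charge (\<lambda>x. f n x - g x)) \<longlonglongrightarrow> charge g"
    "(\<lambda>n. kin m (f n) - kin m (\<lambda>x. f n x - g x)) \<longlonglongrightarrow> kin m g"
    "(\<lambda>n. pot p (f n) - pot p (\<lambda>x. f n x - g x)) \<longlonglongrightarrow> pot p g"
proof -
  have fL: "f n \<in> L2" for n using sobolev_L2[OF f(1)] .
  have [measurable]: "f n \<in> borel_measurable borel" for n using fL L2_measurable by auto
  have gm: "g \<in> borel_measurable borel" by (rule borel_measurable_LIMSEQ_metric[OF _ lim]) simp
  have cA: "charge (f n) \<le> A" "kin m (f n) \<le> A" for n
    using f(2)[of n] charge_nonneg[of "f n"] kin_nonneg[of m "f n"] by linarith+
  have A: "0 \<le> A" using cA(1)[of 0] charge_nonneg[of "f 0"] by linarith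
  have g: "g \<in> L2" "charge g \<le> A"
    by (rule L2_Fatou[OF fL gm AE_I2[OF lim]]; use cA A in auto)+
  have gM: "cmod (g x) \<le> M" for x
    by (rule LIMSEQ_le_const2[OF tendsto_norm[OF lim[of x]]]) (use f(3) in auto)
  define d where "d n x = f n x - g x" for n x
  have dL: "d n \<in> L2" for n unfolding d_def[abs_def] by (intro L2_diff fL g)
  have dc: "charge (d n) \<le> (2 * sqrt A)\<^sup>2" for n
  proof -
    have "l2n (d n) \<le> l2n (f n) + l2n g"
      using l2n_diff_triangle[OF fL L2_zero g(1)] l2n_minus_commute[of "\<lambda>x. 0" g] by (simp add: d_def[abs_def])
    also have "\<dots> \<le> 2 * sqrt A" using l2n_le[OF cA(1)[of n]] l2n_le[OF g(2)] by linarith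
    finally have "(l2n (d n))\<^sup>2 \<le> (2 * sqrt A)\<^sup>2" by (intro power_mono l2n_nonneg)
    thus ?thesis by (simp add: l2n_sq)
  qed
  have dM: "cmod (d n x) \<le> 2 * M" for n x
    using norm_triangle_ineq4[of "f n x" "g x"] f(3)[of n x] gM[of x] by (simp add: d_def)
  have dlim: "(\<lambda>n. d n x) \<longlonglongrightarrow> 0" for x using LIM_zero[OF lim] by (simp add: d_def)
  note null = pointwise_null_integral[OF dL dc dM dlim]
  have null': "(\<lambda>n. LINT x|lborel. d n x * h x) \<longlonglongrightarrow> 0" if "h \<in> L2" for h
    by (rule Lim_null_comparison[OF _ null[OF that]]) (auto intro!: always_eventually integral_norm_bound)
  \<comment> \<open>the transform moves to the test function, so weak convergence passes to the Fourier side\<close>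
  have fweak: "(\<lambda>n. LINT \<xi>|lborel. fourier (d n) \<xi> * h \<xi>) \<longlonglongrightarrow> 0" if "h \<in> L2" for h
    using null'[OF fourier_L2[OF that]] fourier_multiplication_formula[OF dL that] by simp
  have fd: "AE \<xi> in lborel. fourier (d n) \<xi> = fourier (f n) \<xi> - fourier g \<xi>" for n
    unfolding d_def[abs_def] by (rule fourier_diff[OF fL g(1)])
  have fweak2: "(\<lambda>n. LINT \<xi>|lborel. fourier (f n) \<xi> * h \<xi>) \<longlonglongrightarrow> (LINT \<xi>|lborel. fourier g \<xi> * h \<xi>)" if h: "h \<in> L2" for h
  proof -
    have [measurable]: "fourier (f n) \<in> borel_measurable borel" "fourier (d n) \<in> borel_measurable borel"
      "fourier g \<in> borel_measurable borel" "h \<in> borel_measurable borel" for n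
      using h fL dL g fourier_L2 L2_measurable by auto
    have "(LINT \<xi>|lborel. fourier (d n) \<xi> * h \<xi>) = (LINT \<xi>|lborel. fourier (f n) \<xi> * h \<xi> - fourier g \<xi> * h \<xi>)" for n
      by (intro integral_cong_AE) (use fd[of n] in \<open>auto elim!: eventually_mono simp: left_diff_distrib\<close>)
    also have "\<dots> n = (LINT \<xi>|lborel. fourier (f n) \<xi> * h \<xi>) - (LINT \<xi>|lborel. fourier g \<xi> * h \<xi>)" for n
      by (intro Bochner_Integration.integral_diff L2_mult_integrable fourier_L2 fL g h)
    finally have "(\<lambda>n. (LINT \<xi>|lborel. fourier (f n) \<xi> * h \<xi>) - (LINT \<xi>|lborel. fourier g \<xi> * h \<xi>)) \<longlonglongrightarrow> 0"
      using fweak[OF h] by simp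
    thus ?thesis by (rule LIM_zero_cancel)
  qed
  have hgm: "wfourier m g \<in> borel_measurable borel" by (rule wfourier_measurable[OF g(1)])
  have tr: "trunc R (wfourier m g) = (\<lambda>\<xi>. complex_of_real (\<bar>\<xi>\<bar> ^ m) * trunc R (fourier g) \<xi>)" for R
    by (auto simp: trunc_def wfourier_def)
  have trL: "trunc R (wfourier m g) \<in> L2" for R
    unfolding tr by (rule weighted_trunc_L2[OF fourier_L2[OF g(1)]])
  have trc: "charge (trunc R (wfourier m g)) \<le> A" for R
  proof -
    \<comment> \<open>paired with $\hat g$ this gives the charge of the truncation, and paired with $\hat f_n$ it is bounded by its norm\<close>
    let ?h = "\<lambda>\<xi>. complex_of_real (\<bar>\<xi>\<bar> ^ m) * trunc R (\<lambda>\<xi>. cnj (wfourier m g \<xi>)) \<xi>"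
    have heq: "?h = (\<lambda>\<xi>. complex_of_real (\<bar>\<xi>\<bar> ^ m) * trunc R (\<lambda>\<xi>. cnj (trunc R (wfourier m g) \<xi>)) \<xi>)"
      by (auto simp: trunc_def indicator_def)
    have hL: "?h \<in> L2" unfolding heq by (intro weighted_trunc_L2 L2_cnj trL)
    have eq1: "fourier u \<xi> * ?h \<xi> = wfourier m u \<xi> * cnj (trunc R (wfourier m g) \<xi>)" for u \<xi>
      by (simp add: wfourier_def trunc_def indicator_def mult_ac)
    have "(\<lambda>n. cmod (LINT \<xi>|lborel. fourier (f n) \<xi> * ?h \<xi>)) \<longlonglongrightarrow> cmod (LINT \<xi>|lborel. fourier g \<xi> * ?h \<xi>)"
      by (intro tendsto_norm fweak2 hL)
    moreover have "cmod (LINT \<xi>|lborel. fourier (f n) \<xi> * ?h \<xi>) \<le> sqrt A * l2n (trunc R (wfourier m g))" for n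
    proof -
      have "cmod (LINT \<xi>|lborel. fourier (f n) \<xi> * ?h \<xi>) \<le> l2n (wfourier m (f n)) * l2n (\<lambda>\<xi>. cnj (trunc R (wfourier m g) \<xi>))"
        unfolding eq1 by (intro L2_Cauchy_Schwarz L2_cnj trL sobolev_wfourier f)
      also have "\<dots> \<le> sqrt A * l2n (trunc R (wfourier m g))"
        using cA(2)[of n] by (intro mult_mono l2n_le) (auto simp: kin_def l2n_def charge_cnj charge_nonneg A)
      finally show ?thesis .
    qed
    ultimately have "cmod (LINT \<xi>|lborel. fourier g \<xi> * ?h \<xi>) \<le> sqrt A * l2n (trunc R (wfourier m g))"
      by (intro LIMSEQ_le_const2[of _ "cmod (LINT \<xi>|lborel. fourier g \<xi> * ?h \<xi>)"]) auto
    also have "(LINT \<xi>|lborel. fourier g \<xi> * ?h \<xi>) = complex_of_real (charge (trunc R (wfourier m g)))"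
      unfolding eq1 complex_charge
      by (intro Bochner_Integration.integral_cong refl) (simp add: trunc_def indicator_def)
    finally have "(l2n (trunc R (wfourier m g)))\<^sup>2 \<le> sqrt A * l2n (trunc R (wfourier m g))"
      by (simp add: l2n_sq charge_nonneg)
    hence "l2n (trunc R (wfourier m g)) \<le> sqrt A"
      using l2n_nonneg[of "trunc R (wfourier m g)"] A by (cases "l2n (trunc R (wfourier m g)) = 0") (auto simp: power2_eq_square)
    thus ?thesis using A by (simp add: l2n_def)
  qed
  have "wfourier m g \<in> L2"
  proof (rule L2_Fatou(1)[of "\<lambda>n. trunc (real n) (wfourier m g)"])
    show "AE \<xi> in lborel. (\<lambda>n. trunc (real n) (wfourier m g) \<xi>) \<longlonglongrightarrow> wfourier m g \<xi>"
    proof (rule AE_I2, rule tendsto_eventually)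
      fix \<xi> :: real
      obtain N :: nat where "\<bar>\<xi>\<bar> \<le> real N" using real_arch_simple[of "\<bar>\<xi>\<bar>"] by blast
      thus "\<forall>\<^sub>F n in sequentially. trunc (real n) (wfourier m g) \<xi> = wfourier m g \<xi>"
        by (intro eventually_sequentiallyI[of N]) (auto simp: trunc_def indicator_def abs_le_iff)
    qed
    show "\<forall>\<^sub>F n in sequentially. charge (trunc (real n) (wfourier m g)) \<le> A" using trc by simp
  qed (use trL hgm A in auto)
  thus gS: "g \<in> sobolev m" using g by (simp add: sobolev_iff)
  have dS: "d n \<in> sobolev m" for n unfolding d_def[abs_def] by (intro sobolev_diff f gS)
  have fdg: "f n = (\<lambda>x. d n x + g x)" for n by (auto simp: d_def)
  have dfold: "(\<lambda>x. f n x - g x) = d n" for n by (auto simp: d_def)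
  have Re0: "(\<lambda>n. 2 * Re (z n)) \<longlonglongrightarrow> 0" if "z \<longlonglongrightarrow> 0" for z :: "nat \<Rightarrow> complex"
    using tendsto_mult_left[OF tendsto_Re[OF that], of 2] by simp
  show "(\<lambda>n. charge (f n) - charge (\<lambda>x. f n x - g x)) \<longlonglongrightarrow> charge g"
  proof -
    have "charge (f n) - charge (d n) = charge g + 2 * Re (LINT x|lborel. d n x * cnj (g x))" for n
      unfolding fdg using charge_add[OF dL g(1)] by simp
    moreover have "(\<lambda>n. charge g + 2 * Re (LINT x|lborel. d n x * cnj (g x))) \<longlonglongrightarrow> charge g + 0"
      by (intro tendsto_intros Re0 null' L2_cnj g)
    ultimately show ?thesis unfolding dfold by simp
  qed
  have kd: "charge (wfourier m (d n)) \<le> (sqrt A + l2n (wfourier m g))\<^sup>2" for n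
  proof -
    have "sqrt (kin m (d n)) = l2n (\<lambda>\<xi>. wfourier m (f n) \<xi> - wfourier m g \<xi>)"
      using l2n_wfourier_diff[OF f(1) gS, of n] by (simp add: dfold)
    also have "\<dots> \<le> l2n (wfourier m (f n)) + l2n (wfourier m g)"
      using l2n_diff_triangle[OF sobolev_wfourier[OF f(1)] L2_zero sobolev_wfourier[OF gS]] l2n_minus_commute[of "\<lambda>x. 0" "wfourier m g"] by simp
    also have "\<dots> \<le> sqrt A + l2n (wfourier m g)" using l2n_le[of "wfourier m (f n)" A] cA(2)[of n] by (simp add: kin_def)
    finally have "(sqrt (kin m (d n)))\<^sup>2 \<le> (sqrt A + l2n (wfourier m g))\<^sup>2" by (intro power_mono) (auto simp: kin_nonneg)
    thus ?thesis by (simp add: kin_nonneg kin_def charge_nonneg)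
  qed
  have kweak: "(\<lambda>n. LINT \<xi>|lborel. wfourier m (d n) \<xi> * cnj (wfourier m g \<xi>)) \<longlonglongrightarrow> 0"
  proof (rule weakly_null_of_truncations[OF sobolev_wfourier[OF dS] kd])
    show "(\<lambda>\<xi>. cnj (wfourier m g \<xi>)) \<in> L2" by (intro L2_cnj sobolev_wfourier gS)
    show "(\<lambda>n. LINT \<xi>|lborel. wfourier m (d n) \<xi> * trunc R (\<lambda>\<xi>. cnj (wfourier m g \<xi>)) \<xi>) \<longlonglongrightarrow> 0" for R
      unfolding wfourier_mult_trunc by (intro fweak weighted_trunc_L2 L2_cnj sobolev_wfourier gS)
  qed
  show "(\<lambda>n. kin m (f n) - kin m (\<lambda>x. f n x - g x)) \<longlonglongrightarrow> kin m g"
  proof -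
    have "kin m (f n) - kin m (d n) = kin m g + 2 * Re (LINT \<xi>|lborel. wfourier m (d n) \<xi> * cnj (wfourier m g \<xi>))" for n
      unfolding fdg using kin_add[OF dS gS] by simp
    moreover have "(\<lambda>n. kin m g + 2 * Re (LINT \<xi>|lborel. wfourier m (d n) \<xi> * cnj (wfourier m g \<xi>))) \<longlonglongrightarrow> kin m g + 0"
      by (intro tendsto_intros Re0 kweak)
    ultimately show ?thesis unfolding dfold by simp
  qed
  show "(\<lambda>n. pot p (f n) - pot p (\<lambda>x. f n x - g x)) \<longlonglongrightarrow> pot p g"
    unfolding dfold
  proof (rule LIM_zero_cancel, rule Lim_null_comparison)
    let ?C = "(3 * p + 1) * (2 * (2 * M)) powr (p - 2)"
    show "(\<lambda>n. ?C * (LINT x|lborel. cmod (d n x * g x))) \<longlonglongrightarrow> 0"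
      by (intro tendsto_mult_right_zero null g)
    show "\<forall>\<^sub>F n in sequentially. norm (pot p (f n) - pot p (d n) - pot p g) \<le> ?C * (LINT x|lborel. cmod (d n x * g x))"
    proof (intro always_eventually allI)
      fix n
      have i: "integrable lborel (\<lambda>x. cmod (f n x) powr p)" "integrable lborel (\<lambda>x. cmod (d n x) powr p)"
        "integrable lborel (\<lambda>x. cmod (g x) powr p)"
        by (intro sobolev_pot_integrable[OF m p] f dS gS)+
      have "pot p (f n) - pot p (d n) - pot p g = (LINT x|lborel. cmod (f n x) powr p - cmod (d n x) powr p - cmod (g x) powr p)"
        unfolding pot_def using i by simp
      also have "norm \<dots> \<le> (LINT x|lborel. norm (cmod (f n x) powr p - cmod (d n x) powr p - cmod (g x) powr p))"
        by (rule integral_norm_bound)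
      also have "\<dots> \<le> (LINT x|lborel. ?C * cmod (d n x * g x))"
      proof (rule integral_mono_AE)
        show "integrable lborel (\<lambda>x. norm (cmod (f n x) powr p - cmod (d n x) powr p - cmod (g x) powr p))"
          by (intro integrable_norm Bochner_Integration.integrable_diff i)
        show "integrable lborel (\<lambda>x. ?C * cmod (d n x * g x))"
          by (intro integrable_mult_right integrable_norm L2_mult_integrable dL g)
        show "AE x in lborel. norm (cmod (f n x) powr p - cmod (d n x) powr p - cmod (g x) powr p) \<le> ?C * cmod (d n x * g x)"
        proof (rule AE_I2)
          fix x
          have "0 \<le> M" using gM[of x] norm_ge_zero order_trans by blast
          hence "cmod (g x) \<le> 2 * M" using gM[of x] by simp
          from Brezis_Lieb_pointwise[OF p dM this, of n x]
          show "norm (cmod (f n x) powr p - cmod (d n x) powr p - cmod (g x) powr p) \<le> ?C * cmod (d n x * g x)"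
            by (simp add: d_def norm_mult)
        qed
      qed
      also have "\<dots> = ?C * (LINT x|lborel. cmod (d n x * g x))" by (rule integral_mult_right_zero)
      finally show "norm (pot p (f n) - pot p (d n) - pot p g) \<le> ?C * (LINT x|lborel. cmod (d n x * g x))" .
    qed
  qed
qed

text \<open>
  The consequence of \<open>energy_amplitude_scaling\<close> that also covers functions of charge zero; remainders may
  be of this kind.
\<close>

lemma energy_ge_fraction:
  assumes m: "1 \<le> m" and p: "2 < p" and u: "u \<in> sobolev m" and c: "0 < c" and b: "charge u \<le> c"
    and inf: "\<And>v. v \<in> sobolev m \<Longrightarrow> charge v = c \<Longrightarrow> I \<le> energy m p v"
  shows "charge u / c * I \<le> energy m p u"
proof (cases "charge u = 0")
  case True
  hence "AE x in lborel. u x = 0" using charge_eq_0_iff[OF sobolev_L2[OF u]] by simp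
  hence "pot p u = 0" unfolding pot_def by (intro integral_eq_zero_AE) (auto elim!: eventually_mono)
  thus ?thesis using True kin_nonneg[of m u] by (simp add: energy_eq[OF m p u])
next
  case False
  hence cu: "0 < charge u" using charge_nonneg[of u] by simp
  have "1 \<le> (c / charge u) powr (p / 2 - 1)" using b cu p by (intro ge_one_powr_ge_zero) auto
  hence "0 \<le> ((c / charge u) powr (p / 2 - 1) - 1) * (2 / p * pot p u)"
    using p pot_nonneg[of p u] by simp
  thus ?thesis using energy_amplitude_scaling[OF m p u c cu inf] by simp
qed

text \<open>
  If the supremum were below this value, its power $p - 2$ times the charge would not reach the
  potential energy.
\<close>

lemma nonvanishing:
  assumes m: "1 \<le> m" and p: "2 < p" and u: "u \<in> sobolev m" and c: "charge u \<le> C" "0 < C" and e: "0 < e" "e < pot p u"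
  shows "\<exists>x. (e / C) powr (1 / (p - 2)) \<le> cmod (cont_rep u x)"
proof (rule ccontr)
  let ?\<delta> = "(e / C) powr (1 / (p - 2))"
  assume "\<not> ?thesis"
  hence "AE x in lborel. cmod (u x) \<le> ?\<delta>"
    using cont_rep_AE[OF m u] by (auto elim!: eventually_mono simp: not_le less_imp_le)
  from pot_integrable(2)[OF p sobolev_L2[OF u] this]
  have "pot p u \<le> ?\<delta> powr (p - 2) * charge u" .
  also have "?\<delta> powr (p - 2) = e / C" unfolding powr_powr using e c p by simp
  also have "e / C * charge u \<le> e / C * C" using c e by (intro mult_left_mono) auto
  finally show False using e c by simp
qed

section \<open>Compactness of minimizing sequences\<close>

lemma sobolev_dist_eq:
  assumes "u \<in> sobolev m" "v \<in> sobolev m"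
  shows "sobolev_dist m u v = sqrt (charge (\<lambda>x. u x - v x) + kin m (\<lambda>x. u x - v x))"
  unfolding sobolev_dist_def by (rule sobolev_norm_eq[OF sobolev_diff[OF assms]])

text \<open>
  Concentration-compactness. Translating the sequence so that it does not vanish at the origin
  excludes vanishing; \<open>energy_amplitude_scaling\<close> for the limit and \<open>energy_ge_fraction\<close> for the remainder
  exclude dichotomy.
\<close>

theorem minimizing_sequences_compact:
  assumes m: "1 \<le> m" and p: "2 < p" "p < 4 * real m + 2" and c: "0 < c" and I: "I < 0"
    and inf: "\<And>v. v \<in> sobolev m \<Longrightarrow> charge v = c \<Longrightarrow> I \<le> energy m p v"
    and u: "\<And>n. u n \<in> sobolev m" and uc: "(\<lambda>n. charge (u n)) \<longlonglongrightarrow> c" and ue: "(\<lambda>n. energy m p (u n)) \<longlonglongrightarrow> I"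
  obtains r s g where "strict_mono (r :: nat \<Rightarrow> nat)" "g \<in> sobolev m" "charge g = c" "energy m p g = I"
    "(\<lambda>k. sobolev_dist m (translate (s k) (u (r k))) g) \<longlonglongrightarrow> 0"
proof -
  obtain D where D: "\<And>v. v \<in> sobolev m \<Longrightarrow> charge v \<le> c + 1 \<Longrightarrow> kin m v \<le> 4 * energy m p v + D"
    using energy_coercive[OF m p, of "c + 1"] c by (metis add_nonneg_nonneg less_imp_le zero_le_one)
  define A where "A = c + 5 + 4 * I + D"
  have "\<forall>\<^sub>F n in sequentially. charge (u n) < c + 1"
    "\<forall>\<^sub>F n in sequentially. energy m p (u n) < I + 1"
    "\<forall>\<^sub>F n in sequentially. energy m p (u n) < I / 2"
    by (rule order_tendstoD(2)[OF uc] order_tendstoD(2)[OF ue], use I in simp)+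
  hence "\<forall>\<^sub>F n in sequentially. charge (u n) < c + 1 \<and> energy m p (u n) < I + 1 \<and> energy m p (u n) < I / 2"
    by eventually_elim simp
  then obtain N where N: "\<And>n. n \<ge> N \<Longrightarrow> charge (u n) < c + 1 \<and> energy m p (u n) < I + 1 \<and> energy m p (u n) < I / 2"
    unfolding eventually_sequentially by blast
  define v where "v n = u (n + N)" for n
  have v: "v n \<in> sobolev m" "charge (v n) \<le> c + 1" "energy m p (v n) \<le> I + 1" "energy m p (v n) < I / 2" for n
    using u N[of "n + N"] by (auto simp: v_def)
  have vA: "charge (v n) + kin m (v n) \<le> A" for n
    using D[OF v(1,2), of n] v(2,3)[of n] unfolding A_def by linarith
  \<comment> \<open>an energy below $I/2$ leaves at least this much for the integral of $|u|^p$\<close>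
  define e0 where "e0 = - (p / 4 * I)"
  have e0: "0 < e0" using I p by (simp add: e0_def mult_pos_neg)
  have vpot: "e0 < pot p (v n)" for n
  proof -
    have "kin m (v n) / 2 - 2 / p * pot p (v n) < I / 2" using v(4)[of n] by (simp add: energy_eq[OF m p(1) v(1)])
    hence "- (I / 2) < 2 / p * pot p (v n)" using kin_nonneg[of m "v n"] by linarith
    hence "p / 2 * - (I / 2) < p / 2 * (2 / p * pot p (v n))" using p by (intro mult_strict_left_mono) auto
    thus ?thesis using p by (simp add: e0_def)
  qed
  define \<delta> where "\<delta> = (e0 / (c + 1)) powr (1 / (p - 2))"
  have \<delta>: "0 < \<delta>" using e0 c by (simp add: \<delta>_def)
  have "\<exists>x. \<delta> \<le> cmod (cont_rep (v n) x)" for n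
    unfolding \<delta>_def by (rule nonvanishing[OF m p(1) v(1,2) _ e0 vpot]) (use c in simp)
  then obtain y where y: "\<And>n. \<delta> \<le> cmod (cont_rep (v n) (y n))" by metis
  \<comment> \<open>moves the points where the functions are not small to the origin\<close>
  define w where "w n = translate (- y n) (v n)" for n
  have w: "w n \<in> sobolev m" "kin m (w n) = kin m (v n)" "charge (w n) = charge (v n)" "pot p (w n) = pot p (v n)" for n
    unfolding w_def using translate_sobolev[OF m v(1)] charge_translate pot_translate by auto
  have wA: "charge (w n) + kin m (w n) \<le> A" for n using vA w by simp
  have w0: "\<delta> \<le> cmod (cont_rep (w n) 0)" for n using y[of n] by (simp add: w_def cont_rep_translate[OF m v(1)])
  have A: "0 \<le> A" using wA[of 0] charge_nonneg[of "w 0"] kin_nonneg[of m "w 0"] by linarith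
  obtain r g where r: "strict_mono (r :: nat \<Rightarrow> nat)" and g: "\<And>x. (\<lambda>k. cont_rep (w (r k)) x) \<longlonglongrightarrow> g x"
    by (rule cont_rep_pointwise_convergent_subsequence[where v = w, OF m w(1) wA], rule that)
  define f where "f k = cont_rep (w (r k))" for k
  have wm: "w n \<in> borel_measurable borel" for n using sobolev_L2[OF w(1)] L2_measurable by auto
  have fm: "f k \<in> borel_measurable borel" for k unfolding f_def by (rule cont_rep_measurable[OF sobolev_L2[OF w(1)]])
  have wf: "AE x in lborel. w (r k) x = f k x" for k unfolding f_def by (rule cont_rep_AE[OF m w(1)])
  have f: "f k \<in> sobolev m" "kin m (f k) = kin m (v (r k))" "charge (f k) = charge (v (r k))" "pot p (f k) = pot p (v (r k))" for k
    using sobolev_cong[OF w(1) fm wf, of k] w[of "r k"] pot_cong_AE[OF wm[of "r k"] fm[of k] wf[of k], of p] by simp_all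
  have fA: "charge (f k) + kin m (f k) \<le> A" for k using vA f by simp
  have fM: "cmod (f k x) \<le> l2n (inv_weight m) * sqrt A" for k x unfolding f_def by (rule cont_rep_bound1[OF m w(1) wA])
  note split = pointwise_limit_splitting[where f = f, OF m p(1) f(1) fA fM g[folded f_def]]
  note gS = split(1)
  define d where "d k x = f k x - g x" for k x
  have dS: "d k \<in> sobolev m" for k unfolding d_def[abs_def] by (intro sobolev_diff f gS)
  have dfold: "(\<lambda>x. f k x - g x) = d k" for k by (auto simp: d_def)
  define a where "a = charge g"
  have vlim: "(\<lambda>k. charge (v (r k))) \<longlonglongrightarrow> c" "(\<lambda>k. energy m p (v (r k))) \<longlonglongrightarrow> I"
    using LIMSEQ_subseq_LIMSEQ[OF LIMSEQ_ignore_initial_segment[OF uc, of N] r]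
      LIMSEQ_subseq_LIMSEQ[OF LIMSEQ_ignore_initial_segment[OF ue, of N] r] by (simp_all add: v_def o_def)
  have dc: "(\<lambda>k. charge (d k)) \<longlonglongrightarrow> c - a"
    using tendsto_diff[OF vlim(1) split(2)] by (simp add: f dfold a_def)
  have de: "(\<lambda>k. energy m p (d k)) \<longlonglongrightarrow> I - energy m p g"
  proof -
    have "(\<lambda>k. energy m p (v (r k)) - (1 / 2 * (kin m (f k) - kin m (d k)) - 2 / p * (pot p (f k) - pot p (d k))))
       \<longlonglongrightarrow> I - (1 / 2 * kin m g - 2 / p * pot p g)"
      using split(3,4) by (intro tendsto_intros vlim) (simp_all add: dfold)
    moreover have "energy m p (v (r k)) - (1 / 2 * (kin m (f k) - kin m (d k)) - 2 / p * (pot p (f k) - pot p (d k))) = energy m p (d k)" for k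
      by (simp add: energy_eq[OF m p(1) v(1)] energy_eq[OF m p(1) dS] f algebra_simps)
    ultimately show ?thesis by (simp add: energy_eq[OF m p(1) gS])
  qed
  have ac: "a \<le> c" using LIMSEQ_le_const[OF dc, of 0] charge_nonneg by auto
  \<comment> \<open>equicontinuity spreads the lower bound at the origin to a neighbourhood\<close>
  have a0: "0 < a"
  proof (rule ccontr)
    assume "\<not> 0 < a"
    hence "charge g = 0" using charge_nonneg[of g] by (simp add: a_def)
    hence ae: "AE x in lborel. g x = 0" using charge_eq_0_iff[OF sobolev_L2[OF gS]] by simp
    have sA: "0 < sqrt A + 1" using A by (simp add: add_nonneg_pos)
    hence "0 < \<delta> / (2 * (sqrt A + 1))" using \<delta> by (intro divide_pos_pos mult_pos_pos) auto
    then obtain h where h: "0 < h" "\<And>x. \<bar>x\<bar> < h \<Longrightarrow> modulus m x < \<delta> / (2 * (sqrt A + 1))"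
      using modulus_small[OF m] by metis
    have "\<delta> / 2 \<le> cmod (g x)" if x: "\<bar>x\<bar> < h" for x
    proof (rule LIMSEQ_le_const[OF tendsto_norm[OF g[of x]]], intro exI allI impI)
      fix k
      have "cmod (cont_rep (w (r k)) x - cont_rep (w (r k)) 0) \<le> modulus m (x - 0) * sqrt A"
        by (rule cont_rep_equicontinuous[OF m w(1) wA])
      also have "\<dots> \<le> \<delta> / (2 * (sqrt A + 1)) * sqrt A" using h(2)[OF x] A by (intro mult_right_mono) auto
      also have "\<dots> \<le> \<delta> / 2"
      proof -
        have "sqrt A / (sqrt A + 1) \<le> 1" using A sA by (simp add: divide_le_eq)
        hence "\<delta> / 2 * (sqrt A / (sqrt A + 1)) \<le> \<delta> / 2 * 1" using \<delta> by (intro mult_left_mono) auto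
        thus ?thesis by (simp add: field_simps)
      qed
      finally show "\<delta> / 2 \<le> cmod (cont_rep (w (r k)) x)"
        using w0[of "r k"] norm_triangle_ineq2[of "cont_rep (w (r k)) 0" "cont_rep (w (r k)) x"]
        by (simp add: norm_minus_commute)
    qed
    hence "AE x in lborel. x \<notin> {-h<..<h}"
      using ae by (auto elim!: eventually_mono simp: abs_less_iff) (use \<delta> in force)
    hence "emeasure lborel {-h<..<h} = 0" by (subst (asm) AE_iff_measurable[of "{-h<..<h}"]) auto
    thus False using h(1) by simp
  qed
  have frac: "charge (d k) / c * I \<le> energy m p (d k)" if "charge (d k) \<le> c" for k
    by (rule energy_ge_fraction[OF m p(1) dS c that inf])
  \<comment> \<open>the gain for the limit would push the total energy above its infimum\<close>
  have "a = c"
  proof (rule ccontr)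
    assume "a \<noteq> c"
    hence lt: "a < c" using ac by simp
    have "\<forall>\<^sub>F k in sequentially. charge (d k) < c" by (rule order_tendstoD(2)[OF dc]) (use a0 in simp)
    hence "\<forall>\<^sub>F k in sequentially. charge (d k) / c * I \<le> energy m p (d k)"
      by eventually_elim (use frac in simp)
    moreover have "(\<lambda>k. charge (d k) / c * I) \<longlonglongrightarrow> (c - a) / c * I" using c by (intro tendsto_intros dc) auto
    ultimately have 1: "(c - a) / c * I \<le> I - energy m p g"
      by (intro tendsto_le[OF sequentially_bot de]) auto
    have 2: "a / c * I + ((c / a) powr (p / 2 - 1) - 1) * (2 / p * pot p g) \<le> energy m p g"
      unfolding a_def by (rule energy_amplitude_scaling[OF m p(1) gS c _ inf]) (use a0 in \<open>simp add: a_def\<close>)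
    have "1 < (c / a) powr (p / 2 - 1)" using lt a0 p by (intro gr_one_powr) auto
    hence "0 < ((c / a) powr (p / 2 - 1) - 1) * (2 / p * pot p g)"
      using pot_pos[OF m p(1) gS] a0 p by (simp add: a_def)
    moreover have "(c - a) / c * I + a / c * I = I" using c by (simp add: field_simps)
    ultimately show False using 1 2 by linarith
  qed
  hence dc0: "(\<lambda>k. charge (d k)) \<longlonglongrightarrow> 0" using dc by simp
  have gI: "I \<le> energy m p g" by (rule inf[OF gS]) (use \<open>a = c\<close> in \<open>simp add: a_def\<close>)
  define M where "M = 2 * (l2n (inv_weight m) * sqrt A)"
  have gM: "cmod (g x) \<le> l2n (inv_weight m) * sqrt A" for x
    by (rule LIMSEQ_le_const2[OF tendsto_norm[OF g[of x]]]) (use fM in \<open>auto simp: f_def\<close>)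
  have dM: "cmod (d k x) \<le> M" for k x
    using norm_triangle_ineq4[of "f k x" "g x"] fM[of k x] gM[of x] by (simp add: d_def M_def)
  have dp: "(\<lambda>k. pot p (d k)) \<longlonglongrightarrow> 0"
  proof (rule Lim_null_comparison)
    show "(\<lambda>k. M powr (p - 2) * charge (d k)) \<longlonglongrightarrow> 0" by (intro tendsto_mult_right_zero dc0)
    show "\<forall>\<^sub>F k in sequentially. norm (pot p (d k)) \<le> M powr (p - 2) * charge (d k)"
      using pot_integrable(2)[OF p(1) sobolev_L2[OF dS] AE_I2[OF dM]] pot_nonneg by simp
  qed
  have dk: "(\<lambda>k. kin m (d k)) \<longlonglongrightarrow> 2 * (I - energy m p g)"
  proof -
    have "(\<lambda>k. 2 * (energy m p (d k) + 2 / p * pot p (d k))) \<longlonglongrightarrow> 2 * (I - energy m p g + 2 / p * 0)"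
      by (intro tendsto_intros de dp)
    thus ?thesis by (simp add: energy_eq[OF m p(1) dS])
  qed
  have "0 \<le> 2 * (I - energy m p g)" by (rule LIMSEQ_le_const[OF dk]) (use kin_nonneg in auto)
  hence gI': "energy m p g = I" using gI by simp
  define s where "s k = - y (r k)" for k
  have ddist: "sobolev_dist m (translate (s k) (u (r k + N))) g = sqrt (charge (d k) + kin m (d k))" for k
  proof -
    have tw: "translate (s k) (u (r k + N)) = w (r k)" by (simp add: w_def s_def v_def)
    have gm: "g \<in> borel_measurable borel" using sobolev_L2[OF gS] L2_measurable by auto
    have ae: "AE x in lborel. d k x = w (r k) x - g x" using wf[of k] by eventually_elim (simp add: d_def)
    have "(\<lambda>x. w (r k) x - g x) \<in> borel_measurable borel" using wm[of "r k"] gm by measurable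
    from sobolev_cong[OF dS this ae] show ?thesis
      unfolding tw sobolev_dist_eq[OF w(1) gS] by simp
  qed
  have "(\<lambda>k. sqrt (charge (d k) + kin m (d k))) \<longlonglongrightarrow> sqrt (0 + 2 * (I - energy m p g))"
    by (intro tendsto_intros dc0 dk)
  hence "(\<lambda>k. sobolev_dist m (translate (s k) (u (r k + N))) g) \<longlonglongrightarrow> 0" unfolding ddist by (simp add: gI')
  moreover have "strict_mono (\<lambda>k. r k + N)" using r by (simp add: strict_mono_def)
  ultimately show thesis using that[of "\<lambda>k. r k + N" g s] gS gI' \<open>a = c\<close> by (simp add: a_def)
qed

lemma l2n_sq_diff_bound:
  assumes "f \<in> L2" "g \<in> L2" "l2n f \<le> B" "l2n g \<le> B"
  shows "\<bar>charge f - charge g\<bar> \<le> 2 * B * l2n (\<lambda>x. f x - g x)"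
proof -
  have "charge f - charge g = (l2n f + l2n g) * (l2n f - l2n g)"
    by (simp add: square_diff_square_factored[symmetric] power2_eq_square[symmetric] l2n_sq)
  hence "\<bar>charge f - charge g\<bar> = (l2n f + l2n g) * \<bar>l2n f - l2n g\<bar>"
    using l2n_nonneg[of f] l2n_nonneg[of g] by (simp add: abs_mult)
  also have "\<dots> \<le> (2 * B) * l2n (\<lambda>x. f x - g x)"
    using assms l2n_reverse_triangle[OF assms(1,2)] l2n_nonneg[of f] l2n_nonneg[of g] by (intro mult_mono) auto
  finally show ?thesis .
qed

lemma pot_diff_bound:
  assumes p: "2 < p" and L: "f \<in> L2" "g \<in> L2" "l2n f \<le> B" "l2n g \<le> B"
    and M: "AE x in lborel. cmod (f x) \<le> M" "AE x in lborel. cmod (g x) \<le> M"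
  shows "\<bar>pot p f - pot p g\<bar> \<le> p * M powr (p - 2) * (2 * B) * l2n (\<lambda>x. f x - g x)"
proof -
  let ?F = "\<lambda>x. complex_of_real (cmod (f x)) + complex_of_real (cmod (g x))" and ?D = "\<lambda>x. f x - g x"
  have F: "?F \<in> L2" "?D \<in> L2" by (intro L2_add L2_cmod L2_diff L)+
  have nF: "l2n ?F \<le> 2 * B"
  proof -
    have "l2n (\<lambda>x. complex_of_real (cmod (f x))) = l2n f" "l2n (\<lambda>x. complex_of_real (cmod (g x))) = l2n g"
      by (simp_all add: l2n_def charge_def)
    thus ?thesis using l2n_triangle[OF L2_cmod[OF L(1)] L2_cmod[OF L(2)]] L(3,4) by linarith
  qed
  have i: "integrable lborel (\<lambda>x. cmod (f x) powr p)" "integrable lborel (\<lambda>x. cmod (g x) powr p)"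
    using pot_integrable(1)[OF p L(1) M(1)] pot_integrable(1)[OF p L(2) M(2)] by auto
  have "\<bar>pot p f - pot p g\<bar> = norm (LINT x|lborel. cmod (f x) powr p - cmod (g x) powr p)"
    unfolding pot_def using i by simp
  also have "\<dots> \<le> (LINT x|lborel. norm (cmod (f x) powr p - cmod (g x) powr p))" by (rule integral_norm_bound)
  also have "\<dots> \<le> (LINT x|lborel. p * M powr (p - 2) * cmod (?F x * ?D x))"
  proof (rule integral_mono_AE)
    show "integrable lborel (\<lambda>x. norm (cmod (f x) powr p - cmod (g x) powr p))"
      by (intro integrable_norm Bochner_Integration.integrable_diff i)
    show "integrable lborel (\<lambda>x. p * M powr (p - 2) * cmod (?F x * ?D x))"
      by (intro integrable_mult_right integrable_norm L2_mult_integrable F)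
    show "AE x in lborel. norm (cmod (f x) powr p - cmod (g x) powr p) \<le> p * M powr (p - 2) * cmod (?F x * ?D x)"
      using M
    proof eventually_elim
      case (elim x)
      have "\<bar>cmod (f x) powr p - cmod (g x) powr p\<bar> \<le> p * M powr (p - 2) * (cmod (f x) + cmod (g x)) * \<bar>cmod (f x) - cmod (g x)\<bar>"
        by (rule powr_diff_bound) (use p elim in auto)
      also have "\<dots> \<le> p * M powr (p - 2) * (cmod (f x) + cmod (g x)) * cmod (f x - g x)"
        using p norm_triangle_ineq3[of "f x" "g x"] by (intro mult_left_mono) auto
      also have "cmod (f x) + cmod (g x) = cmod (?F x)"
        by (simp flip: of_real_add)
      finally show ?case by (simp add: norm_mult mult.assoc)
    qed
  qed
  also have "\<dots> = p * M powr (p - 2) * (LINT x|lborel. cmod (?F x * ?D x))" by (rule integral_mult_right_zero)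
  also have "\<dots> \<le> p * M powr (p - 2) * (2 * B * l2n ?D)"
    using p nF l2n_nonneg L2_Cauchy_Schwarz_abs[OF F]
    by (intro mult_left_mono order_trans[OF L2_Cauchy_Schwarz_abs[OF F]] mult_right_mono) auto
  finally show ?thesis by (simp add: mult.assoc)
qed

text \<open>
  Energy and charge are uniformly continuous on bounded sets. The form with two sequences is the one
  that stability uses: initial data and the ground states closest to them.
\<close>

lemma energy_charge_uniformly_continuous:
  assumes m: "1 \<le> m" and p: "2 < p" and u: "\<And>n. u n \<in> sobolev m" and v: "\<And>n. v n \<in> sobolev m"
    and A: "\<And>n. charge (v n) + kin m (v n) \<le> A" and d: "(\<lambda>n. sobolev_dist m (u n) (v n)) \<longlonglongrightarrow> 0"
  shows "(\<lambda>n. charge (u n) - charge (v n)) \<longlonglongrightarrow> 0" "(\<lambda>n. energy m p (u n) - energy m p (v n)) \<longlonglongrightarrow> 0"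
proof -
  let ?d = "\<lambda>n. sobolev_dist m (u n) (v n)"
  have A0: "0 \<le> A" using A[of 0] charge_nonneg[of "v 0"] kin_nonneg[of m "v 0"] by linarith
  have L: "u n \<in> L2" "v n \<in> L2" "wfourier m (u n) \<in> L2" "wfourier m (v n) \<in> L2" for n
    using u[of n] v[of n] by (auto simp: sobolev_iff)
  have dn: "l2n (\<lambda>x. u n x - v n x) \<le> ?d n" "l2n (\<lambda>\<xi>. wfourier m (u n) \<xi> - wfourier m (v n) \<xi>) \<le> ?d n" for n
    unfolding sobolev_dist_eq[OF u v] l2n_wfourier_diff[OF u v] unfolding l2n_def using charge_nonneg kin_nonneg by auto
  define B where "B = sqrt A + 1"
  have vB: "l2n (v n) \<le> sqrt A" "l2n (wfourier m (v n)) \<le> sqrt A" for n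
    using A[of n] charge_nonneg[of "v n"] kin_nonneg[of m "v n"] by (auto simp: l2n_def kin_def)
  obtain N where N: "\<And>n. n \<ge> N \<Longrightarrow> ?d n < 1"
    using order_tendstoD(2)[OF d, of 1] unfolding eventually_sequentially by auto
  have uB: "l2n (u n) \<le> B" "l2n (wfourier m (u n)) \<le> B" if "n \<ge> N" for n
    using l2n_diff_triangle[OF L(1,2) L2_zero, of n n] l2n_diff_triangle[OF L(3,4) L2_zero, of n n] dn[of n] vB[of n] N[OF that]
    unfolding B_def by simp_all
  have vB': "l2n (v n) \<le> B" "l2n (wfourier m (v n)) \<le> B" for n using vB[of n] by (auto simp: B_def)
  have B: "0 \<le> B" using A0 by (simp add: B_def)
  have cB: "charge f \<le> B\<^sup>2" if "l2n f \<le> B" for f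
    using power_mono[OF that l2n_nonneg, of 2] by (simp add: l2n_sq)
  define M where "M = l2n (inv_weight m) * sqrt (2 * B\<^sup>2)"
  have M: "AE x in lborel. cmod (u n x) \<le> M" "AE x in lborel. cmod (v n x) \<le> M" if "n \<ge> N" for n
    using sobolev_bounded[OF m u, of n "2 * B\<^sup>2"] sobolev_bounded[OF m v, of n "2 * B\<^sup>2"]
      cB[OF uB(1)[OF that]] cB[OF uB(2)[OF that]] cB[OF vB'(1)[of n]] cB[OF vB'(2)[of n]]
    by (auto simp: M_def kin_def)
  have le: "2 * B * x \<le> 2 * B * ?d n" if "x \<le> ?d n" for x n using that B by (intro mult_left_mono) auto
  have c: "\<bar>charge (u n) - charge (v n)\<bar> \<le> 2 * B * ?d n" "\<bar>kin m (u n) - kin m (v n)\<bar> \<le> 2 * B * ?d n" if "n \<ge> N" for n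
    using order_trans[OF l2n_sq_diff_bound[OF L(1)[of n] L(2)[of n] uB(1)[OF that] vB'(1)] le[OF dn(1)]]
      order_trans[OF l2n_sq_diff_bound[OF L(3)[of n] L(4)[of n] uB(2)[OF that] vB'(2)] le[OF dn(2)]]
    unfolding kin_def by blast+
  have pt: "\<bar>pot p (u n) - pot p (v n)\<bar> \<le> p * M powr (p - 2) * (2 * B) * ?d n" if "n \<ge> N" for n
  proof -
    have "p * M powr (p - 2) * (2 * B) * l2n (\<lambda>x. u n x - v n x) \<le> p * M powr (p - 2) * (2 * B) * ?d n"
      using dn(1)[of n] p B by (intro mult_left_mono) auto
    thus ?thesis using pot_diff_bound[OF p L(1)[of n] L(2)[of n] uB(1)[OF that] vB'(1) M[OF that]] by linarith
  qed
  have ev: "\<forall>\<^sub>F n in sequentially. n \<ge> N" by (rule eventually_ge_at_top)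
  show "(\<lambda>n. charge (u n) - charge (v n)) \<longlonglongrightarrow> 0"
    by (rule Lim_null_comparison[OF _ tendsto_mult_right_zero[OF d, of "2 * B"]])
       (use ev in eventually_elim, use c in simp)
  have k: "(\<lambda>n. kin m (u n) - kin m (v n)) \<longlonglongrightarrow> 0"
    by (rule Lim_null_comparison[OF _ tendsto_mult_right_zero[OF d, of "2 * B"]])
       (use ev in eventually_elim, use c in simp)
  have q: "(\<lambda>n. pot p (u n) - pot p (v n)) \<longlonglongrightarrow> 0"
    by (rule Lim_null_comparison[OF _ tendsto_mult_right_zero[OF d, of "p * M powr (p - 2) * (2 * B)"]])
       (use ev in eventually_elim, use pt in simp)
  have "(\<lambda>n. 1 / 2 * (kin m (u n) - kin m (v n)) - 2 / p * (pot p (u n) - pot p (v n))) \<longlonglongrightarrow> 1 / 2 * 0 - 2 / p * 0"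
    by (intro tendsto_intros k q)
  moreover have "1 / 2 * (kin m (u n) - kin m (v n)) - 2 / p * (pot p (u n) - pot p (v n)) = energy m p (u n) - energy m p (v n)" for n
    by (simp add: energy_eq[OF m p u] energy_eq[OF m p v] algebra_simps)
  ultimately show "(\<lambda>n. energy m p (u n) - energy m p (v n)) \<longlonglongrightarrow> 0" by simp
qed

section \<open>The Euler-Lagrange equation\<close>

lemma nonlin_measurable [measurable]: "nonlin p \<in> borel_measurable borel"
  unfolding nonlin_def[abs_def] by measurable

lemma cmod_nonlin: "cmod (nonlin p z) = cmod z powr (p - 2) * cmod z"
  by (simp add: nonlin_def norm_mult)

lemma nonlin_L2:
  assumes "2 < p" "w \<in> L2" "AE x in lborel. cmod (w x) \<le> M"
  shows "(\<lambda>x. nonlin p (w x)) \<in> L2"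
proof -
  have [measurable]: "w \<in> borel_measurable borel" using assms L2_measurable by auto
  show ?thesis
  proof (rule L2_dominated[OF assms(2), where B = "M powr (p - 2)"])
    show "AE x in lborel. cmod (nonlin p (w x)) \<le> M powr (p - 2) * cmod (w x)"
      using assms(3) unfolding cmod_nonlin
      by eventually_elim (use assms(1) in \<open>auto intro!: mult_right_mono powr_mono2\<close>)
  qed measurable
qed

lemma nonlin_unit: "cmod e = 1 \<Longrightarrow> nonlin p (z * e) = nonlin p z * e"
  by (simp add: nonlin_def norm_mult)

text \<open>
  Convexity of $|z|^p$. Integrated, it bounds the potential energy from below by a function that is
  affine in the perturbation, so that the first variation can be found without differentiating
  under the integral sign.
\<close>

lemma powr_tangent_complex:
  assumes p: "2 < p"
  shows "cmod w powr p + p * (Re (v * cnj (nonlin p w)) - cmod w powr p) \<le> cmod v powr p"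
proof -
  have x1: "cmod w powr (p - 1) = cmod w powr (p - 2) * cmod w"
  proof (cases "w = 0")
    case False
    have "cmod w powr (p - 1) = cmod w powr ((p - 2) + 1)" by simp
    also have "\<dots> = cmod w powr (p - 2) * cmod w powr 1" by (rule powr_add)
    finally show ?thesis using False by simp
  qed simp
  have xx: "cmod w powr (p - 1) * cmod w = cmod w powr p"
    unfolding x1 using powr_split[of "cmod w" p] p by (simp add: power2_eq_square mult.assoc)
  have "Re (v * cnj (nonlin p w)) = cmod w powr (p - 2) * Re (v * cnj w)"
    by (simp add: nonlin_def algebra_simps)
  also have "\<dots> \<le> cmod w powr (p - 2) * (cmod w * cmod v)"
    using complex_Re_le_cmod[of "v * cnj w"] by (intro mult_left_mono) (auto simp: norm_mult mult.commute)
  also have "\<dots> = cmod w powr (p - 1) * cmod v" by (simp add: x1)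
  finally have "Re (v * cnj (nonlin p w)) - cmod w powr p \<le> cmod w powr (p - 1) * (cmod v - cmod w)"
    using xx by (simp add: algebra_simps)
  hence "p * (Re (v * cnj (nonlin p w)) - cmod w powr p) \<le> p * (cmod w powr (p - 1) * (cmod v - cmod w))"
    using p by (intro mult_left_mono) auto
  moreover have "cmod w powr p + p * (cmod w powr (p - 1) * (cmod v - cmod w)) \<le> cmod v powr p"
    by (rule powr_convex_below) (use p in auto)
  ultimately show ?thesis by linarith
qed

lemma nonlin_self: assumes "2 < p" shows "w * cnj (nonlin p w) = complex_of_real (cmod w powr p)"
proof -
  have "w * cnj (nonlin p w) = complex_of_real (cmod w powr (p - 2)) * (w * cnj w)"
    by (simp add: nonlin_def mult_ac)
  also have "w * cnj w = complex_of_real ((cmod w)\<^sup>2)" by (rule complex_norm_square[symmetric])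
  finally show ?thesis using powr_split[of "cmod w" p] assms by simp
qed

text \<open>
  Perturb $w$ in the direction \<open>\<eta>\<close> and rescale to the charge $c$. Replacing the potential energy by its
  tangent leaves a differentiable function $F$ of one real variable, which has a local minimum
  at $0$ because the energy of the perturbed function is at least that of $w$.
\<close>

lemma first_variation:
  assumes m: "1 \<le> m" and p: "2 < p" and c: "0 < c" and w: "w \<in> sobolev m" "charge w = c"
    and min: "\<And>v. v \<in> sobolev m \<Longrightarrow> charge v = c \<Longrightarrow> energy m p w \<le> energy m p v"
    and \<eta>: "\<eta> \<in> sobolev m"
  shows "Re (LINT \<xi>|lborel. wfourier m w \<xi> * cnj (wfourier m \<eta> \<xi>)) / 2 - Re (LINT x|lborel. nonlin p (w x) * cnj (\<eta> x))
     = (kin m w / 2 - pot p w) / c * Re (LINT x|lborel. w x * cnj (\<eta> x))"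
proof -
  define P where "P = Re (LINT \<xi>|lborel. wfourier m w \<xi> * cnj (wfourier m \<eta> \<xi>))"
  define Q where "Q = Re (LINT x|lborel. w x * cnj (\<eta> x))"
  define N where "N = Re (LINT x|lborel. nonlin p (w x) * cnj (\<eta> x))"
  define K where "K = kin m w"
  define V where "V = pot p w"
  define X where "X = charge \<eta>"
  define Y where "Y = kin m \<eta>"
  have L: "w \<in> L2" "\<eta> \<in> L2" using w \<eta> sobolev_L2 by auto
  have nl: "(\<lambda>x. nonlin p (w x)) \<in> L2" by (rule nonlin_L2[OF p L(1) sobolev_bounded[OF m w(1) order_refl]])
  have X0: "0 \<le> X" by (simp add: X_def charge_nonneg)
  define \<tau> where "\<tau> s = c / (c + 2 * s * Q + s\<^sup>2 * X)" for s
  define F where "F s = \<tau> s / 2 * (K + 2 * s * P + s\<^sup>2 * Y) - 2 * (sqrt (\<tau> s) * (V + s * N))" for s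
  \<comment> \<open>on this neighbourhood of $0$ the perturbed function has positive charge\<close>
  define d where "d = c / (2 * \<bar>Q\<bar> + 1)"
  have d: "0 < d" using c by (simp add: d_def add_nonneg_pos)
  have pos: "0 < c + 2 * s * Q + s\<^sup>2 * X" if "\<bar>s\<bar> < d" for s
  proof -
    have "\<bar>s\<bar> * (2 * \<bar>Q\<bar> + 1) < c" using that by (simp add: d_def pos_less_divide_eq add_nonneg_pos)
    hence "\<bar>2 * s * Q\<bar> < c" using abs_ge_zero[of s] by (simp add: abs_mult algebra_simps)
    moreover have "0 \<le> s\<^sup>2 * X" using X0 by simp
    ultimately show ?thesis by linarith
  qed
  have Re_s: "Re (LINT x|lborel. a x * cnj (complex_of_real s * b x)) = s * Re (LINT x|lborel. a x * cnj (b x))"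
    for a b :: "real \<Rightarrow> complex" and s
  proof -
    have "(LINT x|lborel. a x * cnj (complex_of_real s * b x)) = (LINT x|lborel. complex_of_real s * (a x * cnj (b x)))"
      by (simp add: mult_ac)
    also have "\<dots> = complex_of_real s * (LINT x|lborel. a x * cnj (b x))" by (rule integral_mult_right_zero)
    finally show ?thesis by simp
  qed
  have F_min: "F 0 \<le> F s" if s: "\<bar>s\<bar> < d" for s
  proof -
    let ?t = "sqrt (\<tau> s)"
    have \<tau>: "0 < \<tau> s" using pos[OF s] c by (simp add: \<tau>_def)
    let ?\<eta> = "\<lambda>x. complex_of_real s * \<eta> x"
    let ?y = "\<lambda>x. w x + ?\<eta> x"
    have s\<eta>: "?\<eta> \<in> sobolev m" by (rule sobolev_cmult[OF \<eta>])
    have y: "?y \<in> sobolev m" by (rule sobolev_add[OF w(1) s\<eta>])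
    have cy: "charge ?y = c + 2 * s * Q + s\<^sup>2 * X"
      unfolding charge_add[OF L(1) sobolev_L2[OF s\<eta>]] Re_s charge_cmult w(2) by (simp add: Q_def X_def)
    have ky: "kin m ?y = K + 2 * s * P + s\<^sup>2 * Y"
    proof -
      have "(LINT \<xi>|lborel. wfourier m w \<xi> * cnj (wfourier m ?\<eta> \<xi>)) = (LINT \<xi>|lborel. wfourier m w \<xi> * cnj (complex_of_real s * wfourier m \<eta> \<xi>))"
        by (rule integral_cong_AE)
           (use wfourier_cmult[OF L(2), of m "complex_of_real s"] wfourier_measurable[OF L(1), of m] wfourier_measurable[OF L(2), of m]
             wfourier_measurable[OF sobolev_L2[OF s\<eta>], of m] in \<open>auto elim!: eventually_mono\<close>)
      thus ?thesis unfolding kin_add[OF w(1) s\<eta>] kin_cmult[OF L(2)] by (simp add: Re_s P_def K_def Y_def del: complex_cnj_mult)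
    qed
    let ?v = "\<lambda>x. complex_of_real ?t * ?y x"
    have v: "?v \<in> sobolev m" by (rule sobolev_cmult[OF y])
    have "charge ?v = \<tau> s * charge ?y" using \<tau> by (simp add: charge_cmult)
    also have "\<dots> = c" unfolding cy \<tau>_def using pos[OF s] by simp
    finally have "energy m p w \<le> energy m p ?v" by (rule min[OF v])
    moreover have kv: "kin m ?v = \<tau> s * (K + 2 * s * P + s\<^sup>2 * Y)"
      unfolding kin_cmult[OF sobolev_L2[OF y]] ky using \<tau> by simp
    moreover have "V + p * (?t * (V + s * N) - V) \<le> pot p ?v"
    proof -
      have i1: "integrable lborel (\<lambda>x. cmod (w x) powr p)" by (rule sobolev_pot_integrable[OF m p w(1)])
      define Z where "Z x = nonlin p (w x) * cnj (\<eta> x)" for x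
      define G where "G x = Re (Z x)" for x
      have i2: "integrable lborel Z" unfolding Z_def[abs_def] by (intro L2_mult_integrable nl L2_cnj L)
      have iG: "integrable lborel G" unfolding G_def[abs_def] by (rule integrable_Re[OF i2])
      have NG: "N = (LINT x|lborel. G x)" unfolding N_def G_def Z_def[symmetric] by (rule integral_Re[OF i2, symmetric])
      have "V + p * (?t * (V + s * N) - V) =
        (LINT x|lborel. cmod (w x) powr p + p * (?t * (cmod (w x) powr p + s * G x) - cmod (w x) powr p))"
        unfolding NG V_def pot_def using i1 iG by simp
      also have "\<dots> \<le> (LINT x|lborel. cmod (?v x) powr p)"
      proof (rule integral_mono_AE)
        show "integrable lborel (\<lambda>x. cmod (w x) powr p + p * (?t * (cmod (w x) powr p + s * G x) - cmod (w x) powr p))"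
          by (intro Bochner_Integration.integrable_add Bochner_Integration.integrable_diff integrable_mult_right i1 iG)
        show "integrable lborel (\<lambda>x. cmod (?v x) powr p)" by (rule sobolev_pot_integrable[OF m p v])
        show "AE x in lborel. cmod (w x) powr p + p * (?t * (cmod (w x) powr p + s * G x) - cmod (w x) powr p) \<le> cmod (?v x) powr p"
        proof (rule AE_I2)
          fix x
          have "?v x * cnj (nonlin p (w x)) = complex_of_real ?t * (w x * cnj (nonlin p (w x)) + complex_of_real s * cnj (Z x))"
            by (simp add: Z_def algebra_simps)
          also have "\<dots> = complex_of_real ?t * (complex_of_real (cmod (w x) powr p) + complex_of_real s * cnj (Z x))"
            unfolding nonlin_self[OF p] ..
          finally have "Re (?v x * cnj (nonlin p (w x))) =
              Re (complex_of_real ?t * (complex_of_real (cmod (w x) powr p) + complex_of_real s * cnj (Z x)))"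
            by (rule arg_cong)
          also have "\<dots> = ?t * (cmod (w x) powr p + s * G x)" by (simp add: G_def)
          finally have "Re (?v x * cnj (nonlin p (w x))) = ?t * (cmod (w x) powr p + s * G x)" .
          thus "cmod (w x) powr p + p * (?t * (cmod (w x) powr p + s * G x) - cmod (w x) powr p) \<le> cmod (?v x) powr p"
            using powr_tangent_complex[OF p, of "w x" "?v x"] by (simp only:)
        qed
      qed
      finally show ?thesis by (simp add: pot_def)
    qed
    ultimately have e: "K / 2 - 2 / p * V \<le> \<tau> s * (K + 2 * s * P + s\<^sup>2 * Y) / 2 - 2 / p * (V + p * (?t * (V + s * N) - V))"
    proof -
      assume a: "energy m p w \<le> energy m p ?v" "kin m ?v = \<tau> s * (K + 2 * s * P + s\<^sup>2 * Y)" "V + p * (?t * (V + s * N) - V) \<le> pot p ?v"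
      have "2 / p * (V + p * (?t * (V + s * N) - V)) \<le> 2 / p * pot p ?v" using a(3) p by (intro mult_left_mono) auto
      thus ?thesis using a(1) unfolding energy_eq[OF m p w(1)] energy_eq[OF m p v] a(2) K_def[symmetric] V_def[symmetric] by linarith
    qed
    have "2 / p * (V + p * (?t * (V + s * N) - V)) = 2 / p * V + 2 * (?t * (V + s * N)) - 2 * V"
      using p by (simp add: field_simps)
    hence "K / 2 - 2 * V \<le> \<tau> s * (K + 2 * s * P + s\<^sup>2 * Y) / 2 - 2 * (?t * (V + s * N))" using e by linarith
    moreover have "F 0 = K / 2 - 2 * V" using c by (simp add: F_def \<tau>_def)
    ultimately show ?thesis by (simp add: F_def)
  qed
  have \<tau>': "(\<tau> has_real_derivative (- 2 * Q / c)) (at 0)"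
    unfolding \<tau>_def[abs_def] using c
    by (auto intro!: derivative_eq_intros simp: power2_eq_square)
  have \<tau>0: "\<tau> 0 = 1" using c by (simp add: \<tau>_def)
  have sq': "((\<lambda>s. sqrt (\<tau> s)) has_real_derivative (- Q / c)) (at 0)"
    using DERIV_chain2[OF DERIV_real_sqrt[of "\<tau> 0"] \<tau>'] by (simp add: \<tau>0)
  have "(F has_real_derivative ((- 2 * Q / c) / 2 * K + P - 2 * ((- Q / c) * V + N))) (at 0)"
    unfolding F_def[abs_def] using \<tau>0 c by (auto intro!: derivative_eq_intros \<tau>' sq' simp: field_simps)
  hence "(- 2 * Q / c) / 2 * K + P - 2 * ((- Q / c) * V + N) = 0"
    by (rule DERIV_local_min[OF _ d]) (use F_min in simp)
  moreover define q where "q = Q / c"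
  ultimately have "- (q * K) + P - 2 * (- (q * V) + N) = 0" by simp
  hence "P / 2 - N = (K / 2 - V) * q" by (simp add: field_simps)
  hence "P / 2 - N = (K / 2 - V) / c * Q" by (simp add: q_def)
  thus ?thesis by (simp add: P_def Q_def N_def K_def V_def)
qed

lemma wfourier_inner_test:
  assumes w: "w \<in> sobolev m" and t: "test_fun \<eta>"
  shows "(LINT \<xi>|lborel. wfourier m w \<xi> * cnj (wfourier m \<eta> \<xi>)) = (-1) ^ m * (LINT x|lborel. w x * cnj ((deriv_x ^^ (2 * m)) \<eta> x))"
proof -
  have L: "w \<in> L2" "\<eta> \<in> L2" using sobolev_L2[OF w] test_fun_L2[OF t, of 0] by simp_all
  have i: "integrable lborel \<eta>" using test_fun_integrable[OF t, of 0] by simp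
  let ?D = "(deriv_x ^^ (2 * m)) \<eta>"
  have D: "?D \<in> L2" "integrable lborel ?D" using test_fun_L2[OF t] test_fun_integrable[OF t] by auto
  have [measurable]: "fourier w \<in> borel_measurable borel" "wfourier m w \<in> borel_measurable borel" "wfourier m \<eta> \<in> borel_measurable borel"
    "fourier ?D \<in> borel_measurable borel" "fourier \<eta> \<in> borel_measurable borel"
    using L D fourier_L2 wfourier_measurable L2_measurable by auto
  have "(LINT x|lborel. w x * cnj (?D x)) = (LINT \<xi>|lborel. fourier w \<xi> * cnj (fourier ?D \<xi>))"
    by (rule parseval[OF L(1) D(1), symmetric])
  also have "\<dots> = (LINT \<xi>|lborel. (-1) ^ m * (wfourier m w \<xi> * cnj (wfourier m \<eta> \<xi>)))"
  proof (rule integral_cong_AE)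
    show "AE \<xi> in lborel. fourier w \<xi> * cnj (fourier ?D \<xi>) = (-1) ^ m * (wfourier m w \<xi> * cnj (wfourier m \<eta> \<xi>))"
      using fourier_integrable[OF D] fourier_integrable[OF L(2) i]
    proof eventually_elim
      case (elim \<xi>)
      have "(\<i> * complex_of_real \<xi>) ^ (2 * m) = (- (complex_of_real \<xi>)\<^sup>2) ^ m"
        by (simp add: power_mult power_mult_distrib)
      also have "\<dots> = (-1) ^ m * (complex_of_real (\<bar>\<xi>\<bar> ^ m))\<^sup>2"
      proof -
        have "(\<bar>\<xi>\<bar> ^ m)\<^sup>2 = \<bar>\<xi>\<bar> ^ (m * 2)" by (rule power_mult[symmetric])
        also have "\<dots> = \<bar>\<xi>\<bar> ^ (2 * m)" by (simp only: mult.commute)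
        also have "\<dots> = (\<bar>\<xi>\<bar>\<^sup>2) ^ m" by (rule power_mult)
        finally have "(complex_of_real (\<bar>\<xi>\<bar> ^ m))\<^sup>2 = ((complex_of_real \<xi>)\<^sup>2) ^ m"
          by (simp only: power2_abs of_real_power[symmetric])
        thus ?thesis by (simp only: power_minus[of "(complex_of_real \<xi>)\<^sup>2"])
      qed
      finally show ?case unfolding elim FT_deriv_x_funpow[OF t] wfourier_def by (simp add: elim power2_eq_square mult_ac)
    qed
  qed auto
  also have "\<dots> = (-1) ^ m * (LINT \<xi>|lborel. wfourier m w \<xi> * cnj (wfourier m \<eta> \<xi>))" by (rule integral_mult_right_zero)
  finally show ?thesis by (simp flip: mult.assoc power_mult_distrib)
qed

text \<open>
  The first variation gives the real part of the weak equation for each test function; multiplying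
  the test function by $i$ gives the imaginary part.
\<close>

theorem minimizer_stationary:
  assumes m: "1 \<le> m" and p: "2 < p" and c: "0 < c" and w: "w \<in> sobolev m" "charge w = c"
    and min: "\<And>v. v \<in> sobolev m \<Longrightarrow> charge v = c \<Longrightarrow> energy m p w \<le> energy m p v"
  shows "stationary_solution m p ((kin m w / 2 - pot p w) / c) w"
proof -
  let ?\<omega> = "(kin m w / 2 - pot p w) / c"
  define B where "B \<phi> = (-1) ^ m / 2 * (LINT x|lborel. w x * (deriv_x ^^ (2 * m)) \<phi> x)
        - (LINT x|lborel. nonlin p (w x) * \<phi> x) - complex_of_real ?\<omega> * (LINT x|lborel. w x * \<phi> x)" for \<phi>
  have ReB: "Re (B \<phi>) = 0" if t: "test_fun \<phi>" for \<phi>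
  proof -
    let ?\<eta> = "\<lambda>x. cnj (\<phi> x)"
    have t\<eta>: "test_fun ?\<eta>" by (rule test_fun_cnj[OF t])
    have "(LINT \<xi>|lborel. wfourier m w \<xi> * cnj (wfourier m ?\<eta> \<xi>)) = (-1) ^ m * (LINT x|lborel. w x * (deriv_x ^^ (2 * m)) \<phi> x)"
      unfolding wfourier_inner_test[OF w(1) t\<eta>] deriv_x_funpow_cnj[OF t] by simp
    moreover have fv: "Re (LINT \<xi>|lborel. wfourier m w \<xi> * cnj (wfourier m ?\<eta> \<xi>)) / 2 - Re (LINT x|lborel. nonlin p (w x) * cnj (?\<eta> x))
     = ?\<omega> * Re (LINT x|lborel. w x * cnj (?\<eta> x))"
      by (rule first_variation[OF m p c w min test_fun_sobolev[OF t\<eta>]])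
    moreover have "(-1) ^ m * Z / 2 = (-1) ^ m / 2 * (Z :: complex)" for Z by simp
    ultimately have "Re ((-1) ^ m / 2 * (LINT x|lborel. w x * (deriv_x ^^ (2 * m)) \<phi> x)) - Re (LINT x|lborel. nonlin p (w x) * \<phi> x)
       = ?\<omega> * Re (LINT x|lborel. w x * \<phi> x)"
      using fv by (simp only: complex_cnj_cnj flip: Re_divide_numeral)
    thus ?thesis unfolding B_def minus_complex.sel Re_complex_of_real by simp
  qed
  have "B \<phi> = 0" if t: "test_fun \<phi>" for \<phi>
  proof -
    have ti: "test_fun (\<lambda>x. \<i> * \<phi> x)" by (rule test_fun_cmult[OF t])
    have pull: "(LINT x|lborel. a x * (\<i> * b x)) = \<i> * (LINT x|lborel. a x * b x)" for a b :: "real \<Rightarrow> complex"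
      by (subst integral_mult_right_zero[symmetric]) (simp add: mult_ac)
    have "B (\<lambda>x. \<i> * \<phi> x) = \<i> * B \<phi>"
      unfolding B_def deriv_x_funpow_cmult[OF t] pull by (simp add: algebra_simps)
    hence "Im (B \<phi>) = 0" using ReB[OF ti] by simp
    with ReB[OF t] show ?thesis by (simp add: complex_eq_iff)
  qed
  thus ?thesis unfolding stationary_solution_def B_def by (simp add: algebra_simps)
qed

section \<open>Standing waves\<close>

lemma sobolev_dist_cmult:
  assumes "u \<in> sobolev m"
  shows "sobolev_dist m (\<lambda>x. a * u x) (\<lambda>x. b * u x) = cmod (a - b) * sqrt (charge u + kin m u)"
proof -
  have "(\<lambda>x. a * u x - b * u x) = (\<lambda>x. (a - b) * u x)" by (auto simp: algebra_simps)
  hence "sobolev_dist m (\<lambda>x. a * u x) (\<lambda>x. b * u x) = sobolev_norm m (\<lambda>x. (a - b) * u x)"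
    unfolding sobolev_dist_def by (rule arg_cong)
  also have "\<dots> = sqrt ((cmod (a - b))\<^sup>2 * (charge u + kin m u))"
    unfolding sobolev_norm_eq[OF sobolev_cmult[OF assms]] charge_cmult kin_cmult[OF sobolev_L2[OF assms]]
    by (simp add: ring_distribs)
  finally have "sobolev_dist m (\<lambda>x. a * u x) (\<lambda>x. b * u x) = sqrt ((cmod (a - b))\<^sup>2 * (charge u + kin m u))" .
  thus ?thesis by (simp add: real_sqrt_mult)
qed

lemma partial_x_funpow: "(deriv_x ^^ n) (\<phi> t) = ((partial_x ^^ n) \<phi>) t"
  by (induction n) (simp_all add: partial_x_def)

lemma test_fun2_derivatives:
  assumes "test_fun2 J \<phi>"
  shows "continuous_on UNIV (\<lambda>(t, x). ((partial_x ^^ j) \<phi>) t x)"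
    "continuous_on UNIV (\<lambda>(t, x). partial_t \<phi> t x)"
    "((partial_x ^^ j) \<phi>) t differentiable (at x)"
    "((\<lambda>s. \<phi> s x) has_vector_derivative partial_t \<phi> t x) (at t)"
proof -
  have a: "continuous_on UNIV (\<lambda>(t, x). ((partial_t ^^ i) ((partial_x ^^ j) \<phi>)) t x)"
    "(\<lambda>s. ((partial_t ^^ i) ((partial_x ^^ j) \<phi>)) s x) differentiable (at t)"
    "((partial_t ^^ i) ((partial_x ^^ j) \<phi>)) t differentiable (at x)" for i j t x
    using assms unfolding test_fun2_def Let_def by blast+
  show "continuous_on UNIV (\<lambda>(t, x). ((partial_x ^^ j) \<phi>) t x)" using a(1)[of 0 j] by simp
  show "continuous_on UNIV (\<lambda>(t, x). partial_t \<phi> t x)" using a(1)[of 1 0] by simp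
  show "((partial_x ^^ j) \<phi>) t differentiable (at x)" using a(3)[of 0 j] by simp
  show "((\<lambda>s. \<phi> s x) has_vector_derivative partial_t \<phi> t x) (at t)"
    using a(2)[of 0 0 x t] unfolding partial_t_def by (simp add: vector_derivative_works)
qed

lemma test_fun2_support:
  assumes "test_fun2 J \<phi>"
  obtains R where "0 < R" "\<And>j t x. R < \<bar>t\<bar> \<or> R < \<bar>x\<bar> \<Longrightarrow> ((partial_x ^^ j) \<phi>) t x = 0"
    "\<And>t x. R < \<bar>t\<bar> \<or> R < \<bar>x\<bar> \<Longrightarrow> partial_t \<phi> t x = 0"
proof -
  obtain K where K: "compact K" "\<And>t x. (t, x) \<notin> K \<Longrightarrow> \<phi> t x = 0" using assms unfolding test_fun2_def by blast
  obtain R where R: "0 < R" "\<And>z. z \<in> K \<Longrightarrow> norm z \<le> R" using compact_imp_bounded[OF K(1)] bounded_pos by metis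
  have z: "\<phi> t x = 0" if "R < \<bar>t\<bar> \<or> R < \<bar>x\<bar>" for t x
  proof (rule K(2), rule notI)
    assume "(t, x) \<in> K"
    hence "norm (t, x) \<le> R" by (rule R(2))
    thus False using that norm_fst_le[of t x] norm_snd_le[of x t] by auto
  qed
  have 1: "((partial_x ^^ j) \<phi>) t x = 0" if "R < \<bar>t\<bar> \<or> R < \<bar>x\<bar>" for j t x
    using that
  proof (induction j arbitrary: t x)
    case 0 thus ?case using z by simp
  next
    case (Suc j)
    have "deriv_x (((partial_x ^^ j) \<phi>) t) x = 0"
    proof (cases "R < \<bar>t\<bar>")
      case True
      show ?thesis by (rule deriv_x_zero_outside[OF open_UNIV]) (use Suc.IH True in auto)
    next
      case False
      thus ?thesis by (intro deriv_x_zero_outside[OF open_abs_greater[of R]]) (use Suc in auto)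
    qed
    thus ?case by (simp add: partial_x_def[of "(partial_x ^^ j) \<phi>"])
  qed
  have 2: "partial_t \<phi> t x = 0" if "R < \<bar>t\<bar> \<or> R < \<bar>x\<bar>" for t x
  proof -
    have "deriv_x (\<lambda>s. \<phi> s x) t = 0"
    proof (cases "R < \<bar>x\<bar>")
      case True
      show ?thesis by (rule deriv_x_zero_outside[OF open_UNIV]) (use z True in auto)
    next
      case False
      thus ?thesis by (intro deriv_x_zero_outside[OF open_abs_greater[of R]]) (use that z in auto)
    qed
    thus ?thesis by (simp add: partial_t_def deriv_x_def)
  qed
  show thesis using that[OF R(1) 1 2] by blast
qed

lemma test_fun2_slice:
  assumes "test_fun2 J \<phi>" shows "test_fun (\<phi> t)"
proof -
  obtain R where R: "\<And>t x. R < \<bar>t\<bar> \<or> R < \<bar>x\<bar> \<Longrightarrow> \<phi> t x = 0"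
    using test_fun2_support[OF assms] by (metis funpow_0)
  have "\<forall>x. x \<notin> {-R..R} \<longrightarrow> \<phi> t x = 0" using R by force
  thus ?thesis unfolding test_fun_def partial_x_funpow
    using test_fun2_derivatives(3)[OF assms] compact_Icc by blast
qed

text \<open>
  Licenses exchanging the integrals over time and space in the weak formulation.
\<close>

lemma integrable_against_compact_support:
  fixes E :: "real \<Rightarrow> complex" and G :: "real \<Rightarrow> real \<Rightarrow> complex"
  assumes u: "u \<in> L2" and E: "E \<in> borel_measurable borel" "\<And>t. cmod (E t) = 1"
    and G: "continuous_on UNIV (\<lambda>(t, x). G t x)" "\<And>t x. R < \<bar>t\<bar> \<or> R < \<bar>x\<bar> \<Longrightarrow> G t x = 0"
  shows "integrable (lborel \<Otimes>\<^sub>M lborel) (\<lambda>(t, x). E t * (u x * G t x))"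
proof -
  have um [measurable]: "u \<in> borel_measurable borel" "E \<in> borel_measurable borel" using u E L2_measurable by auto
  have "(\<lambda>(t, x). G t x) \<in> borel_measurable borel" by (rule borel_measurable_continuous_onI[OF G(1)])
  hence Gm [measurable]: "(\<lambda>(t, x). G t x) \<in> borel_measurable (borel \<Otimes>\<^sub>M borel)" by (simp add: borel_prod)
  have meas: "(\<lambda>(t, x). E t * (u x * G t x)) \<in> borel_measurable (lborel \<Otimes>\<^sub>M lborel)"
    unfolding split_beta' by (measurable; use Gm in \<open>simp add: split_beta'\<close>)
  have "compact ((\<lambda>(t, x). G t x) ` ({-R..R} \<times> {-R..R}))"
    by (intro compact_continuous_image compact_Times compact_Icc continuous_on_subset[OF G(1)]) auto
  then obtain B where B: "0 < B" "\<And>z. z \<in> (\<lambda>(t, x). G t x) ` ({-R..R} \<times> {-R..R}) \<Longrightarrow> cmod z \<le> B"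
    using compact_imp_bounded bounded_pos by metis
  have Gb: "cmod (G t x) \<le> B * (indicator {-R..R} t * indicator {-R..R} x)" for t x
  proof (cases "t \<in> {-R..R} \<and> x \<in> {-R..R}")
    case True
    thus ?thesis using B(2)[of "G t x"] by force
  next
    case False
    hence "R < \<bar>t\<bar> \<or> R < \<bar>x\<bar>" by auto
    thus ?thesis using G(2) B(1) by (simp add: indicator_def)
  qed
  have ui: "integrable lborel (\<lambda>x. B * cmod (indicator {-R..R} x * u x))"
    by (intro integrable_mult_right integrable_norm L2_integrable_on_interval u)
  have bnd: "cmod (E t * (u x * G t x)) \<le> indicator {-R..R} t * (B * cmod (indicator {-R..R} x * u x))" for t x
  proof -
    have "cmod (E t * (u x * G t x)) = cmod (u x) * cmod (G t x)" by (simp add: norm_mult E)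
    also have "\<dots> \<le> cmod (u x) * (B * (indicator {-R..R} t * indicator {-R..R} x))" by (intro mult_left_mono Gb) simp
    also have "\<dots> = indicator {-R..R} t * (B * cmod (indicator {-R..R} x * u x))"
      by (simp add: norm_mult indicator_def)
    finally show ?thesis .
  qed
  have inner: "integrable lborel (\<lambda>x. E t * (u x * G t x))" for t
  proof (rule Bochner_Integration.integrable_bound[OF ui])
    show "(\<lambda>x. E t * (u x * G t x)) \<in> borel_measurable lborel"
      using measurable_compose[OF measurable_Pair1' meas, of t] by simp
    show "AE x in lborel. norm (E t * (u x * G t x)) \<le> norm (B * cmod (indicator {-R..R} x * u x))"
    proof (rule AE_I2)
      fix x
      have "indicator {-R..R} t * (B * cmod (indicator {-R..R} x * u x)) \<le> B * cmod (indicator {-R..R} x * u x)"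
        using B(1) by (auto simp: indicator_def)
      thus "norm (E t * (u x * G t x)) \<le> norm (B * cmod (indicator {-R..R} x * u x))"
        using bnd[of t x] by simp
    qed
  qed
  show ?thesis
  proof (rule lborel_pair.Fubini_integrable[OF meas])
    let ?C = "LINT x|lborel. B * cmod (indicator {-R..R} x * u x)"
    have iR: "integrable lborel (indicator {-R..R} :: real \<Rightarrow> real)"
      by (rule integrable_real_indicator) (auto simp: emeasure_lborel_Icc_eq)
    show "integrable lborel (\<lambda>t. LINT x|lborel. norm ((\<lambda>(t, x). E t * (u x * G t x)) (t, x)))"
    proof (rule Bochner_Integration.integrable_bound)
      show "integrable lborel (\<lambda>t. indicator {-R..R} t * ?C)" by (intro integrable_mult_left iR)
      show "(\<lambda>t. LINT x|lborel. norm ((\<lambda>(t, x). E t * (u x * G t x)) (t, x))) \<in> borel_measurable lborel"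
        using meas by (intro lborel.borel_measurable_lebesgue_integral) (simp add: split_beta')
      show "AE t in lborel. norm (LINT x|lborel. norm ((\<lambda>(t, x). E t * (u x * G t x)) (t, x))) \<le> norm (indicator {-R..R} t * ?C)"
      proof (rule AE_I2)
        fix t
        have "(LINT x|lborel. cmod (E t * (u x * G t x))) \<le> (LINT x|lborel. indicator {-R..R} t * (B * cmod (indicator {-R..R} x * u x)))"
          by (intro integral_mono_AE AE_I2 bnd integrable_norm inner integrable_mult_right ui)
        also have "\<dots> = indicator {-R..R} t * ?C" by (rule integral_mult_right_zero)
        finally have "(LINT x|lborel. cmod (E t * (u x * G t x))) \<le> indicator {-R..R} t * ?C" .
        moreover have "0 \<le> (LINT x|lborel. cmod (E t * (u x * G t x)))" by (intro integral_nonneg_AE) auto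
        ultimately show "norm (LINT x|lborel. norm ((\<lambda>(t, x). E t * (u x * G t x)) (t, x))) \<le> norm (indicator {-R..R} t * ?C)"
          by simp
      qed
    qed
    show "AE t in lborel. integrable lborel (\<lambda>x. (\<lambda>(t, x). E t * (u x * G t x)) (t, x))"
      using inner by simp
  qed
qed

text \<open>
  At each time the stationary equation, tested with a time slice, turns the right-hand side into \<open>\<omega>\<close> times the
  pairing with the test function. After exchanging the integrals, integration by parts in time turns
  the left-hand side into the same.
\<close>

theorem standing_wave_solution:
  assumes m: "1 \<le> m" and p: "2 < p" and u: "u \<in> sobolev m" and st: "stationary_solution m p \<omega> u"
  shows "solution_on m p UNIV (\<lambda>t x. u x * exp (- \<i> * complex_of_real (\<omega> * t)))"
proof -
  define E where "E t = exp (- \<i> * complex_of_real (\<omega> * t))" for t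
  have cE: "cmod (E t) = 1" for t unfolding E_def using cmod_exp_i_real(1)[of "\<omega> * t"] by simp
  have Ec: "continuous_on UNIV E" unfolding E_def by (intro continuous_intros)
  have Em: "E \<in> borel_measurable borel" by (rule borel_measurable_continuous_onI[OF Ec])
  have Ed: "(E has_vector_derivative (- \<i> * complex_of_real \<omega>) * E t) (at t)" for t
  proof -
    have "((\<lambda>z. exp (- \<i> * (complex_of_real \<omega> * z))) has_field_derivative (- \<i> * complex_of_real \<omega>) * exp (- \<i> * (complex_of_real \<omega> * complex_of_real t))) (at (complex_of_real t))"
      by (auto intro!: derivative_eq_intros)
    thus ?thesis unfolding E_def using has_vector_derivative_real_field by (fastforce simp: o_def)
  qed
  have uE: "(\<lambda>x. u x * E t) = (\<lambda>x. E t * u x)" for t by (simp add: mult.commute)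
  have uL: "u \<in> L2" by (rule sobolev_L2[OF u])
  have nlL: "(\<lambda>x. nonlin p (u x)) \<in> L2" by (rule nonlin_L2[OF p uL sobolev_bounded[OF m u order_refl]])
  have weak: "- \<i> * (LINT t|lborel. LINT x|lborel. u x * E t * partial_t \<phi> t x) =
        (-1) ^ m / 2 * (LINT t|lborel. LINT x|lborel. u x * E t * (partial_x ^^ (2 * m)) \<phi> t x)
        - (LINT t|lborel. LINT x|lborel. nonlin p (u x * E t) * \<phi> t x)" if t2: "test_fun2 J \<phi>" for J \<phi>
  proof -
    obtain R where R: "0 < R" "\<And>j t x. R < \<bar>t\<bar> \<or> R < \<bar>x\<bar> \<Longrightarrow> ((partial_x ^^ j) \<phi>) t x = 0"
      "\<And>t x. R < \<bar>t\<bar> \<or> R < \<bar>x\<bar> \<Longrightarrow> partial_t \<phi> t x = 0" by (rule test_fun2_support[OF t2]) (rule that)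
    have z: "R < \<bar>t\<bar> \<or> R < \<bar>x\<bar> \<Longrightarrow> \<phi> t x = 0" for t x using R(2)[of t x 0] by simp
    note der = test_fun2_derivatives[OF t2]
    have c0: "continuous_on UNIV (\<lambda>(t, x). \<phi> t x)" using der(1)[of 0] by simp
    note int = integrable_against_compact_support[where R = R and E = E, OF _ Em cE]
    have iphi: "integrable (lborel \<Otimes>\<^sub>M lborel) (\<lambda>(t, x). E t * (u x * \<phi> t x))" by (rule int[OF uL c0 z])
    have it: "integrable (lborel \<Otimes>\<^sub>M lborel) (\<lambda>(t, x). E t * (u x * partial_t \<phi> t x))" by (rule int[OF uL der(2) R(3)])
    have ix: "integrable (lborel \<Otimes>\<^sub>M lborel) (\<lambda>(t, x). E t * (u x * (partial_x ^^ (2 * m)) \<phi> t x))" by (rule int[OF uL der(1) R(2)])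
    have inl: "integrable (lborel \<Otimes>\<^sub>M lborel) (\<lambda>(t, x). E t * (nonlin p (u x) * \<phi> t x))" by (rule int[OF nlL c0 z])
    define a where "a t = (LINT x|lborel. u x * (partial_x ^^ (2 * m)) \<phi> t x)" for t
    define b where "b t = (LINT x|lborel. nonlin p (u x) * \<phi> t x)" for t
    define d where "d t = (LINT x|lborel. u x * \<phi> t x)" for t
    have Ea: "(LINT x|lborel. E t * (u x * (partial_x ^^ (2 * m)) \<phi> t x)) = E t * a t"
      and Eb: "(LINT x|lborel. E t * (nonlin p (u x) * \<phi> t x)) = E t * b t"
      and Ed': "(LINT x|lborel. E t * (u x * \<phi> t x)) = E t * d t" for t
      unfolding a_def b_def d_def by (rule integral_mult_right_zero)+
    have ia: "integrable lborel (\<lambda>t. E t * a t)" using lborel_pair.integrable_fst[OF ix] by (simp add: a_def)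
    have ib: "integrable lborel (\<lambda>t. E t * b t)" using lborel_pair.integrable_fst[OF inl] by (simp add: b_def)
    have stat: "(-1) ^ m / 2 * a t - b t = complex_of_real \<omega> * d t" for t
      using st[unfolded stationary_solution_def, rule_format, OF test_fun2_slice[OF t2, of t]]
      unfolding a_def b_def d_def partial_x_funpow .
    \<comment> \<open>integration by parts in time\<close>
    have time: "(LINT t|lborel. E t * partial_t \<phi> t x) = \<i> * complex_of_real \<omega> * (LINT t|lborel. E t * \<phi> t x)" for x
    proof -
      have cp: "continuous_on UNIV (\<lambda>t. (t, x))" by (intro continuous_intros)
      have cs: "continuous_on UNIV (\<lambda>t. \<phi> t x)" "continuous_on UNIV (\<lambda>t. partial_t \<phi> t x)"
        using continuous_on_compose2[OF c0 cp] continuous_on_compose2[OF der(2) cp] by auto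
      have i1: "integrable lborel (\<lambda>t. E t * partial_t \<phi> t x)" "integrable lborel (\<lambda>t. E t * \<phi> t x)"
        by (rule continuous_compact_support_integrable[where R = R]; use R(3) z in \<open>auto intro!: continuous_intros Ec cs\<close>)+
      have "(LINT t|lborel. E t * partial_t \<phi> t x + (- \<i> * complex_of_real \<omega>) * E t * \<phi> t x) = 0"
      proof (rule integral_derivative_zero[where R = R])
        show "((\<lambda>t. E t * \<phi> t x) has_vector_derivative E t * partial_t \<phi> t x + (- \<i> * complex_of_real \<omega>) * E t * \<phi> t x) (at t)" for t
          by (rule has_vector_derivative_mult[OF Ed der(4)])
        show "continuous_on UNIV (\<lambda>t. E t * partial_t \<phi> t x + (- \<i> * complex_of_real \<omega>) * E t * \<phi> t x)"
          by (intro continuous_intros Ec cs)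
      qed (use R(1,3) z in auto)
      moreover have "(LINT t|lborel. E t * partial_t \<phi> t x + (- \<i> * complex_of_real \<omega>) * E t * \<phi> t x)
        = (LINT t|lborel. E t * partial_t \<phi> t x) + (LINT t|lborel. (- \<i> * complex_of_real \<omega>) * (E t * \<phi> t x))"
        unfolding mult.assoc[of "- \<i> * complex_of_real \<omega>"]
        by (intro Bochner_Integration.integral_add integrable_mult_right i1)
      moreover have "(LINT t|lborel. (- \<i> * complex_of_real \<omega>) * (E t * \<phi> t x)) = (- \<i> * complex_of_real \<omega>) * (LINT t|lborel. E t * \<phi> t x)"
        by (rule integral_mult_right_zero)
      ultimately show ?thesis by (simp add: add_eq_0_iff)
    qed
    have swap: "(LINT t|lborel. LINT x|lborel. E t * (u x * h t x)) = (LINT x|lborel. u x * (LINT t|lborel. E t * h t x))"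
      if "integrable (lborel \<Otimes>\<^sub>M lborel) (\<lambda>(t, x). E t * (u x * h t x))" for h
    proof -
      have "(LINT t|lborel. LINT x|lborel. E t * (u x * h t x)) = (LINT x|lborel. LINT t|lborel. E t * (u x * h t x))"
        using lborel_pair.Fubini_integral[OF that] by simp
      also have "\<dots> = (LINT x|lborel. u x * (LINT t|lborel. E t * h t x))"
        by (subst integral_mult_right_zero[symmetric]) (simp add: mult_ac)
      finally show ?thesis .
    qed
    have "- \<i> * (LINT t|lborel. LINT x|lborel. u x * E t * partial_t \<phi> t x) = - \<i> * (LINT t|lborel. LINT x|lborel. E t * (u x * partial_t \<phi> t x))"
      by (simp add: mult_ac)
    also have "\<dots> = - \<i> * (LINT x|lborel. u x * (\<i> * complex_of_real \<omega> * (LINT t|lborel. E t * \<phi> t x)))"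
      unfolding swap[OF it] time ..
    also have "(LINT x|lborel. u x * (\<i> * complex_of_real \<omega> * (LINT t|lborel. E t * \<phi> t x))) =
       \<i> * complex_of_real \<omega> * (LINT x|lborel. u x * (LINT t|lborel. E t * \<phi> t x))"
      by (subst integral_mult_right_zero[symmetric]) (simp add: mult_ac)
    also have "(LINT x|lborel. u x * (LINT t|lborel. E t * \<phi> t x)) = (LINT t|lborel. E t * d t)"
      unfolding swap[OF iphi, symmetric] Ed' ..
    also have "- \<i> * (\<i> * complex_of_real \<omega> * (LINT t|lborel. E t * d t)) = complex_of_real \<omega> * (LINT t|lborel. E t * d t)"
      by (simp flip: mult.assoc)
    also have "\<dots> = (LINT t|lborel. E t * (complex_of_real \<omega> * d t))"
      by (subst integral_mult_right_zero[symmetric]) (simp add: mult_ac)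
    also have "\<dots> = (LINT t|lborel. (-1) ^ m / 2 * (E t * a t) - E t * b t)"
      unfolding stat[symmetric] by (simp add: algebra_simps)
    also have "\<dots> = (LINT t|lborel. (-1) ^ m / 2 * (E t * a t)) - (LINT t|lborel. E t * b t)"
      by (intro Bochner_Integration.integral_diff integrable_mult_right ia ib)
    also have "(LINT t|lborel. (-1) ^ m / 2 * (E t * a t)) = (-1) ^ m / 2 * (LINT t|lborel. E t * a t)"
      by (rule integral_mult_right_zero)
    also have "(LINT t|lborel. E t * a t) = (LINT t|lborel. LINT x|lborel. u x * E t * (partial_x ^^ (2 * m)) \<phi> t x)"
      unfolding Ea[symmetric] by (simp add: mult_ac)
    also have "(LINT t|lborel. E t * b t) = (LINT t|lborel. LINT x|lborel. nonlin p (u x * E t) * \<phi> t x)"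
      unfolding Eb[symmetric] nonlin_unit[OF cE] by (simp add: mult_ac)
    finally show ?thesis .
  qed
  show ?thesis unfolding solution_on_def E_def[symmetric]
  proof (intro conjI ballI allI impI)
    show "(\<lambda>x. u x * E t) \<in> sobolev m" for t unfolding uE by (rule sobolev_cmult[OF u])
    show "((\<lambda>s. sobolev_dist m (\<lambda>x. u x * E s) (\<lambda>x. u x * E t)) \<longlongrightarrow> 0) (at t within UNIV)" for t
    proof -
      have "((\<lambda>s. cmod (E s - E t) * sqrt (charge u + kin m u)) \<longlongrightarrow> cmod (E t - E t) * sqrt (charge u + kin m u)) (at t)"
        using Ec by (intro tendsto_intros) (simp add: continuous_on_eq_continuous_at isCont_def)
      thus ?thesis unfolding uE sobolev_dist_cmult[OF u] by simp
    qed
  qed (use weak in blast)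
qed

section \<open>Ground states and solitons\<close>

text \<open>
  The limit of a minimizing sequence. The negative energy matters later, in the compactness of
  arbitrary minimizing sequences.
\<close>

lemma minimizer_exists:
  assumes m: "1 \<le> m" and p: "2 < p" "p < 4 * real m + 2" and c: "0 < c"
  obtains g where "g \<in> sobolev m" "charge g = c" "energy m p g < 0"
    "\<And>v. v \<in> sobolev m \<Longrightarrow> charge v = c \<Longrightarrow> energy m p g \<le> energy m p v"
proof -
  define S where "S = energy m p ` {v \<in> sobolev m. charge v = c}"
  obtain v0 where v0: "v0 \<in> sobolev m" "charge v0 = c" "energy m p v0 < 0"
    by (rule negative_energy_exists[OF m p c]) (rule that)
  have v0S: "energy m p v0 \<in> S" using v0 by (auto simp: S_def)
  obtain D where D: "\<And>v. v \<in> sobolev m \<Longrightarrow> charge v \<le> c \<Longrightarrow> kin m v \<le> 4 * energy m p v + D"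
    by (rule energy_coercive[OF m p less_imp_le[OF c]]) (rule that)
  have "- D / 4 \<le> e" if "e \<in> S" for e
  proof -
    obtain v where v: "v \<in> sobolev m" "charge v = c" "e = energy m p v" using \<open>e \<in> S\<close> by (auto simp: S_def)
    thus ?thesis using D[OF v(1)] kin_nonneg[of m v] by simp
  qed
  hence bdd: "bdd_below S" by (rule bdd_belowI)
  define I where "I = Inf S"
  have inf: "I \<le> energy m p v" if "v \<in> sobolev m" "charge v = c" for v
    unfolding I_def by (rule cInf_lower[OF _ bdd]) (use that in \<open>auto simp: S_def\<close>)
  have I: "I < 0" using inf[OF v0(1,2)] v0(3) by simp
  have "\<exists>v. v \<in> sobolev m \<and> charge v = c \<and> energy m p v < I + 1 / real (Suc n)" for n
  proof -
    have "Inf S < I + 1 / real (Suc n)" by (simp add: I_def)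
    then obtain e where "e \<in> S" "e < I + 1 / real (Suc n)" using cInf_lessD[of S] v0S by blast
    thus ?thesis by (auto simp: S_def)
  qed
  then obtain v where v: "\<And>n. v n \<in> sobolev m" "\<And>n. charge (v n) = c" "\<And>n. energy m p (v n) < I + 1 / real (Suc n)"
    by metis
  have up: "(\<lambda>n. I + 1 / real (Suc n)) \<longlonglongrightarrow> I + 0"
    using LIMSEQ_inverse_real_of_nat by (intro tendsto_intros) (simp add: inverse_eq_divide)
  have lim: "(\<lambda>n. energy m p (v n)) \<longlonglongrightarrow> I"
  proof (rule tendsto_sandwich[OF _ _ tendsto_const[of I]])
    show "(\<lambda>n. I + 1 / real (Suc n)) \<longlonglongrightarrow> I" using up by simp
    show "\<forall>\<^sub>F n in sequentially. I \<le> energy m p (v n)"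
      by (intro always_eventually allI inf v)
    show "\<forall>\<^sub>F n in sequentially. energy m p (v n) \<le> I + 1 / real (Suc n)"
      by (intro always_eventually allI less_imp_le v)
  qed
  have "(\<lambda>n. charge (v n)) \<longlonglongrightarrow> c" by (simp add: v(2))
  note vc = this
  obtain r s g where "strict_mono (r :: nat \<Rightarrow> nat)" and g: "g \<in> sobolev m" "charge g = c" "energy m p g = I"
    and "(\<lambda>k. sobolev_dist m (translate (s k) (v (r k))) g) \<longlonglongrightarrow> 0"
    by (rule minimizing_sequences_compact[where u = v, OF m p c I _ v(1) vc lim], erule (1) inf, rule that)
  show thesis by (rule that[OF g(1,2)]) (use inf I g in auto)
qed

lemma sobolev_dist_translate:
  assumes m: "1 \<le> m" and u: "u \<in> sobolev m" and g: "g \<in> sobolev m"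
  shows "sobolev_dist m u (translate (- s) g) = sobolev_dist m (translate s u) g"
proof -
  let ?h = "\<lambda>x. u x - translate (- s) g x"
  have h: "?h \<in> sobolev m" by (intro sobolev_diff u translate_sobolev[OF m g])
  have "(\<lambda>x. translate s u x - g x) = translate s ?h" by (auto simp: translate_def)
  hence "sobolev_dist m (translate s u) g = sobolev_norm m (translate s ?h)"
    unfolding sobolev_dist_def by (rule arg_cong)
  also have "\<dots> = sobolev_norm m ?h"
    unfolding sobolev_norm_eq[OF h] sobolev_norm_eq[OF translate_sobolev(1)[OF m h]]
    by (simp add: charge_translate translate_sobolev(2)[OF m h])
  finally show ?thesis unfolding sobolev_dist_def by simp
qed

definition ground_states :: "nat \<Rightarrow> real \<Rightarrow> real \<Rightarrow> real \<Rightarrow> (real \<Rightarrow> complex) set" where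
  "ground_states m p e c = {u \<in> sobolev m. energy m p u = e \<and> \<bar>charge u\<bar> = c}"

lemma ground_states_iff: "u \<in> ground_states m p e c \<longleftrightarrow> u \<in> sobolev m \<and> energy m p u = e \<and> charge u = c"
  by (auto simp: ground_states_def charge_nonneg)

lemma ground_states_translate:
  assumes "1 \<le> m" "2 < p" "u \<in> ground_states m p e c" shows "translate s u \<in> ground_states m p e c"
proof -
  have u: "u \<in> sobolev m" "energy m p u = e" "charge u = c" using assms(3) by (auto simp: ground_states_iff)
  note t = translate_sobolev[OF assms(1) u(1), of s]
  have "energy m p (translate s u) = energy m p u"
    by (simp add: energy_eq[OF assms(1,2) u(1)] energy_eq[OF assms(1,2) t(1)] t(2) pot_translate)
  thus ?thesis using u t by (simp add: ground_states_iff charge_translate)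
qed

lemma sobolev_dist_nonneg: "0 \<le> sobolev_dist m u v"
  unfolding sobolev_dist_def sobolev_norm_def by (intro real_sqrt_ge_zero integral_nonneg_AE) auto

lemma sobolev_setdist_le: "v \<in> \<Gamma> \<Longrightarrow> sobolev_setdist m u \<Gamma> \<le> sobolev_dist m u v"
  unfolding sobolev_setdist_def by (rule cINF_lower) (auto intro!: bdd_belowI2[of _ 0] sobolev_dist_nonneg)

lemma sobolev_setdist_less:
  assumes "sobolev_setdist m u \<Gamma> < e" "\<Gamma> \<noteq> {}" obtains v where "v \<in> \<Gamma>" "sobolev_dist m u v < e"
proof -
  have "bdd_below (sobolev_dist m u ` \<Gamma>)" by (auto intro!: bdd_belowI2[of _ 0] sobolev_dist_nonneg)
  thus thesis using assms that unfolding sobolev_setdist_def by (auto simp: cINF_less_iff)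
qed

lemma globally_well_posed_flow:
  assumes gwp: "globally_well_posed m p T \<gamma>" and u: "u \<in> sobolev m" and t: "0 \<le> t"
  shows "\<gamma> t u \<in> sobolev m" "energy m p (\<gamma> t u) = energy m p u" "charge (\<gamma> t u) = charge u"
proof -
  have "T u = \<infinity>" using gwp u by (auto simp: globally_well_posed_def global_states_def)
  moreover have "T u = Sup {ereal \<tau> |\<tau>. 0 \<le> \<tau> \<and> well_behaved_until m p T \<gamma> u \<tau>}"
    using gwp u unfolding globally_well_posed_def is_flow_def by blast
  ultimately have "ereal t < Sup {ereal \<tau> |\<tau>. 0 \<le> \<tau> \<and> well_behaved_until m p T \<gamma> u \<tau>}" by simp
  then obtain \<tau> where \<tau>: "t < \<tau>" "well_behaved_until m p T \<gamma> u \<tau>"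
    unfolding less_Sup_iff by auto
  have ti: "t \<in> {0..<\<tau>}" using t \<tau>(1) by simp
  show "\<gamma> t u \<in> sobolev m"
    using \<tau>(2) ti unfolding well_behaved_until_def cauchy_solution_def solution_on_def by blast
  show "energy m p (\<gamma> t u) = energy m p u" "charge (\<gamma> t u) = charge u"
    using \<tau>(2) ti unfolding well_behaved_until_def by blast+
qed

context
  fixes m :: nat and p c I :: real
  assumes m: "1 \<le> m" and p: "2 < p" "p < 4 * real m + 2" and c: "0 < c" and I: "I < 0"
    and inf: "\<And>v. v \<in> sobolev m \<Longrightarrow> charge v = c \<Longrightarrow> I \<le> energy m p v"
begin

lemma ground_states_compact: "compact_up_to_translations m (ground_states m p I c)"
  unfolding compact_up_to_translations_def
proof (intro allI impI)
  fix u :: "nat \<Rightarrow> real \<Rightarrow> complex" assume "\<forall>n. u n \<in> ground_states m p I c"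
  hence u: "\<And>n. u n \<in> sobolev m" "\<And>n. charge (u n) = c" "\<And>n. energy m p (u n) = I" by (auto simp: ground_states_iff)
  have l: "(\<lambda>n. charge (u n)) \<longlonglongrightarrow> c" "(\<lambda>n. energy m p (u n)) \<longlonglongrightarrow> I" by (simp_all add: u)
  obtain r s g where "strict_mono (r :: nat \<Rightarrow> nat)" "g \<in> sobolev m" "charge g = c" "energy m p g = I"
    "(\<lambda>k. sobolev_dist m (translate (s k) (u (r k))) g) \<longlonglongrightarrow> 0"
    by (rule minimizing_sequences_compact[where u = u, OF m p c I _ u(1) l], erule (1) inf, rule that)
  thus "\<exists>r \<tau>. strict_mono (r :: nat \<Rightarrow> nat) \<and> (\<exists>w\<in>sobolev m. (\<lambda>k. sobolev_dist m (\<lambda>x. u (r k) (x - \<tau> k)) w) \<longlonglongrightarrow> 0)"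
    unfolding translate_def[abs_def] by blast
qed

text \<open>
  From a sequence of orbits that leave a neighbourhood of the ground states, although they start
  closer and closer to them, take the points $z_n$ where they have left. By conservation $z_n$ is a
  minimizing sequence, and a subsequence comes close to translates of a ground state.
\<close>

lemma ground_states_stable:
  assumes gwp: "globally_well_posed m p T \<gamma>" and ne: "ground_states m p I c \<noteq> {}"
  shows "stable_set m T \<gamma> (ground_states m p I c)"
  unfolding stable_set_def
proof (rule ccontr)
  let ?\<Gamma> = "ground_states m p I c"
  assume "\<not> (\<forall>\<epsilon>>0. \<exists>\<eta>>0. \<forall>u\<in>sobolev m. sobolev_setdist m u ?\<Gamma> \<le> \<eta> \<longrightarrow>
        (\<forall>t. 0 \<le> t \<and> ereal t < T u \<longrightarrow> sobolev_setdist m (\<gamma> t u) ?\<Gamma> \<le> \<epsilon>))"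
  then obtain \<epsilon> where \<epsilon>: "0 < \<epsilon>" and bad: "\<And>\<eta>. 0 < \<eta> \<Longrightarrow> \<exists>u\<in>sobolev m. sobolev_setdist m u ?\<Gamma> \<le> \<eta> \<and>
      (\<exists>t. 0 \<le> t \<and> ereal t < T u \<and> \<epsilon> < sobolev_setdist m (\<gamma> t u) ?\<Gamma>)"
    by (auto simp: not_le)
  have "\<exists>u t. u \<in> sobolev m \<and> sobolev_setdist m u ?\<Gamma> \<le> 1 / real (Suc n) \<and> 0 \<le> t \<and> \<epsilon> < sobolev_setdist m (\<gamma> t u) ?\<Gamma>" for n
    using bad[of "1 / real (Suc n)"] by auto
  then obtain u t where u: "\<And>n. u n \<in> sobolev m" "\<And>n. sobolev_setdist m (u n) ?\<Gamma> \<le> 1 / real (Suc n)"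
    and t: "\<And>n. 0 \<le> t n" "\<And>n. \<epsilon> < sobolev_setdist m (\<gamma> (t n) (u n)) ?\<Gamma>" by metis
  have "\<exists>v. v \<in> ?\<Gamma> \<and> sobolev_dist m (u n) v < 2 / real (Suc n)" for n
  proof -
    have "sobolev_setdist m (u n) ?\<Gamma> < 2 / real (Suc n)"
      by (rule le_less_trans[OF u(2)[of n]]) (simp add: divide_strict_right_mono)
    thus ?thesis by (rule sobolev_setdist_less[OF _ ne]) blast
  qed
  then obtain v where v: "\<And>n. v n \<in> ?\<Gamma>" "\<And>n. sobolev_dist m (u n) (v n) < 2 / real (Suc n)" by metis
  have vS: "v n \<in> sobolev m" "energy m p (v n) = I" "charge (v n) = c" for n using v(1)[of n] by (auto simp: ground_states_iff)
  obtain D where D: "\<And>v. v \<in> sobolev m \<Longrightarrow> charge v \<le> c \<Longrightarrow> kin m v \<le> 4 * energy m p v + D"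
    by (rule energy_coercive[OF m p less_imp_le[OF c]]) (rule that)
  have vA: "charge (v n) + kin m (v n) \<le> c + (4 * I + D)" for n using D[OF vS(1)[of n]] vS(2,3)[of n] by simp
  have "(\<lambda>n. 2 * inverse (real (Suc n))) \<longlonglongrightarrow> 2 * 0" by (intro tendsto_intros LIMSEQ_inverse_real_of_nat)
  hence "(\<lambda>n. 2 / real (Suc n)) \<longlonglongrightarrow> 0" by (simp add: divide_inverse)
  hence dist0: "(\<lambda>n. sobolev_dist m (u n) (v n)) \<longlonglongrightarrow> 0"
    by (rule Lim_null_comparison[rotated]) (use v(2) in \<open>auto intro!: always_eventually less_imp_le simp: sobolev_dist_nonneg\<close>)
  note close = energy_charge_uniformly_continuous[where u = u and v = v, OF m p(1) u(1) vS(1) vA dist0]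
  define z where "z n = \<gamma> (t n) (u n)" for n
  have z: "z n \<in> sobolev m" "energy m p (z n) = energy m p (u n)" "charge (z n) = charge (u n)" for n
    unfolding z_def using globally_well_posed_flow[OF gwp u(1) t(1)] by auto
  have zl: "(\<lambda>n. charge (z n)) \<longlonglongrightarrow> c" "(\<lambda>n. energy m p (z n)) \<longlonglongrightarrow> I"
    using tendsto_add[OF close(1) tendsto_const[of c]] tendsto_add[OF close(2) tendsto_const[of I]] by (simp_all add: z vS)
  obtain r s g where "strict_mono (r :: nat \<Rightarrow> nat)" and g: "g \<in> sobolev m" "charge g = c" "energy m p g = I"
    and lim: "(\<lambda>k. sobolev_dist m (translate (s k) (z (r k))) g) \<longlonglongrightarrow> 0"
    by (rule minimizing_sequences_compact[where u = z, OF m p c I _ z(1) zl], erule (1) inf, rule that)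
  obtain k where k: "sobolev_dist m (translate (s k) (z (r k))) g < \<epsilon>"
    using order_tendstoD(2)[OF lim \<epsilon>] by (auto simp: eventually_sequentially)
  have "translate (- s k) g \<in> ?\<Gamma>" using g by (intro ground_states_translate[OF m p(1)]) (simp add: ground_states_iff)
  hence "sobolev_setdist m (z (r k)) ?\<Gamma> \<le> sobolev_dist m (z (r k)) (translate (- s k) g)" by (rule sobolev_setdist_le)
  also have "\<dots> < \<epsilon>" unfolding sobolev_dist_translate[OF m z(1) g(1)] by (rule k)
  finally show False using t(2)[of "r k"] by (simp add: z_def)
qed

end

theorem hylomorphic_soliton_of_minimizer:
  assumes m: "1 \<le> m" and p: "2 < p" "p < 4 * real m + 2" and c: "0 < c"
    and gwp: "globally_well_posed m p T \<gamma>"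
    and g: "g \<in> sobolev m" "charge g = c" "energy m p g < 0"
    and min: "\<And>v. v \<in> sobolev m \<Longrightarrow> charge v = c \<Longrightarrow> energy m p g \<le> energy m p v"
  shows "hylomorphic_soliton m p T \<gamma> g"
proof -
  let ?\<Gamma> = "ground_states m p (energy m p g) c"
  have gG: "g \<in> ?\<Gamma>" using g by (simp add: ground_states_iff)
  have "soliton_set m T \<gamma> ?\<Gamma>" unfolding soliton_set_def
  proof (intro conjI)
    show "?\<Gamma> \<subseteq> global_states m T" using gwp by (auto simp: globally_well_posed_def ground_states_def)
    show "invariant_set T \<gamma> ?\<Gamma>"
      unfolding invariant_set_def using globally_well_posed_flow[OF gwp] by (auto simp: ground_states_iff)
    show "stable_set m T \<gamma> ?\<Gamma>" by (rule ground_states_stable[OF m p c g(3) min gwp]) (use gG in auto)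
    show "compact_up_to_translations m ?\<Gamma>" by (rule ground_states_compact[OF m p c g(3) min])
  qed
  thus ?thesis unfolding hylomorphic_soliton_def
    using gG g min
    by (intro exI[of _ ?\<Gamma>] exI[of _ "energy m p g"] exI[of _ c]) (auto simp: ground_states_def charge_nonneg)
qed

theorem theorem3:
  fixes m :: nat and p :: real
    and T :: "(real \<Rightarrow> complex) \<Rightarrow> ereal"
    and \<gamma> :: "real \<Rightarrow> (real \<Rightarrow> complex) \<Rightarrow> real \<Rightarrow> complex"
  assumes "1 \<le> m"
    and "globally_well_posed m p T \<gamma>"
    and "2 < p" and "p < 4 * real m + 2"
  shows "\<exists>\<delta>max>0. \<exists>u :: real \<Rightarrow> real \<Rightarrow> complex.
    (\<forall>\<delta>\<in>{0<..<\<delta>max}.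
       hylomorphic_soliton m p T \<gamma> (u \<delta>) \<and>
       \<not> (AE x in lborel. u \<delta> x = 0) \<and>
       (\<exists>\<omega> :: real.
          stationary_solution m p \<omega> (u \<delta>) \<and>
          solution_on m p UNIV (\<lambda>t x. u \<delta> x * exp (- \<i> * complex_of_real (\<omega> * t))))) \<and>
    (\<forall>\<delta>\<in>{0<..<\<delta>max}. \<forall>\<delta>'\<in>{0<..<\<delta>max}.
       \<delta> \<noteq> \<delta>' \<longrightarrow> \<not> (AE x in lborel. u \<delta> x = u \<delta>' x))"
proof -
  note m = assms(1) and p = assms(3,4)
  have "\<forall>c. \<exists>g. 0 < c \<longrightarrow> g \<in> sobolev m \<and> charge g = c \<and> energy m p g < 0 \<and>
      (\<forall>v. v \<in> sobolev m \<longrightarrow> charge v = c \<longrightarrow> energy m p g \<le> energy m p v)"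
    using minimizer_exists[OF m p] by metis
  then obtain u where u: "\<And>c. 0 < c \<Longrightarrow> u c \<in> sobolev m" "\<And>c. 0 < c \<Longrightarrow> charge (u c) = c" "\<And>c. 0 < c \<Longrightarrow> energy m p (u c) < 0"
    and min: "\<And>c v. 0 < c \<Longrightarrow> v \<in> sobolev m \<Longrightarrow> charge v = c \<Longrightarrow> energy m p (u c) \<le> energy m p v"
    by metis
  have soliton: "hylomorphic_soliton m p T \<gamma> (u \<delta>)" if "0 < \<delta>" for \<delta>
    by (rule hylomorphic_soliton_of_minimizer[OF m p that assms(2) u(1)[OF that] u(2)[OF that] u(3)[OF that] min[OF that]])
  have nonzero: "\<not> (AE x in lborel. u \<delta> x = 0)" if "0 < \<delta>" for \<delta>
    using charge_eq_0_iff[OF sobolev_L2[OF u(1)[OF that]]] u(2)[OF that] that by simp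
  have waves: "\<exists>\<omega>. stationary_solution m p \<omega> (u \<delta>) \<and> solution_on m p UNIV (\<lambda>t x. u \<delta> x * exp (- \<i> * complex_of_real (\<omega> * t)))"
    if d: "0 < \<delta>" for \<delta>
  proof -
    have "stationary_solution m p ((kin m (u \<delta>) / 2 - pot p (u \<delta>)) / \<delta>) (u \<delta>)"
      by (rule minimizer_stationary[OF m p(1) d u(1)[OF d] u(2)[OF d] min[OF d]])
    thus ?thesis using standing_wave_solution[OF m p(1) u(1)[OF d]] by blast
  qed
  have distinct: "\<not> (AE x in lborel. u \<delta> x = u \<delta>' x)" if "0 < \<delta>" "0 < \<delta>'" "\<delta> \<noteq> \<delta>'" for \<delta> \<delta>'
  proof
    assume "AE x in lborel. u \<delta> x = u \<delta>' x"
    hence "charge (u \<delta>) = charge (u \<delta>')"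
      by (intro charge_cong_AE L2_measurable sobolev_L2[OF u(1)] that)
    thus False using u(2) that by simp
  qed
  \<comment> \<open>every positive charge has a ground state, so any value serves as the bound\<close>
  show ?thesis
    by (intro exI[of _ "1 :: real"] conjI exI[of _ u]) (use soliton nonzero waves distinct in auto)
qed

end
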